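(* Let $F$ be a field of characteristic $0$, $V=V_0\oplus V_1$ a finite-dimensional $\mathbb{Z}_2$-graded $F$-vector space, and $\Omega\subseteq\mathbb{Y}$ a filter with corresponding algebra $A_\Omega=A_\Omega(V)$. Let $d_n=\dim A_\Omega(n)$. Then there exists an integer $\alpha$ with $0\le\alpha\le\dim V_0+\dim V_1$ such that $\mathrm{Exp}(A_\Omega)=\mathrm{Exp}(d_n)=\alpha$.
   Context: $\mathbb{Y}$ is the set of all partitions, $\mu\subseteq\lambda$ meaning $\mu_i\le\lambda_i$ for all $i$; a filter is a subset $\Omega\subseteq\mathbb{Y}$ with $\mu\in\Omega,\ \mu\subseteq\lambda\Rightarrow\lambda\in\Omega$. $T(V)=\bigoplus_nT^n(V)$ is the tensor algebra. $S_n$ acts on $T^n(V)$ by the signed place-permutation action ($(z_1\otimes\cdots\otimes z_n)*\sigma=\pm z_{\sigma(1)}\otimes\cdots\otimes z_{\sigma(n)}$ for homogeneous $z_i$, the sign being $(-1)^N$ with $N$ the number of pairs of odd factors whose relative order is reversed), and for $\lambda\vdash n$, $W_\lambda$ is the isotypic component of $\chi^\lambda$ in $T^n(V)$. $I_\Omega=\bigoplus_{\lambda\in\Omega}W_\lambda$ is a two-sided ideal of $T(V)$, $A_\Omega=T(V)/I_\Omega$, graded by $A_\Omega(n)=T^n(V)/(I_\Omega\cap T^n(V))\cong\bigoplus_{\lambda\vdash n,\lambda\notin\Omega}W_\lambda$. For a sequence $d_n$ and real $\alpha$: $\mathrm{Exp}(d_n)\ge\alpha$ means there is a polynomial $p$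 with $p(n)>0$ and $d_n\ge p(n)\alpha^n$ for all large $n$; $\mathrm{Exp}(d_n)\le\alpha$ is defined analogously with $d_n\le p(n)\alpha^n$; $\mathrm{Exp}(d_n)=\alpha$ means both hold; also $\mathrm{Exp}(d_n)=0$ if $d_n=0$ for all large $n$. *)

theory Defs
  imports
    Complex_Main
    "HOL-Library.Function_Algebras"
    "HOL-Combinatorics.Permutations"
    "HOL-Computational_Algebra.Polynomial"
begin

section \<open>Exponential growth\<close>

definition Exp_ge :: "(nat \<Rightarrow> real) \<Rightarrow> real \<Rightarrow> bool" where
  "Exp_ge d \<alpha> \<longleftrightarrow>
     (\<exists>p :: real poly. eventually (\<lambda>n. poly p (real n) > 0 \<and> d n \<ge> poly p (real n) * \<alpha> ^ n) sequentially)"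

definition Exp_le :: "(nat \<Rightarrow> real) \<Rightarrow> real \<Rightarrow> bool" where
  "Exp_le d \<alpha> \<longleftrightarrow>
     (\<exists>p :: real poly. eventually (\<lambda>n. poly p (real n) > 0 \<and> d n \<le> poly p (real n) * \<alpha> ^ n) sequentially)"

definition Exp_eq :: "(nat \<Rightarrow> real) \<Rightarrow> real \<Rightarrow> bool" where
  "Exp_eq d \<alpha> \<longleftrightarrow>
     (Exp_ge d \<alpha> \<and> Exp_le d \<alpha>) \<or> (\<alpha> = 0 \<and> eventually (\<lambda>n. d n = 0) sequentially)"


section \<open>Partitions and filters\<close>

text \<open>
  A partition is the function of its parts: \<open>\<nu> i\<close> is the part with (0-based) index \<open>i\<close>,
  and \<open>\<nu> i = 0\<close> from some index on. Containment of diagrams is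
  then the pointwise order \<open>\<mu> \<le> \<nu>\<close>.
\<close>

definition partitions :: "(nat \<Rightarrow> nat) set" where
  "partitions = {\<nu>. antimono \<nu> \<and> finite {i. \<nu> i \<noteq> 0}}"

definition psize :: "(nat \<Rightarrow> nat) \<Rightarrow> nat" where
  "psize \<nu> = (\<Sum>i | \<nu> i \<noteq> 0. \<nu> i)"

definition partition_filter :: "(nat \<Rightarrow> nat) set \<Rightarrow> bool" where
  "partition_filter \<Omega> \<longleftrightarrow>
     \<Omega> \<subseteq> partitions \<and> (\<forall>\<mu>\<in>\<Omega>. \<forall>\<nu>\<in>partitions. \<mu> \<le> \<nu> \<longrightarrow> \<nu> \<in> \<Omega>)"


section \<open>Spaces of functions and quotient spaces\<close>

definition fscale :: "'f::field \<Rightarrow> ('x \<Rightarrow> 'f) \<Rightarrow> 'x \<Rightarrow> 'f" where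
  "fscale c t = (\<lambda>x. c * t x)"

interpretation fun_vs: vector_space "fscale :: 'f::field \<Rightarrow> ('x \<Rightarrow> 'f) \<Rightarrow> 'x \<Rightarrow> 'f"
  by unfold_locales (auto simp: fscale_def fun_eq_iff algebra_simps)

text \<open>
  \<open>B\<close> is a finite set of vectors of \<open>U\<close> whose cosets form a basis of \<open>U / W\<close> (with
  different elements of \<open>B\<close> having different cosets): every coset is a unique
  linear combination of the cosets of the elements of \<open>B\<close>.
\<close>

definition quotient_basis ::
    "('f::field \<Rightarrow> 'v::ab_group_add \<Rightarrow> 'v) \<Rightarrow> 'v set \<Rightarrow> 'v set \<Rightarrow> 'v set \<Rightarrow> bool" where
  "quotient_basis scale U W B \<longleftrightarrow>
     finite B \<and> B \<subseteq> U \<and>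
     (\<forall>u\<in>U. \<exists>!c. (\<forall>x. x \<notin> B \<longrightarrow> c x = 0) \<and> u - (\<Sum>x\<in>B. scale (c x) x) \<in> W)"

definition quotient_dim ::
    "('f::field \<Rightarrow> 'v::ab_group_add \<Rightarrow> 'v) \<Rightarrow> 'v set \<Rightarrow> 'v set \<Rightarrow> nat" where
  "quotient_dim scale U W = (THE d. \<exists>B. quotient_basis scale U W B \<and> card B = d)"

lemma (in vector_space) quotient_dim_eq:
  assumes U: "local.subspace U" and W: "local.subspace W" "W \<subseteq> U"
    and fin: "finite A" "U \<subseteq> local.span A"
  shows "quotient_dim scale U W = local.dim U - local.dim W"
proof -
  obtain C where C: "C \<subseteq> W" "local.independent C" "W \<subseteq> local.span C"
    using local.maximal_independent_subset[of W] by blast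
  have spC: "local.span C = W"
    using C W(1) local.span_minimal by blast
  obtain D where D: "C \<subseteq> D" "D \<subseteq> U" "local.independent D" "U \<subseteq> local.span D"
    using local.maximal_independent_subset_extend[of C U] C W by blast
  have finD: "finite D"
    using local.independent_span_bound[of A D] fin D by blast
  have dimU: "local.dim U = card D" and dimW: "local.dim W = card C"
    using local.basis_card_eq_dim[of D U] local.basis_card_eq_dim[of C W] C D by auto
  have finC: "finite C" using finD D(1) finite_subset by blast
  have card_eq: "card B = local.dim U - local.dim W" if B: "quotient_basis scale U W B" for B
  proof -
    have finB: "finite B" and BU: "B \<subseteq> U"
      and ex: "\<And>u. u \<in> U \<Longrightarrow> \<exists>!c. (\<forall>x. x \<notin> B \<longrightarrow> c x = 0) \<and> u - (\<Sum>x\<in>B. scale (c x) x) \<in> W"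
      using B unfolding quotient_basis_def by auto
    have unique: "c = d" if "u \<in> U"
      and c: "(\<forall>x. x \<notin> B \<longrightarrow> c x = 0) \<and> u - (\<Sum>x\<in>B. scale (c x) x) \<in> W"
      and d: "(\<forall>x. x \<notin> B \<longrightarrow> d x = 0) \<and> u - (\<Sum>x\<in>B. scale (d x) x) \<in> W" for u c d
    proof (rule ex1E[OF ex[OF \<open>u \<in> U\<close>]])
      fix e
      assume e: "\<forall>y. (\<forall>x. x \<notin> B \<longrightarrow> y x = 0) \<and> u - (\<Sum>x\<in>B. scale (y x) x) \<in> W \<longrightarrow> y = e"
      show "c = d"
        using e[THEN spec, THEN mp, OF c] e[THEN spec, THEN mp, OF d] by simp
    qed
    have uniq: "\<forall>x\<in>B. c x = 0" if c: "(\<Sum>x\<in>B. scale (c x) x) \<in> W" for c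
    proof -
      let ?c = "\<lambda>x. if x \<in> B then c x else 0"
      have "(\<Sum>x\<in>B. scale (?c x) x) = (\<Sum>x\<in>B. scale (c x) x)"
        by (rule sum.cong) auto
      then have 1: "(\<forall>x. x \<notin> B \<longrightarrow> ?c x = 0) \<and> 0 - (\<Sum>x\<in>B. scale (?c x) x) \<in> W"
        using local.subspace_neg[OF W(1) c] by simp
      have 2: "(\<forall>x. x \<notin> B \<longrightarrow> (\<lambda>_. 0::'a) x = 0) \<and> 0 - (\<Sum>x\<in>B. scale ((\<lambda>_. 0) x) x) \<in> W"
        using local.subspace_0[OF W(1)] by simp
      have eq: "?c = (\<lambda>_. 0)"
        by (rule unique[of 0]) (use 1 2 local.subspace_0[OF U] in blast)+
      show ?thesis
      proof
        fix x assume "x \<in> B"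
        then show "c x = 0" using fun_cong[OF eq, of x] by simp
      qed
    qed
    have disj: "B \<inter> C = {}"
    proof (rule ccontr)
      assume "B \<inter> C \<noteq> {}"
      then obtain b where b: "b \<in> B" "b \<in> C" by blast
      have "(\<Sum>x\<in>B. scale (if x = b then 1 else 0) x) = b"
      proof -
        have "(\<Sum>x\<in>B. scale (if x = b then 1 else 0) x) = (\<Sum>x\<in>B. if x = b then x else 0)"
          by (rule sum.cong) auto
        then show ?thesis using finB b by simp
      qed
      then have "(\<Sum>x\<in>B. scale (if x = b then 1 else 0) x) \<in> W"
        using b(2) C(1) by auto
      from uniq[OF this] show False using b(1) by auto
    qed
    have ind: "local.independent (B \<union> C)"
    proof (rule local.independent_if_scalars_zero)
      show "finite (B \<union> C)" using finB finC by simp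
      fix f x
      assume s: "(\<Sum>x\<in>B \<union> C. scale (f x) x) = 0" and x: "x \<in> B \<union> C"
      have s': "(\<Sum>x\<in>B. scale (f x) x) + (\<Sum>x\<in>C. scale (f x) x) = 0"
        using s finB finC disj by (simp add: sum.union_disjoint)
      have inW: "(\<Sum>x\<in>C. scale (f x) x) \<in> W"
        unfolding spC[symmetric] by (intro local.span_sum local.span_scale local.span_base)
      have "(\<Sum>x\<in>B. scale (f x) x) = - (\<Sum>x\<in>C. scale (f x) x)"
        using s' by (simp add: eq_neg_iff_add_eq_0)
      then have fB: "\<forall>x\<in>B. f x = 0"
        using uniq local.subspace_neg[OF W(1) inW] by simp
      then have "(\<Sum>x\<in>C. scale (f x) x) = 0" using s' by simp
      then have "\<forall>x\<in>C. f x = 0"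
        using local.independentD[OF C(2) finC order_refl, of f] by blast
      then show "f x = 0" using fB x by blast
    qed
    have "U \<subseteq> local.span (B \<union> C)"
    proof
      fix u assume "u \<in> U"
      then obtain c where c: "u - (\<Sum>x\<in>B. scale (c x) x) \<in> W" using ex by blast
      have 1: "u - (\<Sum>x\<in>B. scale (c x) x) \<in> local.span (B \<union> C)"
        using c spC local.span_mono[of C "B \<union> C"] by auto
      have 2: "(\<Sum>x\<in>B. scale (c x) x) \<in> local.span (B \<union> C)"
        by (intro local.span_sum local.span_scale local.span_base) auto
      show "u \<in> local.span (B \<union> C)" using local.span_add[OF 1 2] by simp
    qed
    moreover have "B \<union> C \<subseteq> U" using BU C W by blast
    ultimately have "card (B \<union> C) = local.dim U"
      using local.basis_card_eq_dim ind by blast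
    then show ?thesis using dimW finB finC disj by (simp add: card_Un_disjoint)
  qed
  have "quotient_basis scale U W (D - C)"
    unfolding quotient_basis_def
  proof (intro conjI ballI)
    show "finite (D - C)" "D - C \<subseteq> U" using finD D by auto
    fix u assume "u \<in> U"
    then have u: "u \<in> local.span D" using D by auto
    let ?R = "local.representation D u"
    have "u = (\<Sum>x\<in>D. scale (?R x) x)"
      using local.sum_representation_eq[OF D(3) u finD] by simp
    also have "\<dots> = (\<Sum>x\<in>D - C. scale (?R x) x) + (\<Sum>x\<in>C. scale (?R x) x)"
      using sum.subset_diff[OF D(1) finD] by blast
    finally have eq: "u - (\<Sum>x\<in>D - C. scale (?R x) x) = (\<Sum>x\<in>C. scale (?R x) x)"
      by (simp add: algebra_simps)
    have inW: "(\<Sum>x\<in>C. scale (?R x) x) \<in> W"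
      unfolding spC[symmetric] by (intro local.span_sum local.span_scale local.span_base)
    show "\<exists>!c. (\<forall>x. x \<notin> D - C \<longrightarrow> c x = 0) \<and> u - (\<Sum>x\<in>D - C. scale (c x) x) \<in> W"
    proof (rule ex_ex1I)
      let ?c = "\<lambda>x. if x \<in> D - C then ?R x else 0"
      have "(\<Sum>x\<in>D - C. scale (?c x) x) = (\<Sum>x\<in>D - C. scale (?R x) x)"
        by (rule sum.cong) auto
      then have "u - (\<Sum>x\<in>D - C. scale (?c x) x) \<in> W"
        using eq inW by (simp only:)
      then show "\<exists>c. (\<forall>x. x \<notin> D - C \<longrightarrow> c x = 0) \<and> u - (\<Sum>x\<in>D - C. scale (c x) x) \<in> W"
        by (intro exI[of _ ?c] conjI) simp_all
    next
      fix c d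
      assume c: "(\<forall>x. x \<notin> D - C \<longrightarrow> c x = 0) \<and> u - (\<Sum>x\<in>D - C. scale (c x) x) \<in> W"
        and d: "(\<forall>x. x \<notin> D - C \<longrightarrow> d x = 0) \<and> u - (\<Sum>x\<in>D - C. scale (d x) x) \<in> W"
      have "(u - (\<Sum>x\<in>D - C. scale (d x) x)) - (u - (\<Sum>x\<in>D - C. scale (c x) x)) \<in> W"
        by (rule local.subspace_diff[OF W(1) conjunct2[OF d] conjunct2[OF c]])
      then have "(\<Sum>x\<in>D - C. scale (c x - d x) x) \<in> local.span C"
        unfolding spC by (simp add: local.scale_left_diff_distrib sum_subtractf)
      then obtain e where e: "(\<Sum>x\<in>D - C. scale (c x - d x) x) = (\<Sum>x\<in>C. scale (e x) x)"
        using local.span_finite[OF finC] by auto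
      let ?f = "\<lambda>x. if x \<in> C then - e x else c x - d x"
      have "(\<Sum>x\<in>D. scale (?f x) x) = (\<Sum>x\<in>D - C. scale (?f x) x) + (\<Sum>x\<in>C. scale (?f x) x)"
        using sum.subset_diff[OF D(1) finD] by blast
      also have "(\<Sum>x\<in>D - C. scale (?f x) x) = (\<Sum>x\<in>D - C. scale (c x - d x) x)"
        by (rule sum.cong) auto
      also have "(\<Sum>x\<in>C. scale (?f x) x) = - (\<Sum>x\<in>C. scale (e x) x)"
        by (simp add: sum_negf)
      finally have "(\<Sum>x\<in>D. scale (?f x) x) = 0" using e by simp
      then have f0: "\<And>x. x \<in> D \<Longrightarrow> ?f x = 0"
        using local.independentD[OF D(3) finD order_refl, of ?f] by blast
      show "c = d"
      proof
        fix x show "c x = d x"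
        proof (cases "x \<in> D - C")
          case True then show ?thesis using f0[of x] by simp
        next
          case False then show ?thesis using c d by simp
        qed
      qed
    qed
  qed
  then have "\<exists>B. quotient_basis scale U W B \<and> card B = local.dim U - local.dim W"
    using card_eq by blast
  then show ?thesis
    unfolding quotient_dim_def using card_eq by (intro the_equality) auto
qed


section \<open>The symmetric group and its Specht modules\<close>

text \<open>
  \<open>S\<^sub>n\<close> is the set of permutations of \<open>{0,...,n-1}\<close> with product
  \<open>\<sigma> \<circ> \<tau>\<close>, and all modules are right modules. An element of the group algebra
  \<open>F S\<^sub>n\<close> is given by its coefficient function.
\<close>

definition sym_group :: "nat \<Rightarrow> (nat \<Rightarrow> nat) set" where
  "sym_group n = {\<sigma>. \<sigma> permutes {..<n}}"

definition group_alg_act :: "(nat \<Rightarrow> nat) \<Rightarrow> ((nat \<Rightarrow> nat) \<Rightarrow> 'f) \<Rightarrow> (nat \<Rightarrow> nat) \<Rightarrow> 'f" where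
  \<comment> \<open>right multiplication by \<open>\<sigma>\<close>: the coefficient of \<open>\<tau>\<close> in \<open>a \<sigma>\<close> is that of \<open>\<tau> \<sigma>\<^sup>-\<^sup>1\<close> in \<open>a\<close>\<close>
  "group_alg_act \<sigma> a = (\<lambda>\<tau>. a (\<tau> \<circ> inv \<sigma>))"

text \<open>
  The entry in row \<open>i\<close>, column \<open>j\<close> of the tableau of shape \<open>\<nu>\<close> filled with
  \<open>0, 1, 2, ...\<close> row by row.
\<close>

definition tableau :: "(nat \<Rightarrow> nat) \<Rightarrow> nat \<Rightarrow> nat \<Rightarrow> nat" where
  "tableau \<nu> i j = (\<Sum>r<i. \<nu> r) + j"

definition row_group :: "(nat \<Rightarrow> nat) \<Rightarrow> (nat \<Rightarrow> nat) set" where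
  "row_group \<nu> = {\<sigma> \<in> sym_group (psize \<nu>).
     \<forall>i. \<sigma> ` {tableau \<nu> i j | j. j < \<nu> i} = {tableau \<nu> i j | j. j < \<nu> i}}"

definition column_group :: "(nat \<Rightarrow> nat) \<Rightarrow> (nat \<Rightarrow> nat) set" where
  "column_group \<nu> = {\<sigma> \<in> sym_group (psize \<nu>).
     \<forall>j. \<sigma> ` {tableau \<nu> i j | i. j < \<nu> i} = {tableau \<nu> i j | i. j < \<nu> i}}"

text \<open>The element \<open>\<Sum> sign q \<cdot> p q\<close>, summed over row permutations \<open>p\<close> and column permutations \<open>q\<close>.\<close>

definition young_symmetrizer :: "(nat \<Rightarrow> nat) \<Rightarrow> (nat \<Rightarrow> nat) \<Rightarrow> 'f::field" where
  "young_symmetrizer \<nu> \<tau> =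
     (\<Sum>(p, q) | p \<in> row_group \<nu> \<and> q \<in> column_group \<nu> \<and> p \<circ> q = \<tau>. of_int (sign q))"

text \<open>
  The right ideal of \<open>F S\<^sub>n\<close> generated by the Young symmetrizer: the
  irreducible module with character \<open>\<chi>\<^sup>\<nu>\<close> (for \<open>\<nu> = (n)\<close> it is the trivial one).
\<close>

definition specht :: "(nat \<Rightarrow> nat) \<Rightarrow> ((nat \<Rightarrow> nat) \<Rightarrow> 'f::field) set" where
  "specht \<nu> = fun_vs.span ((\<lambda>\<sigma>. group_alg_act \<sigma> (young_symmetrizer \<nu>)) ` sym_group (psize \<nu>))"


section \<open>Tensor powers of a super vector space\<close>

locale super_vector_space = vector_space scale
  for scale :: "'f::field_char_0 \<Rightarrow> 'v::ab_group_add \<Rightarrow> 'v" +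
  fixes V0 V1 :: "'v set"
  assumes subspace_V0: "subspace V0" and subspace_V1: "subspace V1"
    and V0_inter_V1: "V0 \<inter> V1 = {0}"
    and V0_plus_V1: "\<And>v. \<exists>a\<in>V0. \<exists>b\<in>V1. v = a + b"
begin

text \<open>
  A vector is split into its components in \<open>V0\<close> (parity \<open>False\<close>, even) and
  \<open>V1\<close> (parity \<open>True\<close>, odd).
\<close>

definition even_part :: "'v \<Rightarrow> 'v" where
  "even_part v = (THE a. a \<in> V0 \<and> v - a \<in> V1)"

definition component :: "bool \<Rightarrow> 'v \<Rightarrow> 'v" where
  "component b v = (if b then v - even_part v else even_part v)"

text \<open>
  A function on lists of vectors is multilinear if, for every length \<open>n\<close>, its restriction to
  lists of length \<open>n\<close> is an \<open>n\<close>-linear form. The tensor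
  \<open>x\<^sub>1 \<otimes> ... \<otimes> x\<^sub>n\<close> is realised as evaluation of multilinear functions at
  \<open>[x\<^sub>1, ..., x\<^sub>n]\<close>; the tensor algebra and its homogeneous components are the spans of such
  tensors. The lemmas \<open>tensor_add\<close>, \<open>tensor_scale\<close>, \<open>tensor_span\<close>, \<open>tensor_inj_on\<close> and
  \<open>tensor_independent\<close> below confirm that this is multilinear and that the words of length
  \<open>n\<close> in a basis of \<open>V\<close> yield a basis of the \<open>n\<close>-th component.
\<close>

definition multilinear :: "('v list \<Rightarrow> 'f) \<Rightarrow> bool" where
  "multilinear \<phi> \<longleftrightarrow> (\<forall>xs ys. Vector_Spaces.linear scale (*) (\<lambda>v. \<phi> (xs @ v # ys)))"

definition tensor :: "'v list \<Rightarrow> ('v list \<Rightarrow> 'f) \<Rightarrow> 'f" where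
  "tensor xs = (\<lambda>\<phi>. if multilinear \<phi> then \<phi> xs else 0)"

definition tensor_power :: "nat \<Rightarrow> (('v list \<Rightarrow> 'f) \<Rightarrow> 'f) set" where
  "tensor_power n = fun_vs.span (tensor ` {xs. length xs = n})"

text \<open>
  \<open>odd_inversions n \<sigma> S\<close> counts the pairs of odd factors whose relative order is reversed by
  \<open>\<sigma>\<close>, where \<open>S \<subseteq> {0,...,n-1}\<close> is the set of positions of the odd factors before permuting.
\<close>

definition odd_inversions :: "nat \<Rightarrow> (nat \<Rightarrow> nat) \<Rightarrow> nat set \<Rightarrow> nat" where
  "odd_inversions n \<sigma> S = card {(i, j). i < j \<and> j < n \<and> \<sigma> i \<in> S \<and> \<sigma> j \<in> S \<and> \<sigma> i > \<sigma> j}"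

text \<open>
  The signed right action on the \<open>n\<close>-th tensor power. On \<open>x\<^sub>1 \<otimes> ... \<otimes> x\<^sub>n\<close> it splits
  every factor into its homogeneous components (\<open>S\<close> being the set of positions where the odd one is
  chosen) and acts on each of the resulting homogeneous tensors by signed place permutation;
  see \<open>place_act_homogeneous\<close> below.
\<close>

definition pull_back :: "nat \<Rightarrow> (nat \<Rightarrow> nat) \<Rightarrow> ('v list \<Rightarrow> 'f) \<Rightarrow> 'v list \<Rightarrow> 'f" where
  "pull_back n \<sigma> \<phi> xs =
     (if length xs = n
      then \<Sum>S\<in>Pow {..<n}. (-1) ^ odd_inversions n \<sigma> S *
             \<phi> (map (\<lambda>i. component (\<sigma> i \<in> S) (xs ! \<sigma> i)) [0..<n])
      else 0)"

definition place_act ::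
    "nat \<Rightarrow> (nat \<Rightarrow> nat) \<Rightarrow> (('v list \<Rightarrow> 'f) \<Rightarrow> 'f) \<Rightarrow> ('v list \<Rightarrow> 'f) \<Rightarrow> 'f" where
  "place_act n \<sigma> t = (\<lambda>\<phi>. if multilinear \<phi> then t (pull_back n \<sigma> \<phi>) else 0)"


lemma linear_form_iff:
  "Vector_Spaces.linear scale (*) f \<longleftrightarrow>
     (\<forall>x y. f (x + y) = f x + f y) \<and> (\<forall>c x. f (scale c x) = c * f x)"
proof
  assume "Vector_Spaces.linear scale (*) f"
  then interpret f: Vector_Spaces.linear scale "(*)" f .
  show "(\<forall>x y. f (x + y) = f x + f y) \<and> (\<forall>c x. f (scale c x) = c * f x)"
    using f.add f.scale by blast
next
  assume "(\<forall>x y. f (x + y) = f x + f y) \<and> (\<forall>c x. f (scale c x) = c * f x)"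
  then show "Vector_Spaces.linear scale (*) f"
    by unfold_locales (auto simp: algebra_simps)
qed

lemma even_part_eq:
  assumes "a \<in> V0" "b \<in> V1" "v = a + b"
  shows "even_part v = a"
  unfolding even_part_def
proof (rule the_equality)
  show "a \<in> V0 \<and> v - a \<in> V1" using assms by simp
  fix c assume c: "c \<in> V0 \<and> v - c \<in> V1"
  have "c - a \<in> V0" using c assms local.subspace_diff[OF subspace_V0] by blast
  moreover have "b - (v - c) \<in> V1" using c assms local.subspace_diff[OF subspace_V1] by blast
  then have "c - a \<in> V1" using assms by simp
  ultimately have "c - a = 0" using V0_inter_V1 by blast
  then show "c = a" by simp
qed

lemma component_add: "component b (x + y) = component b x + component b y"
  and component_scale: "component b (scale c x) = scale c (component b x)"
proof -
  obtain x0 x1 where x: "x0 \<in> V0" "x1 \<in> V1" "x = x0 + x1" using V0_plus_V1 by blast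
  obtain y0 y1 where y: "y0 \<in> V0" "y1 \<in> V1" "y = y0 + y1" using V0_plus_V1 by blast
  have "even_part (x + y) = x0 + y0"
    by (rule even_part_eq[of _ "x1 + y1"])
       (use x y local.subspace_add[OF subspace_V0] local.subspace_add[OF subspace_V1] in auto)
  then show "component b (x + y) = component b x + component b y"
    using even_part_eq[OF x] even_part_eq[OF y] by (simp add: component_def)
  have "even_part (scale c x) = scale c x0"
    by (rule even_part_eq[of _ "scale c x1"])
       (use x local.subspace_scale[OF subspace_V0] local.subspace_scale[OF subspace_V1]
         in \<open>auto simp: local.scale_right_distrib\<close>)
  then show "component b (scale c x) = scale c (component b x)"
    using even_part_eq[OF x] by (simp add: component_def local.scale_right_diff_distrib)
qed

lemma component_homogeneous:
  assumes "v \<in> (if p then V1 else V0)"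
  shows "component b v = (if b = p then v else 0)"
proof (cases p)
  case True
  then have "even_part v = 0"
    using assms local.subspace_0[OF subspace_V0] by (intro even_part_eq[of _ v]) auto
  then show ?thesis using True by (simp add: component_def)
next
  case False
  then have "even_part v = v"
    using assms local.subspace_0[OF subspace_V1] by (intro even_part_eq[of _ 0]) auto
  then show ?thesis using False by (simp add: component_def)
qed

lemma multilinear_add:
  "multilinear \<phi> \<Longrightarrow> \<phi> (xs @ (u + v) # ys) = \<phi> (xs @ u # ys) + \<phi> (xs @ v # ys)"
  and multilinear_scale:
  "multilinear \<phi> \<Longrightarrow> \<phi> (xs @ scale c v # ys) = c * \<phi> (xs @ v # ys)"
  unfolding multilinear_def linear_form_iff by blast+

lemma multilinear_0:
  assumes "multilinear \<phi>" "0 \<in> set xs"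
  shows "\<phi> xs = 0"
proof -
  obtain us vs where "xs = us @ 0 # vs" using assms(2) split_list by fastforce
  then show ?thesis using multilinear_scale[OF assms(1), of us 0 0 vs] by simp
qed

lemma map_update_split:
  assumes "j < n"
  shows "map (\<lambda>i. if i = j then v else h i) [0..<n] = map h [0..<j] @ v # map h [Suc j..<n]"
proof -
  have "[0..<n] = [0..<j] @ j # [Suc j..<n]"
    using assms upt_add_eq_append[of 0 j "n - j"] upt_conv_Cons[of j n] by simp
  then show ?thesis by auto
qed

lemma multilinear_pull_back:
  assumes \<phi>: "multilinear \<phi>" and \<sigma>: "\<sigma> \<in> sym_group n"
  shows "multilinear (pull_back n \<sigma> \<phi>)"
  unfolding multilinear_def
proof (intro allI)
  fix xs ys :: "'v list"
  show "Vector_Spaces.linear scale (*) (\<lambda>v. pull_back n \<sigma> \<phi> (xs @ v # ys))"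
  proof (cases "length xs + Suc (length ys) = n")
    case False
    then show ?thesis by (simp add: linear_form_iff pull_back_def)
  next
    case True
    have perm: "\<sigma> permutes {..<n}" using \<sigma> by (simp add: sym_group_def)
    define j where "j = inv \<sigma> (length xs)"
    have \<sigma>j: "\<sigma> i = length xs \<longleftrightarrow> i = j" for i
      using permutes_inv_eq[OF perm] unfolding j_def by metis
    have "\<sigma> j < n" using \<sigma>j[of j] True by simp
    then have j: "j < n" using permutes_in_image[OF perm, of j] by simp
    define h where "h S i = component (\<sigma> i \<in> S) ((xs @ 0 # ys) ! \<sigma> i)" for S i
    have list_eq: "map (\<lambda>i. component (\<sigma> i \<in> S) ((xs @ v # ys) ! \<sigma> i)) [0..<n]
       = map (h S) [0..<j] @ component (length xs \<in> S) v # map (h S) [Suc j..<n]" for S v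
    proof -
      have "component (\<sigma> i \<in> S) ((xs @ v # ys) ! \<sigma> i) =
          (if i = j then component (length xs \<in> S) v else h S i)" for i
        using \<sigma>j[of i] unfolding h_def by (auto simp: nth_append nth_Cons split: nat.splits)
      then show ?thesis using map_update_split[OF j] by simp
    qed
    have "pull_back n \<sigma> \<phi> (xs @ v # ys) = (\<Sum>S\<in>Pow {..<n}. (-1) ^ odd_inversions n \<sigma> S *
        \<phi> (map (h S) [0..<j] @ component (length xs \<in> S) v # map (h S) [Suc j..<n]))" for v
      using True by (simp only: pull_back_def list_eq) simp
    then show ?thesis
      unfolding linear_form_iff component_add component_scale
        multilinear_add[OF \<phi>] multilinear_scale[OF \<phi>]
      by (simp only: component_add component_scale multilinear_add[OF \<phi>] multilinear_scale[OF \<phi>]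
        distrib_left sum.distrib sum_distrib_left mult.left_commute simp_thms)
  qed
qed

lemma place_act_add: "place_act n \<sigma> (s + t) = place_act n \<sigma> s + place_act n \<sigma> t"
  and place_act_scale: "place_act n \<sigma> (fscale c t) = fscale c (place_act n \<sigma> t)"
  by (auto simp: place_act_def fscale_def fun_eq_iff)

lemma place_act_homogeneous:
  assumes \<sigma>: "\<sigma> \<in> sym_group n" and len: "length zs = n" and S: "S \<subseteq> {..<n}"
    and zs: "\<And>i. i < n \<Longrightarrow> zs ! i \<in> (if i \<in> S then V1 else V0)"
  shows "place_act n \<sigma> (tensor zs) =
    fscale ((-1) ^ odd_inversions n \<sigma> S) (tensor (map (\<lambda>i. zs ! \<sigma> i) [0..<n]))"
proof
  fix \<phi>
  have perm: "\<sigma> permutes {..<n}" using \<sigma> by (simp add: sym_group_def)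
  have \<sigma>n: "\<sigma> i < n" if "i < n" for i
    using permutes_in_image[OF perm, of i] that by simp
  show "place_act n \<sigma> (tensor zs) \<phi> =
    fscale ((-1) ^ odd_inversions n \<sigma> S) (tensor (map (\<lambda>i. zs ! \<sigma> i) [0..<n])) \<phi>"
  proof (cases "multilinear \<phi>")
    case False
    then show ?thesis by (simp add: place_act_def fscale_def tensor_def)
  next
    case True
    let ?L = "\<lambda>T. map (\<lambda>i. component (\<sigma> i \<in> T) (zs ! \<sigma> i)) [0..<n]"
    have comp: "component (\<sigma> i \<in> T) (zs ! \<sigma> i) =
        (if (\<sigma> i \<in> T) = (\<sigma> i \<in> S) then zs ! \<sigma> i else 0)" if "i < n" for i T
      using component_homogeneous[OF zs[OF \<sigma>n[OF that]]] .
    have zero: "\<phi> (?L T) = 0" if T: "T \<in> Pow {..<n} - {S}" for T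
    proof -
      obtain k where k: "k < n" "(k \<in> T) \<noteq> (k \<in> S)" using T S by blast
      obtain i where i: "i < n" "\<sigma> i = k"
        using permutes_image[OF perm] k(1) by (metis imageE lessThan_iff)
      have "0 = component (\<sigma> i \<in> T) (zs ! \<sigma> i)" using comp[OF i(1), of T] k(2) unfolding i(2) by simp
      then have "0 \<in> set (?L T)" using i(1) by auto
      then show ?thesis by (rule multilinear_0[OF True])
    qed
    have same: "?L S = map (\<lambda>i. zs ! \<sigma> i) [0..<n]"
      using comp by auto
    have "place_act n \<sigma> (tensor zs) \<phi> =
        (\<Sum>T\<in>Pow {..<n}. (-1) ^ odd_inversions n \<sigma> T * \<phi> (?L T))"
      using True multilinear_pull_back[OF True \<sigma>] len
      by (simp add: place_act_def tensor_def pull_back_def)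
    also have "\<dots> = (-1) ^ odd_inversions n \<sigma> S * \<phi> (?L S)
        + (\<Sum>T\<in>Pow {..<n} - {S}. (-1) ^ odd_inversions n \<sigma> T * \<phi> (?L T))"
      using S by (intro sum.remove) auto
    also have "\<dots> = (-1) ^ odd_inversions n \<sigma> S * \<phi> (?L S)"
      using zero by simp
    finally show ?thesis using True unfolding same by (simp add: fscale_def tensor_def)
  qed
qed

lemma tensor_add: "tensor (xs @ (u + v) # ys) = tensor (xs @ u # ys) + tensor (xs @ v # ys)"
  and tensor_scale: "tensor (xs @ scale c v # ys) = fscale c (tensor (xs @ v # ys))"
  by (auto simp: tensor_def fscale_def fun_eq_iff multilinear_add multilinear_scale)

lemma tensor_span:
  fixes n :: nat
  assumes B: "local.span B = UNIV"
  defines "words \<equiv> {w. length w = n \<and> set w \<subseteq> B}"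
  shows "fun_vs.span (tensor ` words) = tensor_power n"
proof (rule subset_antisym)
  show "fun_vs.span (tensor ` words) \<subseteq> tensor_power n"
    unfolding tensor_power_def words_def by (intro fun_vs.span_mono image_mono) auto
  have "tensor (ws @ xs) \<in> fun_vs.span (tensor ` words)"
    if "set ws \<subseteq> B" "length ws + length xs = n" for ws xs
    using that
  proof (induction xs arbitrary: ws)
    case Nil
    then have "ws \<in> words" by (simp add: words_def)
    then show ?case by (simp add: fun_vs.span_base)
  next
    case (Cons x xs)
    have "x \<in> local.span B" using B by simp
    then show ?case
    proof (induction rule: local.span_induct_alt)
      case base
      have "tensor (ws @ 0 # xs) = 0"
        using tensor_scale[of ws 0 0 xs] by (simp add: fun_vs.scale_zero_left)
      then show ?case by (simp only: fun_vs.span_zero)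
    next
      case (step c b y)
      have "tensor (ws @ b # xs) \<in> fun_vs.span (tensor ` words)"
        using Cons.IH[of "ws @ [b]"] Cons.prems step(1) by simp
      then show ?case
        using step(2) by (simp only: tensor_add tensor_scale fun_vs.span_add fun_vs.span_scale)
    qed
  qed
  from this[of "[]"] have "tensor ` {xs. length xs = n} \<subseteq> fun_vs.span (tensor ` words)"
    by (simp add: image_subset_iff)
  then show "tensor_power n \<subseteq> fun_vs.span (tensor ` words)"
    unfolding tensor_power_def by (rule fun_vs.span_minimal[OF _ fun_vs.subspace_span])
qed

lemma dual_word:
  fixes n :: nat
  assumes B: "local.independent B" "local.span B = UNIV" and w: "length w = n" "set w \<subseteq> B"
  obtains \<phi> where "multilinear \<phi>"
    "\<And>v. length v = n \<Longrightarrow> set v \<subseteq> B \<Longrightarrow> \<phi> v = (if v = w then 1 else 0)"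
proof
  define dual where "dual xs =
    (if length xs = n then \<Prod>i<n. local.representation B (xs ! i) (w ! i) else 0)"
    for xs :: "'v list"
  have rep_add: "local.representation B (u + v) b =
      local.representation B u b + local.representation B v b" for u v b
    using local.representation_add[OF B(1)] B(2) by simp
  have rep_scale: "local.representation B (scale c v) b = c * local.representation B v b" for c v b
    using local.representation_scale[OF B(1)] B(2) by simp
  show "multilinear dual"
    unfolding multilinear_def
  proof (intro allI)
    fix xs ys :: "'v list"
    show "Vector_Spaces.linear scale (*) (\<lambda>v. dual (xs @ v # ys))"
    proof (cases "length xs + Suc (length ys) = n")
      case False
      then show ?thesis by (simp add: linear_form_iff dual_def)
    next
      case True
      let ?k = "length xs"
      let ?P = "\<Prod>i\<in>{..<n} - {?k}. local.representation B ((xs @ 0 # ys) ! i) (w ! i)"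
      have "dual (xs @ v # ys) = local.representation B v (w ! ?k) * ?P" for v
      proof -
        have "dual (xs @ v # ys) =
            (\<Prod>i<n. local.representation B ((xs @ v # ys) ! i) (w ! i))"
          using True by (simp add: dual_def)
        also have "\<dots> = local.representation B ((xs @ v # ys) ! ?k) (w ! ?k) *
            (\<Prod>i\<in>{..<n} - {?k}. local.representation B ((xs @ v # ys) ! i) (w ! i))"
          using True by (intro prod.remove) auto
        also have "(\<Prod>i\<in>{..<n} - {?k}. local.representation B ((xs @ v # ys) ! i) (w ! i)) = ?P"
          by (rule prod.cong) (auto simp: nth_append nth_Cons split: nat.splits)
        finally show ?thesis by simp
      qed
      then show ?thesis
        by (simp add: linear_form_iff rep_add rep_scale algebra_simps)
    qed
  qed
  show "dual v = (if v = w then 1 else 0)" if v: "length v = n" "set v \<subseteq> B" for v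
  proof -
    have rep: "local.representation B (v ! i) (w ! i) = (if v ! i = w ! i then 1 else 0)"
      if "i < n" for i
    proof -
      have "v ! i \<in> B" using that \<open>length v = n\<close> \<open>set v \<subseteq> B\<close> by (metis nth_mem subsetD)
      then show ?thesis using local.representation_basis[OF B(1)] by auto
    qed
    show ?thesis
    proof (cases "v = w")
      case True
      then show ?thesis using rep that by (simp add: dual_def)
    next
      case False
      then obtain i where "i < n" "v ! i \<noteq> w ! i"
        using nth_equalityI[of v w] v(1) w(1) by metis
      then have "(\<Prod>i<n. local.representation B (v ! i) (w ! i)) = 0"
        using rep by (intro prod_zero) auto
      then show ?thesis using False that by (simp add: dual_def)
    qed
  qed
qed

lemma tensor_inj_on:
  assumes B: "local.independent B" "local.span B = UNIV"
  shows "inj_on tensor {w. length w = n \<and> set w \<subseteq> B}"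
proof (rule inj_onI)
  fix v w
  assume v: "v \<in> {w. length w = n \<and> set w \<subseteq> B}" and w: "w \<in> {w. length w = n \<and> set w \<subseteq> B}"
    and eq: "tensor v = tensor w"
  obtain \<phi> where "multilinear \<phi>"
    and \<phi>: "\<And>v. length v = n \<Longrightarrow> set v \<subseteq> B \<Longrightarrow> \<phi> v = (if v = w then 1 else 0)"
    using dual_word[OF B, of w n] w by auto
  then have "\<phi> v = \<phi> w" using fun_cong[OF eq, of \<phi>] by (simp add: tensor_def)
  then show "v = w" using \<phi>[of v] \<phi>[of w] v w by (simp split: if_splits)
qed

lemma tensor_independent:
  assumes B: "local.independent B" "local.span B = UNIV"
  shows "fun_vs.independent (tensor ` {w. length w = n \<and> set w \<subseteq> B})"
proof
  assume "fun_vs.dependent (tensor ` {w. length w = n \<and> set w \<subseteq> B})"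
  then obtain T u t where T: "finite T" "T \<subseteq> tensor ` {w. length w = n \<and> set w \<subseteq> B}"
    and s: "(\<Sum>v\<in>T. fscale (u v) v) = 0" and t: "t \<in> T" "u t \<noteq> 0"
    unfolding fun_vs.dependent_explicit by blast
  obtain w where w: "length w = n" "set w \<subseteq> B" "t = tensor w" using T t(1) by blast
  obtain \<phi> where m: "multilinear \<phi>"
    and \<phi>: "\<And>v. length v = n \<Longrightarrow> set v \<subseteq> B \<Longrightarrow> \<phi> v = (if v = w then 1 else 0)"
    using dual_word[OF B w(1,2)] by blast
  have ev: "v \<phi> = (if v = t then 1 else 0)" if v: "v \<in> T" for v
  proof -
    obtain x where x: "length x = n" "set x \<subseteq> B" "v = tensor x" using T v by blast
    have "tensor x = tensor w \<longleftrightarrow> x = w"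
      using inj_on_eq_iff[OF tensor_inj_on[OF B], of x n w] x w by simp
    then show ?thesis
      using \<phi>[OF x(1,2)] m unfolding x(3) w(3) by (simp add: tensor_def[of x] split: if_splits)
  qed
  have app: "(\<Sum>v\<in>T. fscale (u v) v) \<phi> = (\<Sum>v\<in>T. u v * v \<phi>)"
    using T(1) by (induction rule: finite_induct) (auto simp: fscale_def)
  have "0 = (\<Sum>v\<in>T. u v * v \<phi>)" unfolding app[symmetric] s by simp
  also have "\<dots> = (\<Sum>v\<in>T. if v = t then u v else 0)"
  proof (rule sum.cong[OF refl])
    fix v assume "v \<in> T"
    from ev[OF this] show "u v * v \<phi> = (if v = t then u v else 0)" by simp
  qed
  also have "\<dots> = u t" using T(1) t(1) by simp
  finally show False using t(2) by simp
qed


subsection \<open>Isotypic components, and the algebra of a filter\<close>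

definition submodule :: "nat \<Rightarrow> (('v list \<Rightarrow> 'f) \<Rightarrow> 'f) set \<Rightarrow> bool" where
  "submodule n M \<longleftrightarrow>
     M \<subseteq> tensor_power n \<and> fun_vs.subspace M \<and> (\<forall>\<sigma>\<in>sym_group n. \<forall>t\<in>M. place_act n \<sigma> t \<in> M)"

definition affords :: "(('v list \<Rightarrow> 'f) \<Rightarrow> 'f) set \<Rightarrow> (nat \<Rightarrow> nat) \<Rightarrow> bool" where
  \<comment> \<open>\<open>M\<close> is isomorphic to the irreducible module with character \<open>\<chi>\<^sup>\<nu>\<close>\<close>
  "affords M \<nu> \<longleftrightarrow> (\<exists>f. bij_betw f (specht \<nu>) M \<and>
     (\<forall>a\<in>specht \<nu>. \<forall>b\<in>specht \<nu>. f (a + b) = f a + f b) \<and>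
     (\<forall>c. \<forall>a\<in>specht \<nu>. f (fscale c a) = fscale c (f a)) \<and>
     (\<forall>\<sigma>\<in>sym_group (psize \<nu>). \<forall>a\<in>specht \<nu>.
        f (group_alg_act \<sigma> a) = place_act (psize \<nu>) \<sigma> (f a)))"

definition isotypic :: "(nat \<Rightarrow> nat) \<Rightarrow> (('v list \<Rightarrow> 'f) \<Rightarrow> 'f) set" where
  "isotypic \<nu> = fun_vs.span (\<Union>{M. submodule (psize \<nu>) M \<and> affords M \<nu>})"

text \<open>
  \<open>I\<^sub>\<Omega>\<close> is the sum of the isotypic components with \<open>\<nu> \<in> \<Omega>\<close>; this sum is automatically
  direct. \<open>A_dim \<Omega> n\<close> is the dimension of the degree \<open>n\<close> component
  \<open>T\<^sup>n(V) / (I\<^sub>\<Omega> \<inter> T\<^sup>n(V))\<close> of the graded algebra \<open>T(V) / I\<^sub>\<Omega>\<close>.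
\<close>

definition filter_ideal :: "(nat \<Rightarrow> nat) set \<Rightarrow> (('v list \<Rightarrow> 'f) \<Rightarrow> 'f) set" where
  "filter_ideal \<Omega> = fun_vs.span (\<Union>\<nu>\<in>\<Omega>. isotypic \<nu>)"

definition A_dim :: "(nat \<Rightarrow> nat) set \<Rightarrow> nat \<Rightarrow> nat" where
  "A_dim \<Omega> n = quotient_dim fscale (tensor_power n) (filter_ideal \<Omega> \<inter> tensor_power n)"

end

end

theory Submission
  imports Defs "HOL-Library.Poly_Mapping"
begin

text \<open>
  Let \<open>k = dim V0\<close>, \<open>l = dim V1\<close> and call \<open>\<nu>\<close> an \<open>(a, b)\<close>-hook partition if its part with index \<open>a\<close>
  is at most \<open>b\<close>. The exponent is the largest \<open>a + b\<close> with \<open>a \<le> k\<close>, \<open>b \<le> l\<close> such that \<open>\<Omega>\<close> contains no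
  \<open>(a, b)\<close>-hook partition (and \<open>0\<close> if there is no such pair).

  Lower bound: if \<open>\<nu>\<close> is not an \<open>(a, b)\<close>-hook partition, its Young symmetrizer kills all words in
  \<open>a\<close> even and \<open>b\<close> odd basis letters. So the ideal lies in the span of the words with some other
  letter, and the \<open>(a + b) ^ n\<close> words in the given letters stay independent in the quotient.

  Upper bound: the partitions outside \<open>\<Omega>\<close> that occur in the tensor power have, for some
  \<open>a + b \<le> \<alpha>\<close>, a bounded number of boxes outside the first \<open>a\<close> rows and \<open>b\<close> columns. Their Young
  symmetrizers factor through a product of row symmetrizers and column antisymmetrizers for
  \<open>a + b\<close> blocks covering all but boundedly many positions, so up to sign the generators
  of the isotypic component are counted by a polynomial times the \<open>\<alpha> ^ n\<close> labellings by these blocks.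

  That the isotypic components exhaust the tensor power rests on highest weight vectors: modulo
  symmetrizers of more dominant shape, the double coset algebra of a row group is one-dimensional.
\<close>

section \<open>The group algebra of the finitary symmetric group\<close>

text \<open>Through Young elements \<open>e\<close>, row symmetrizer times column antisymmetrizer,
  the isotypic component of a shape becomes the span of all \<open>act n t (e * y)\<close>, and both
  bounds turn into questions about words. The obstacle is to show that the scalars met on the way do
  not vanish. The field is an arbitrary one of characteristic 0, so positivity is borrowed from the
  integers: products of symmetrizers and antisymmetrizers have integer coefficients, and the
  identity coefficient of \<open>a * star a\<close> is a sum of squares. This makes
  \<open>e * e\<close> a nonzero multiple of \<open>e\<close>, and irreducibility and completeness
  are drawn from it. One group, the finitary permutations of the naturals, carries all degrees and
  all sets of positions. The averaging identities compare the symmetrizers of \<open>X\<close> and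
  \<open>X - {x}\<close>, the lower bound isolates a rectangle inside a diagram, and the upper bound
  separates long rows from long columns; all these factors have to be multiplied in the same
  algebra.\<close>

typedef fperm = "{\<sigma> :: nat \<Rightarrow> nat. permutation \<sigma>}"
  morphisms ap FPerm
  by (rule exI[of _ id]) simp

setup_lifting type_definition_fperm

text \<open>Composition is written as addition because the product of finitely supported functions
  convolves along the addition of their keys; \<open>group_add\<close> allows it to be
  noncommutative.\<close>

instantiation fperm :: group_add
begin

lift_definition zero_fperm :: fperm is id by simp
lift_definition plus_fperm :: "fperm \<Rightarrow> fperm \<Rightarrow> fperm" is "(\<circ>)" by (rule permutation_compose)
lift_definition uminus_fperm :: "fperm \<Rightarrow> fperm" is inv by (rule permutation_inverse)
definition minus_fperm :: "fperm \<Rightarrow> fperm \<Rightarrow> fperm" where "minus_fperm a b = a + (- b)"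

instance
proof
  fix a b c :: fperm
  show "a + b + c = a + (b + c)" by transfer (simp add: comp_assoc)
  show "0 + a = a" "a + 0 = a" by (transfer; simp)+
  show "- a + a = 0" by transfer (simp add: permutation_inverse_works)
  show "a + - b = a - b" by (simp add: minus_fperm_def)
qed

end

text \<open>Keeps \<open>g + - h\<close> as a sum, the form in which \<open>ap_plus_apply\<close>
  and \<open>ap_uminus_cancel\<close> evaluate it.\<close>

declare add_uminus_conv_diff [simp del]

lemma ap_zero [simp]: "ap 0 = id"
  by transfer simp

lemma ap_plus: "ap (g + h) = ap g \<circ> ap h"
  by transfer simp

lemma ap_plus_apply [simp]: "ap (g + h) x = ap g (ap h x)"
  by (simp add: ap_plus)

lemma ap_uminus: "ap (- g) = inv (ap g)"
  by transfer simp

lemma ap_uminus_cancel [simp]: "ap (- g) (ap g x) = x" "ap g (ap (- g) x) = x"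
  by (simp_all flip: ap_plus_apply)

lemma fperm_eqI: "(\<And>x. ap g x = ap h x) \<Longrightarrow> g = h"
  by transfer auto

lemma bij_ap: "bij (ap g)"
  by transfer (simp add: permutation)

lemma ap_inj [simp]: "ap g x = ap g y \<longleftrightarrow> x = y"
  using bij_ap[of g] by (simp add: bij_is_inj inj_eq)

lemma ap_FPerm: "finite X \<Longrightarrow> \<sigma> permutes X \<Longrightarrow> ap (FPerm \<sigma>) = \<sigma>"
  by (rule FPerm_inverse) (auto simp: permutation_permutes)

lift_definition swp :: "nat \<Rightarrow> nat \<Rightarrow> fperm" is transpose
  by (rule permutation_swap_id)

lemma swp_same [simp]: "swp x x = 0"
  by transfer simp

lemma swp_swp [simp]: "swp x y + swp x y = 0"
  by transfer simp

lemma uminus_swp: "- swp x y = swp x y"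
  by (rule minus_unique) simp

lemma ap_swp: "ap (swp x y) = transpose x y"
  by transfer simp

lemma swp_conj: "swp (ap g x) (ap g y) + g = g + swp x y"
  by (rule fperm_eqI) (auto simp: ap_swp transpose_def)

definition psgn :: "fperm \<Rightarrow> 'f::field" where
  "psgn g = of_int (sign (ap g))"

lemma psgn_zero [simp]: "psgn 0 = 1"
  by (simp add: psgn_def)

lemma psgn_plus: "psgn (g + h) = psgn g * psgn h"
  unfolding psgn_def of_int_mult[symmetric]
  by transfer (simp add: sign_compose)

lemma psgn_uminus: "psgn (- g) = psgn g"
  unfolding psgn_def by transfer (simp add: sign_inverse)

lemma psgn_square [simp]: "psgn g * psgn g = (1::'f::field)"
  unfolding psgn_def of_int_mult[symmetric] by simp

lemma psgn_swp: "x \<noteq> y \<Longrightarrow> psgn (swp x y) = -1"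
  unfolding psgn_def by transfer (simp add: sign_swap_id)

lemma psgn_cases: "psgn g = (1::'f::field) \<or> psgn g = (- 1::'f)"
  unfolding psgn_def by (cases "ap g" rule: sign_cases) auto

definition perms_on :: "nat set \<Rightarrow> fperm set" where
  "perms_on X = {g. ap g permutes X}"

lemma perms_on_0 [simp]: "0 \<in> perms_on X"
  by (simp add: perms_on_def permutes_id)

lemma perms_on_plus: "g \<in> perms_on X \<Longrightarrow> h \<in> perms_on X \<Longrightarrow> g + h \<in> perms_on X"
  by (simp add: perms_on_def ap_plus permutes_compose)

lemma perms_on_uminus: "g \<in> perms_on X \<Longrightarrow> - g \<in> perms_on X"
  by (simp add: perms_on_def ap_uminus permutes_inv)

lemma perms_on_swp: "x \<in> X \<Longrightarrow> y \<in> X \<Longrightarrow> swp x y \<in> perms_on X"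
  by (simp add: perms_on_def ap_swp permutes_swap_id)

lemma perms_on_mono: "X \<subseteq> Y \<Longrightarrow> perms_on X \<subseteq> perms_on Y"
  by (auto simp: perms_on_def intro: permutes_subset)

lemma perms_on_in [simp]: "g \<in> perms_on X \<Longrightarrow> ap g x \<in> X \<longleftrightarrow> x \<in> X"
  by (simp add: perms_on_def permutes_in_image)

lemma perms_on_fix: "g \<in> perms_on X \<Longrightarrow> x \<notin> X \<Longrightarrow> ap g x = x"
  by (simp add: perms_on_def permutes_not_in)

lemma perms_on_image: "g \<in> perms_on X \<Longrightarrow> ap g ` X = X"
  by (simp add: perms_on_def permutes_image)

lemma finite_perms_on: "finite X \<Longrightarrow> finite (perms_on X)"
proof -
  assume "finite X"
  then have "finite {\<sigma>. \<sigma> permutes X}" by (rule finite_permutations)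
  moreover have "perms_on X = ap -` {\<sigma>. \<sigma> permutes X}" by (auto simp: perms_on_def)
  moreover have "inj ap" by (meson injI ap_inject)
  ultimately show ?thesis by (metis finite_vimageI)
qed

text \<open>The Young subgroup of the partition of \<open>X\<close> into the fibres of
  \<open>f\<close>. Only the fibres matter, so row indices, column indices and labels can all play
  the role of \<open>f\<close>.\<close>

definition stab :: "nat set \<Rightarrow> (nat \<Rightarrow> 'l) \<Rightarrow> fperm set" where
  "stab X f = {g \<in> perms_on X. \<forall>x\<in>X. f (ap g x) = f x}"

lemma stab_perms_on: "g \<in> stab X f \<Longrightarrow> g \<in> perms_on X"
  by (simp add: stab_def)

lemma stab_0 [simp]: "0 \<in> stab X f"
  by (simp add: stab_def)

lemma stab_plus: "g \<in> stab X f \<Longrightarrow> h \<in> stab X f \<Longrightarrow> g + h \<in> stab X f"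
  by (simp add: stab_def perms_on_plus)

lemma stab_uminus: "g \<in> stab X f \<Longrightarrow> - g \<in> stab X f"
  unfolding stab_def
  by (auto simp: perms_on_uminus) (metis ap_uminus_cancel(2) perms_on_in)

lemma stab_swp: "x \<in> X \<Longrightarrow> y \<in> X \<Longrightarrow> f x = f y \<Longrightarrow> swp x y \<in> stab X f"
  by (auto simp: stab_def perms_on_swp ap_swp transpose_def)

lemma finite_stab [simp]: "finite X \<Longrightarrow> finite (stab X f)"
  by (rule finite_subset[OF _ finite_perms_on]) (auto simp: stab_def)

lemma stab_mono: "Y \<subseteq> X \<Longrightarrow> (\<And>x y. x \<in> Y \<Longrightarrow> y \<in> Y \<Longrightarrow> h x = h y \<Longrightarrow> f x = f y) \<Longrightarrow> stab Y h \<subseteq> stab X f"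
  unfolding stab_def using perms_on_mono[of Y X]
  by (auto; metis perms_on_fix perms_on_in)

lemma stab_cong: "(\<And>x y. x \<in> X \<Longrightarrow> y \<in> X \<Longrightarrow> h x = h y \<longleftrightarrow> f x = f y) \<Longrightarrow> stab X h = stab X f"
  by (intro subset_antisym stab_mono) auto

section \<open>The group algebra and its subalgebras for sets of positions\<close>

type_synonym 'f galgebra = "fperm \<Rightarrow>\<^sub>0 'f"

abbreviation coef :: "'f::field_char_0 galgebra \<Rightarrow> fperm \<Rightarrow> 'f" where
  "coef \<equiv> Poly_Mapping.lookup"

abbreviation gp :: "fperm \<Rightarrow> 'f::field_char_0 galgebra" where
  "gp g \<equiv> Poly_Mapping.single g 1"

abbreviation const :: "'f::field_char_0 \<Rightarrow> 'f galgebra" where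
  "const c \<equiv> Poly_Mapping.single 0 c"

lemma gp_mult: "gp g * gp h = gp (g + h)"
  by (simp add: mult_single)

lemma gp_mult_assoc: "gp g * (gp h * a) = gp (g + h) * a"
  by (simp add: gp_mult flip: mult.assoc)

lemma const_mult_gp: "const c * gp g = Poly_Mapping.single g c"
  by (simp add: mult_single)

lemma const_mult: "const c * const d = const (c * d)"
  by (simp add: mult_single)

lemma const_mult_assoc: "const c * (const d * a) = const (c * d) * a"
  by (simp add: const_mult flip: mult.assoc)

lemma expand_gp:
  fixes a :: "'f::field_char_0 galgebra"
  shows "a = (\<Sum>k\<in>Poly_Mapping.keys a. const (coef a k) * gp k)"
proof (rule poly_mapping_eqI)
  fix k
  show "coef a k = coef (\<Sum>k\<in>Poly_Mapping.keys a. const (coef a k) * gp k) k"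
    by (simp add: lookup_sum const_mult_gp lookup_single in_keys_iff when_def)
qed

lemma const_commute: "const c * a = a * const c"
proof -
  have "const c * a = (\<Sum>k\<in>Poly_Mapping.keys a. const c * (const (coef a k) * gp k))"
    by (subst (1) expand_gp[of a]) (simp add: sum_distrib_left)
  also have "\<dots> = (\<Sum>k\<in>Poly_Mapping.keys a. (const (coef a k) * gp k) * const c)"
    by (simp add: mult_single mult.commute)
  also have "\<dots> = a * const c"
    using arg_cong[OF expand_gp[of a], of "\<lambda>u. u * const c"] by (simp only: sum_distrib_right)
  finally show ?thesis .
qed

lemma const_left_commute: "a * (const c * b) = const c * (a * b)"
  by (metis const_commute mult.assoc)

lemma const_cancel: "c \<noteq> 0 \<Longrightarrow> const c * a = 0 \<Longrightarrow> a = 0"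
  by (metis const_mult_assoc left_inverse mult_zero_right mult_1 single_one)

lemma two_cancel:
  fixes a :: "'f::field_char_0 galgebra"
  assumes "a = - a" shows "a = 0"
proof (rule poly_mapping_eqI)
  fix k
  have "coef a k = - coef a k" by (subst assms) simp
  then show "coef a k = coef 0 k" by (simp add: eq_neg_iff_add_eq_0 flip: mult_2)
qed

definition galg :: "nat set \<Rightarrow> 'f::field_char_0 galgebra set" where
  "galg X = {a. Poly_Mapping.keys a \<subseteq> perms_on X}"

lemma galg_0 [simp]: "0 \<in> galg X" and galg_1 [simp]: "1 \<in> galg X"
  by (simp_all add: galg_def)

lemma galg_single [simp]: "g \<in> perms_on X \<Longrightarrow> Poly_Mapping.single g c \<in> galg X"
  by (simp add: galg_def)

lemma galg_add: "a \<in> galg X \<Longrightarrow> b \<in> galg X \<Longrightarrow> a + b \<in> galg X"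
  using Poly_Mapping.keys_add[of a b] by (auto simp: galg_def)

lemma galg_sum: "(\<And>i. i \<in> I \<Longrightarrow> h i \<in> galg X) \<Longrightarrow> sum h I \<in> galg X"
  by (induction I rule: infinite_finite_induct) (auto intro: galg_add)

lemma galg_uminus: "a \<in> galg X \<Longrightarrow> - a \<in> galg X"
  by (auto simp: galg_def in_keys_iff subset_iff)

lemma galg_mult: "a \<in> galg X \<Longrightarrow> b \<in> galg X \<Longrightarrow> a * b \<in> galg X"
  using Poly_Mapping.keys_mult[of a b] by (fastforce simp: galg_def intro: perms_on_plus)

lemma galg_mono: "X \<subseteq> Y \<Longrightarrow> galg X \<subseteq> galg Y"
  using perms_on_mono[of X Y] by (auto simp: galg_def)

lemma galg_induct [consumes 1, case_names add gp]:
  assumes "a \<in> galg X"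
    and "\<And>a b. a \<in> galg X \<Longrightarrow> b \<in> galg X \<Longrightarrow> P a \<Longrightarrow> P b \<Longrightarrow> P (a + b)"
    and "\<And>c g. g \<in> perms_on X \<Longrightarrow> P (const c * gp g)"
  shows "P a"
proof -
  have "(\<Sum>k\<in>K. const (coef a k) * gp k) \<in> galg X \<and>
      P (\<Sum>k\<in>K. const (coef a k) * gp k)" if "finite K" "K \<subseteq> perms_on X" for K
    using that
  proof (induction rule: finite_induct)
    case empty
    show ?case using assms(3)[of 0 0] by simp
  next
    case (insert x F)
    then show ?case using assms(2,3) by (simp add: galg_add galg_mult)
  qed
  from this[of "Poly_Mapping.keys a"] show ?thesis
    using assms(1) unfolding expand_gp[of a, symmetric] by (simp add: galg_def)
qed

subsection \<open>The inversion antiautomorphism and the sign automorphism\<close>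

text \<open>\<open>star\<close> exchanges left and right multiples, and \<open>twist\<close>
  exchanges symmetrizers and antisymmetrizers, so that each absorption rule is proved once and
  transported to its variants.\<close>

definition star :: "'f::field_char_0 galgebra \<Rightarrow> 'f galgebra" where
  "star a = Poly_Mapping.map_key uminus a"

lift_definition twist :: "'f::field_char_0 galgebra \<Rightarrow> 'f galgebra" is "\<lambda>a g. psgn g * a g"
  by (rule finite_subset) auto

lemma star_single: "star (Poly_Mapping.single g c) = Poly_Mapping.single (- g) c"
  using map_key_single[of uminus "- g" c] by (simp add: star_def)

lemma star_add: "star (a + b) = star a + star b"
  by (simp add: star_def map_key_plus)

lemma star_0 [simp]: "star 0 = 0"
  by (simp add: star_def)

lemma star_sum: "star (sum h I) = (\<Sum>i\<in>I. star (h i))"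
  by (induction I rule: infinite_finite_induct) (auto simp: star_add)

lemma twist_single: "twist (Poly_Mapping.single g c) = Poly_Mapping.single g (psgn g * c)"
  by (rule poly_mapping_eqI) (simp add: twist.rep_eq lookup_single when_def)

lemma twist_add: "twist (a + b) = twist a + twist b"
  by (rule poly_mapping_eqI) (simp add: twist.rep_eq lookup_add distrib_left)

lemma twist_0 [simp]: "twist 0 = 0"
  by (rule poly_mapping_eqI) (simp add: twist.rep_eq)

lemma twist_sum: "twist (sum h I) = (\<Sum>i\<in>I. twist (h i))"
  by (induction I rule: infinite_finite_induct) (auto simp: twist_add)

text \<open>With \<open>X = UNIV\<close> the rule \<open>galg_induct\<close> becomes an induction
  over the whole group algebra.\<close>

lemma perms_on_UNIV [simp]: "perms_on UNIV = UNIV"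
  using bij_imp_permutes[of _ UNIV] bij_ap by (auto simp: perms_on_def)

lemma galg_UNIV [simp]: "a \<in> galg UNIV"
  by (simp add: galg_def)

lemma lookup_const_mult: "coef (const c * a) g = c * coef a g"
  by (rule galg_induct[of a UNIV])
     (auto simp: algebra_simps lookup_add mult_single lookup_single when_def)

lemma star_mult: "star (a * b) = star b * star a"
proof (rule galg_induct[of a UNIV])
  fix d g
  show "star (const d * gp g * b) = star b * star (const d * gp g)"
    by (rule galg_induct[of b UNIV])
       (simp_all add: algebra_simps star_add mult_single star_single minus_add)
qed (simp_all add: algebra_simps star_add)

lemma twist_mult: "twist (a * b) = twist a * twist b"
proof (rule galg_induct[of a UNIV])
  fix d g
  show "twist (const d * gp g * b) = twist (const d * gp g) * twist b"
    by (rule galg_induct[of b UNIV])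
       (simp_all add: algebra_simps twist_add mult_single twist_single psgn_plus)
qed (simp_all add: algebra_simps twist_add)

lemma star_galg: "a \<in> galg X \<Longrightarrow> star a \<in> galg X"
  by (induction rule: galg_induct) (auto simp: star_add galg_add mult_single star_single perms_on_uminus)

lemma star_star [simp]: "star (star a) = a"
  by (rule galg_induct[of a UNIV]) (simp_all add: star_add mult_single star_single)

subsection \<open>Symmetrizers and antisymmetrizers\<close>

definition symz :: "nat set \<Rightarrow> (nat \<Rightarrow> 'l) \<Rightarrow> 'f::field_char_0 galgebra" where
  "symz X f = (\<Sum>g\<in>stab X f. gp g)"

definition altz :: "nat set \<Rightarrow> (nat \<Rightarrow> 'l) \<Rightarrow> 'f::field_char_0 galgebra" where
  "altz X f = (\<Sum>g\<in>stab X f. const (psgn g) * gp g)"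

lemma sym_galg [simp]: "symz X f \<in> galg X" and alt_galg [simp]: "altz X f \<in> galg X"
  unfolding symz_def altz_def by (auto intro!: galg_sum galg_mult dest: stab_perms_on)

lemma sym_cong: "(\<And>x y. x \<in> X \<Longrightarrow> y \<in> X \<Longrightarrow> h x = h y \<longleftrightarrow> f x = f y) \<Longrightarrow> symz X h = symz X f"
  unfolding symz_def using stab_cong[of X h f] by simp

lemma twist_sym: "twist (symz X f) = altz X f"
  by (simp add: symz_def altz_def twist_sum twist_single const_mult_gp)

lemma star_sym [simp]: "star (symz X f) = symz X f"
proof -
  have "bij_betw uminus (stab X f) (stab X f)"
    by (rule bij_betw_byWitness[where f' = uminus]) (auto simp: stab_uminus)
  then show ?thesis
    unfolding symz_def star_sum star_single by (rule sum.reindex_bij_betw)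
qed

lemma star_alt [simp]: "star (altz X f) = altz X f"
proof -
  have "star (twist a) = twist (star a)" for a :: "'a galgebra"
    by (rule galg_induct[of a UNIV])
       (simp_all add: star_add twist_add mult_single star_single twist_single psgn_uminus)
  then show ?thesis by (simp flip: twist_sym)
qed

lemma gp_sym:
  assumes "g \<in> stab X f" shows "gp g * symz X f = symz X f"
proof -
  have "bij_betw (\<lambda>h. g + h) (stab X f) (stab X f)"
    by (rule bij_betw_byWitness[where f' = "\<lambda>h. - g + h"])
       (use assms in \<open>auto simp: stab_plus stab_uminus simp flip: add.assoc\<close>)
  then show ?thesis
    unfolding symz_def sum_distrib_left gp_mult by (rule sum.reindex_bij_betw)
qed

lemma sym_gp: "g \<in> stab X f \<Longrightarrow> symz X f * gp g = symz X f"
  using arg_cong[OF gp_sym[OF stab_uminus], of g X f star] by (simp add: star_mult star_single)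

lemma gp_alt:
  assumes "g \<in> stab X f" shows "gp g * altz X f = const (psgn g) * altz X f"
proof -
  have "const (psgn g) * gp g * altz X f = altz X f"
    using arg_cong[OF gp_sym[OF assms], of twist]
    by (simp add: twist_mult twist_sym twist_single const_mult_gp)
  from arg_cong[OF this, of "\<lambda>a. const (psgn g) * a"] show ?thesis
    by (simp add: const_mult_assoc mult.assoc)
qed

lemma alt_gp:
  assumes "g \<in> stab X f" shows "altz X f * gp g = const (psgn g) * altz X f"
  using arg_cong[OF gp_alt[OF stab_uminus[OF assms]], of star]
  by (simp add: star_mult star_single psgn_uminus const_commute)

lemma sum_const: "(\<Sum>i\<in>I. const (h i)) = const (sum h I)"
  by (induction I rule: infinite_finite_induct) (auto simp: single_add)

lemma sym_absorb:
  assumes "stab Y h \<subseteq> stab X f"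
  shows "symz X f * symz Y h = const (of_nat (card (stab Y h))) * (symz X f :: 'f::field_char_0 galgebra)"
    and "symz Y h * symz X f = const (of_nat (card (stab Y h))) * (symz X f :: 'f::field_char_0 galgebra)"
proof -
  have "symz Y h * symz X f = (\<Sum>g\<in>stab Y h. symz X f :: 'f galgebra)"
    unfolding symz_def[of Y h] sum_distrib_right using assms by (intro sum.cong gp_sym) auto
  then show eq: "symz Y h * symz X f = const (of_nat (card (stab Y h))) * (symz X f :: 'f galgebra)"
    by (simp add: mult_of_nat_commute)
  show "symz X f * symz Y h = const (of_nat (card (stab Y h))) * (symz X f :: 'f galgebra)"
    using arg_cong[OF eq, of star] by (simp only: star_mult star_sym star_single const_commute minus_zero)
qed

lemma alt_absorb:
  assumes "stab Y h \<subseteq> stab X f"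
  shows "altz X f * altz Y h = const (of_nat (card (stab Y h))) * (altz X f :: 'f::field_char_0 galgebra)"
    and "altz Y h * altz X f = const (of_nat (card (stab Y h))) * (altz X f :: 'f::field_char_0 galgebra)"
proof -
  note twist = twist_mult twist_sym twist_single psgn_zero mult_1
  show "altz X f * altz Y h = const (of_nat (card (stab Y h))) * (altz X f :: 'f galgebra)"
    by (rule arg_cong[OF sym_absorb(1)[OF assms], of twist, unfolded twist])
  show "altz Y h * altz X f = const (of_nat (card (stab Y h))) * (altz X f :: 'f galgebra)"
    by (rule arg_cong[OF sym_absorb(2)[OF assms], of twist, unfolded twist])
qed

lemma card_stab_pos: "finite X \<Longrightarrow> card (stab X f) > 0"
  using stab_0[of X f] finite_stab[of X f] card_gt_0_iff by blast

text \<open>Absorption read backwards: the order of the smaller group is invertible in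
  characteristic 0, so its symmetrizer can be split off on either side.\<close>

lemma sym_refine:
  assumes "finite Y" "stab Y h \<subseteq> stab X f"
  obtains c where "symz X f = const c * (symz X f * symz Y h)" "symz X f = const c * (symz Y h * symz X f)"
proof
  let ?c = "inverse (of_nat (card (stab Y h)))"
  show "symz X f = const ?c * (symz X f * symz Y h)" "symz X f = const ?c * (symz Y h * symz X f)"
    unfolding sym_absorb[OF assms(2)] const_mult_assoc
    using card_stab_pos[OF assms(1), of h] by simp_all
qed

lemma alt_refine:
  assumes "finite Y" "stab Y h \<subseteq> stab X f"
  obtains c where "altz X f = const c * (altz X f * altz Y h)" "altz X f = const c * (altz Y h * altz X f)"
proof
  let ?c = "inverse (of_nat (card (stab Y h)))"
  show "altz X f = const ?c * (altz X f * altz Y h)" "altz X f = const ?c * (altz Y h * altz X f)"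
    unfolding alt_absorb[OF assms(2)] const_mult_assoc
    using card_stab_pos[OF assms(1), of h] by simp_all
qed

text \<open>A transposition common to both groups is absorbed as 1 by the symmetrizer and as -1 by
  the antisymmetrizer, so the product equals its own negative.\<close>

lemma sym_alt_zero:
  assumes "swp x y \<in> stab X f" "swp x y \<in> stab Y h" "x \<noteq> y"
  shows "symz X f * (altz Y h :: 'f::field_char_0 galgebra) = 0"
proof (rule two_cancel)
  let ?s = "symz X f :: 'f galgebra"
  have "?s * altz Y h = ?s * gp (swp x y) * altz Y h" using sym_gp[OF assms(1), where 'b = 'f] by simp
  also have "\<dots> = - (?s * altz Y h)"
    by (simp add: mult.assoc gp_alt[OF assms(2)] psgn_swp[OF assms(3)] single_uminus)
  finally show "?s * altz Y h = - (?s * altz Y h)" .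
qed

lemma card_perm_image:
  assumes "g \<in> perms_on X" shows "card {x\<in>X. P (ap g x)} = card {x\<in>X. P x}"
proof (rule bij_betw_same_card[OF bij_betw_byWitness[where f = "ap g" and f' = "ap (- g)"]])
  show "ap (- g) ` {x\<in>X. P x} \<subseteq> {x\<in>X. P (ap g x)}"
    using perms_on_uminus[OF assms] by auto
qed (use assms in auto)

lemma stab_conj:
  assumes "g \<in> perms_on X"
  shows "h \<in> stab X (f \<circ> ap g) \<longleftrightarrow> g + h + - g \<in> stab X f"
proof
  assume h: "h \<in> stab X (f \<circ> ap g)"
  have "f (ap g (ap h (ap (- g) x))) = f x" if "x \<in> X" for x
  proof -
    have "ap (- g) x \<in> X" using that perms_on_uminus[OF assms] by simp
    then show ?thesis using h by (simp add: stab_def)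
  qed
  then show "g + h + - g \<in> stab X f"
    using h assms by (simp add: stab_def perms_on_plus perms_on_uminus)
next
  assume h: "g + h + - g \<in> stab X f"
  have "h = - g + (g + h + - g) + g" by (simp add: add.assoc)
  then have "h \<in> perms_on X" using h assms perms_on_plus perms_on_uminus stab_perms_on by metis
  moreover have "f (ap g (ap h x)) = f (ap g x)" if "x \<in> X" for x
  proof -
    have "ap g x \<in> X" using that assms by simp
    then have "f (ap (g + h + - g) (ap g x)) = f (ap g x)" using h unfolding stab_def by blast
    then show ?thesis by simp
  qed
  ultimately show "h \<in> stab X (f \<circ> ap g)" by (simp add: stab_def)
qed

lemma bij_stab_conj:
  assumes "g \<in> perms_on X"
  shows "bij_betw (\<lambda>h. g + h + - g) (stab X (f \<circ> ap g)) (stab X f)"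
proof (rule bij_betw_byWitness[where f' = "\<lambda>h. - g + h + g"])
  show "(\<lambda>h. - g + h + g) ` stab X f \<subseteq> stab X (f \<circ> ap g)"
  proof (rule image_subsetI)
    fix h assume "h \<in> stab X f"
    moreover have "g + (- g + h + g) + - g = h" by (metis add.assoc add.right_inverse add.left_neutral add.right_neutral)
    ultimately show "- g + h + g \<in> stab X (f \<circ> ap g)" unfolding stab_conj[OF assms] by simp
  qed
  show "(\<lambda>h. g + h + - g) ` stab X (f \<circ> ap g) \<subseteq> stab X f"
    using stab_conj[OF assms] by blast
qed (metis add.assoc add.right_inverse add.left_inverse add.left_neutral add.right_neutral)+

lemma sym_conj:
  assumes "g \<in> perms_on X"
  shows "gp g * symz X (f \<circ> ap g) = (symz X f :: 'f::field_char_0 galgebra) * gp g"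
proof -
  have "(symz X f :: 'f galgebra) * gp g = (\<Sum>h\<in>stab X (f \<circ> ap g). gp (g + h + - g)) * gp g"
    unfolding symz_def
    using sum.reindex_bij_betw[OF bij_stab_conj[OF assms], of "gp :: _ \<Rightarrow> 'f galgebra" f] by simp
  also have "\<dots> = gp g * symz X (f \<circ> ap g)"
    unfolding symz_def sum_distrib_left sum_distrib_right gp_mult
    by (rule sum.cong) (simp_all add: add.assoc)
  finally show ?thesis by simp
qed

lemma alt_conj:
  assumes "g \<in> perms_on X"
  shows "gp g * altz X (f \<circ> ap g) = (altz X f :: 'f::field_char_0 galgebra) * gp g"
proof -
  have gs: "Poly_Mapping.single g (psgn g * 1) = (const (psgn g) * gp g :: 'f galgebra)"
    by (simp add: const_mult_gp)
  have "const (psgn g) * (gp g * altz X (f \<circ> ap g)) = const (psgn g) * ((altz X f :: 'f galgebra) * gp g)"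
    using arg_cong[OF sym_conj[OF assms, of f], of "twist :: 'f galgebra \<Rightarrow> _"]
    by (simp only: twist_mult twist_sym twist_single gs const_left_commute[of "altz X f :: 'f galgebra"] mult.assoc)
  from arg_cong[OF this, of "\<lambda>a. const (psgn g) * a"] show ?thesis
    by (simp add: const_mult_assoc)
qed

text \<open>The translates of \<open>stab (X - {x}) f\<close> by \<open>swp x y\<close>, \<open>y\<close> in the fibre of \<open>x\<close>, partition \<open>stab X f\<close>.\<close>

lemma sym_coset:
  assumes "finite X" "x \<in> X"
  shows "symz X f = symz (X - {x}) f * (\<Sum>y\<in>{y\<in>X. f y = f x}. gp (swp x y))"
    and "symz X f = (\<Sum>y\<in>{y\<in>X. f y = f x}. gp (swp x y)) * symz (X - {x}) f"
proof -
  let ?Y = "{y\<in>X. f y = f x}" and ?H = "stab (X - {x}) f"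
  have H: "h \<in> stab X f" "ap h x = x" if "h \<in> ?H" for h
    using that stab_mono[of "X - {x}" X f f] perms_on_fix[of h "X - {x}" x] by (auto dest: stab_perms_on)
  have S: "swp x y \<in> stab X f" if "y \<in> ?Y" for y using that assms by (auto intro: stab_swp)
  have K: "g \<in> ?H" if g: "g \<in> stab X f" "ap g x = x" for g
  proof -
    have "ap g permutes (X - {x})"
    proof (rule permutes_superset[of _ X])
      show "ap g permutes X" using g by (simp add: stab_def perms_on_def)
    qed (use g in auto)
    then show ?thesis using g by (simp add: stab_def perms_on_def)
  qed
  have b1: "bij_betw (\<lambda>(h, y). h + swp x y) (?H \<times> ?Y) (stab X f)"
  \<comment> \<open>The partner \<open>y\<close> is recovered as the position that \<open>g\<close>
    sends to \<open>x\<close>; multiplying by the same transposition again leaves a permutation that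
    fixes \<open>x\<close>.\<close>
  proof (rule bij_betw_byWitness[where f' = "\<lambda>g. (g + swp x (ap (- g) x), ap (- g) x)"])
    show "\<forall>a\<in>?H \<times> ?Y. (\<lambda>g. (g + swp x (ap (- g) x), ap (- g) x)) ((\<lambda>(h, y). h + swp x y) a) = a"
    proof
      fix a assume a: "a \<in> ?H \<times> ?Y"
      obtain h y where hy: "a = (h, y)" by force
      have "ap h x = x" using H(2)[of h] a hy by auto
      then have "ap (- h) x = x" by (metis ap_uminus_cancel(1))
      then have "ap (- (h + swp x y)) x = y"
        unfolding minus_add uminus_swp ap_plus_apply ap_swp by simp
      moreover have "h + swp x y + swp x y = h" unfolding add.assoc by simp
      ultimately show "(\<lambda>g. (g + swp x (ap (- g) x), ap (- g) x)) ((\<lambda>(h, y). h + swp x y) a) = a"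
        unfolding hy by simp
    qed
    show "\<forall>g\<in>stab X f. (\<lambda>(h, y). h + swp x y) (g + swp x (ap (- g) x), ap (- g) x) = g"
      by (simp add: add.assoc)
    show "(\<lambda>(h, y). h + swp x y) ` (?H \<times> ?Y) \<subseteq> stab X f"
      using H S by (auto intro: stab_plus)
    show "(\<lambda>g. (g + swp x (ap (- g) x), ap (- g) x)) ` stab X f \<subseteq> ?H \<times> ?Y"
    proof (rule image_subsetI)
      fix g assume g: "g \<in> stab X f"
      then have Y: "ap (- g) x \<in> ?Y" using stab_uminus[OF g] assms by (simp add: stab_def)
      have "g + swp x (ap (- g) x) \<in> ?H"
        by (rule K) (use stab_plus[OF g S[OF Y]] in \<open>simp_all add: ap_swp\<close>)
      with Y show "(g + swp x (ap (- g) x), ap (- g) x) \<in> ?H \<times> ?Y"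
        by simp
    qed
  qed
  show eq: "symz X f = symz (X - {x}) f * (\<Sum>y\<in>?Y. gp (swp x y))"
    unfolding symz_def sum_product gp_mult sum.cartesian_product
    using sum.reindex_bij_betw[OF b1, of gp, symmetric] by (simp only: case_prod_unfold fst_conv snd_conv)
  show "symz X f = (\<Sum>y\<in>?Y. gp (swp x y)) * symz (X - {x}) f"
    using arg_cong[OF eq, of star] by (simp add: star_mult star_sum star_single uminus_swp)
qed

section \<open>Young symmetrizers\<close>

subsection \<open>Tableaux\<close>

text \<open>A tableau assigns to each position in \<open>X\<close> its row and column in the diagram of \<open>\<nu>\<close>.\<close>

definition is_tableau :: "(nat \<Rightarrow> nat) \<Rightarrow> nat set \<Rightarrow> (nat \<Rightarrow> nat) \<Rightarrow> (nat \<Rightarrow> nat) \<Rightarrow> bool" where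
  "is_tableau \<nu> X r c \<longleftrightarrow>
     antimono \<nu> \<and> finite X \<and> bij_betw (\<lambda>x. (r x, c x)) X {(i, j). j < \<nu> i}"

lemma tableau_finite: "is_tableau \<nu> X r c \<Longrightarrow> finite X"
  by (simp add: is_tableau_def)

lemma tableau_inj:
  "is_tableau \<nu> X r c \<Longrightarrow> x \<in> X \<Longrightarrow> y \<in> X \<Longrightarrow> r x = r y \<Longrightarrow> c x = c y \<Longrightarrow> x = y"
  unfolding is_tableau_def bij_betw_def inj_on_def by blast

lemma tableau_in: "is_tableau \<nu> X r c \<Longrightarrow> x \<in> X \<Longrightarrow> c x < \<nu> (r x)"
  unfolding is_tableau_def bij_betw_def by blast

lemma tableau_ex:
  assumes "is_tableau \<nu> X r c" "j < \<nu> i" obtains x where "x \<in> X" "r x = i" "c x = j"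
proof -
  have "(i, j) \<in> (\<lambda>x. (r x, c x)) ` X" using assms unfolding is_tableau_def bij_betw_def by blast
  then show ?thesis using that by blast
qed

lemma tableau_card_row:
  assumes "is_tableau \<nu> X r c" shows "card {x\<in>X. r x = i} = \<nu> i"
proof -
  have "bij_betw c {x\<in>X. r x = i} {..<\<nu> i}"
    unfolding bij_betw_def inj_on_def
    using tableau_inj[OF assms] tableau_in[OF assms] tableau_ex[OF assms] by blast
  then show ?thesis by (simp add: bij_betw_same_card)
qed

lemma tableau_card_rows:
  assumes "is_tableau \<nu> X r c" shows "card {x\<in>X. r x < m} = (\<Sum>i<m. \<nu> i)"
proof -
  have "{x\<in>X. r x < m} = (\<Union>i<m. {x\<in>X. r x = i})" by auto
  also have "card \<dots> = (\<Sum>i<m. card {x\<in>X. r x = i})"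
    by (rule card_UN_disjoint) (use tableau_finite[OF assms] in auto)
  finally show ?thesis by (simp add: tableau_card_row[OF assms])
qed

text \<open>Dominance by pigeonhole. If every column met every fibre of \<open>f\<close> at most
  once, a column would contain at most \<open>m\<close> positions with \<open>f x < m\<close>, and
  never more than its height. The smaller of the two numbers is what the first \<open>m\<close> rows
  of the diagram have in that column.\<close>

lemma tableau_clash:
  fixes f :: "nat \<Rightarrow> nat"
  assumes T: "is_tableau \<nu> X r c" and big: "(\<Sum>i<m. \<nu> i) < card {x\<in>X. f x < m}"
  obtains x y where "x \<in> X" "y \<in> X" "x \<noteq> y" "f x = f y" "c x = c y"
proof (rule ccontr)
  assume no: "\<not> thesis"
  have fin: "finite X" using T by (rule tableau_finite)
  have inj: "x = y" if "x \<in> X" "y \<in> X" "f x = f y" "c x = c y" for x y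
    using no that \<open>\<And>y x. \<lbrakk>x \<in> X; y \<in> X; x \<noteq> y; f x = f y; c x = c y\<rbrakk> \<Longrightarrow> thesis\<close> by blast
  have cols: "card {x\<in>X. P x} = (\<Sum>j\<in>c ` X. card {x\<in>X. P x \<and> c x = j})" for P
  proof -
    have "{x\<in>X. P x} = (\<Union>j\<in>c ` X. {x\<in>X. P x \<and> c x = j})" by auto
    also have "card \<dots> = (\<Sum>j\<in>c ` X. card {x\<in>X. P x \<and> c x = j})"
      by (rule card_UN_disjoint) (use fin in auto)
    finally show ?thesis .
  qed
  have "card {x\<in>X. f x < m \<and> c x = j} \<le> card {x\<in>X. r x < m \<and> c x = j}" for j
  proof (cases "\<exists>x\<in>X. c x = j \<and> m \<le> r x")
    case False
    then show ?thesis using fin by (intro card_mono) (auto simp: not_le)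
  next
    case True
    then obtain x0 where x0: "x0 \<in> X" "c x0 = j" "m \<le> r x0" by blast
    have "i \<in> r ` {x\<in>X. r x < m \<and> c x = j}" if "i < m" for i
    proof -
      have "antimono \<nu>" using T by (simp add: is_tableau_def)
      then have "\<nu> (r x0) \<le> \<nu> i" by (rule antimonoD) (use that x0 in simp)
      then have "j < \<nu> i" using tableau_in[OF T x0(1)] x0 by simp
      then obtain x where "x \<in> X" "r x = i" "c x = j" by (rule tableau_ex[OF T])
      then show ?thesis using that by blast
    qed
    then have "{..<m} \<subseteq> r ` {x\<in>X. r x < m \<and> c x = j}" by blast
    then have "card {..<m} \<le> card {x\<in>X. r x < m \<and> c x = j}"
      using fin by (intro surj_card_le) auto
    moreover have "card {x\<in>X. f x < m \<and> c x = j} \<le> card {..<m}"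
    proof (rule card_inj_on_le[of f])
      show "inj_on f {x\<in>X. f x < m \<and> c x = j}" using inj by (simp add: inj_on_def)
    qed auto
    ultimately show ?thesis by linarith
  qed
  then have "card {x\<in>X. f x < m} \<le> card {x\<in>X. r x < m}"
    unfolding cols[of "\<lambda>x. f x < m"] cols[of "\<lambda>x. r x < m"] by (intro sum_mono)
  then show False using big tableau_card_rows[OF T, of m] by simp
qed

text \<open>Conjugation by \<open>g\<close> replaces \<open>f\<close> by
  \<open>f \<circ> ap g\<close> and keeps the fibre sizes, so a clash occurs for each
  \<open>g\<close> and the product vanishes term by term.\<close>

lemma sym_alt_tableau_zero:
  fixes f :: "nat \<Rightarrow> nat" and z :: "'f::field_char_0 galgebra"
  assumes T: "is_tableau \<nu> X r c" and big: "(\<Sum>i<m. \<nu> i) < card {x\<in>X. f x < m}" and z: "z \<in> galg X"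
  shows "symz X f * z * altz X c = 0"
  using z
proof (induction rule: galg_induct)
  case (add a b)
  then show ?case by (simp add: algebra_simps)
next
  case (gp d g)
  have "(\<Sum>i<m. \<nu> i) < card {x\<in>X. (f \<circ> ap g) x < m}"
    using big card_perm_image[OF gp, of "\<lambda>x. f x < m"] by simp
  then obtain x y where xy: "x \<in> X" "y \<in> X" "x \<noteq> y" "(f \<circ> ap g) x = (f \<circ> ap g) y" "c x = c y"
    by (rule tableau_clash[OF T])
  have 0: "symz X (f \<circ> ap g) * (altz X c :: 'f galgebra) = 0"
    using xy stab_swp[of x X y] by (intro sym_alt_zero[of x y]) auto
  have "symz X f * (const d * gp g) * altz X c = const d * ((symz X f * gp g) * altz X c)"
    by (simp only: const_left_commute[of "symz X f"] mult.assoc)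
  also have "\<dots> = const d * (gp g * (symz X (f \<circ> ap g) * altz X c))"
    unfolding sym_conj[OF gp, symmetric] by (simp only: mult.assoc)
  finally show ?case using 0 by simp
qed

subsection \<open>Positivity\<close>

lemma lookup_mult_sum:
  fixes a b :: "'f::field_char_0 galgebra"
  shows "coef (a * b) k = (\<Sum>i\<in>Poly_Mapping.keys a. \<Sum>j\<in>Poly_Mapping.keys b.
    if i + j = k then coef a i * coef b j else 0)"
proof -
  have "a * b = (\<Sum>i\<in>Poly_Mapping.keys a. const (coef a i) * gp i) *
      (\<Sum>j\<in>Poly_Mapping.keys b. const (coef b j) * gp j)"
    by (simp flip: expand_gp)
  also have "\<dots> = (\<Sum>i\<in>Poly_Mapping.keys a. \<Sum>j\<in>Poly_Mapping.keys b.
      Poly_Mapping.single (i + j) (coef a i * coef b j))"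
    unfolding sum_product by (simp add: mult_single)
  finally show ?thesis by (simp add: lookup_sum lookup_single when_def)
qed

definition int_coeffs :: "'f::field_char_0 galgebra \<Rightarrow> bool" where
  "int_coeffs a \<longleftrightarrow> (\<forall>k. coef a k \<in> \<int>)"

lemma int_coeffs_mult: "int_coeffs a \<Longrightarrow> int_coeffs b \<Longrightarrow> int_coeffs (a * b)"
  unfolding int_coeffs_def lookup_mult_sum by (auto intro!: Ints_sum)

lemma int_coeffs_sym: "int_coeffs (symz X f)"
  unfolding int_coeffs_def symz_def
  by (auto simp: lookup_sum lookup_single when_def intro!: Ints_sum)

lemma int_coeffs_alt: "int_coeffs (altz X f)"
  unfolding int_coeffs_def altz_def const_mult_gp
  by (auto simp: lookup_sum lookup_single when_def psgn_def intro!: Ints_sum)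

lemma lookup_star: "coef (star a) k = coef a (- k)"
  by (rule galg_induct[of a UNIV])
     (auto simp: star_add lookup_add mult_single star_single lookup_single when_def)

text \<open>The coefficient of the identity in \<open>a * star a\<close> is the sum of the squares
  of the coefficients of \<open>a\<close>. These are images of integers, so the sum can be taken in
  the integers, where squares are nonnegative, and characteristic 0 carries the conclusion
  back.\<close>

lemma star_pos:
  fixes a :: "'f::field_char_0 galgebra"
  assumes int: "int_coeffs a" and "a \<noteq> 0"
  shows "a * star a \<noteq> 0"
proof
  assume 0: "a * star a = 0"
  let ?K = "Poly_Mapping.keys a"
  have "\<exists>m. coef a k = of_int m" for k
    using int unfolding int_coeffs_def by (meson Ints_cases)
  then obtain n where n: "\<And>k. coef a k = of_int (n k)"
    by metis
  have keys: "Poly_Mapping.keys (star a) = uminus ` ?K"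
  proof (rule set_eqI)
    fix k
    have "k \<in> uminus ` ?K \<longleftrightarrow> - k \<in> ?K" by (metis image_iff minus_minus)
    then show "k \<in> Poly_Mapping.keys (star a) \<longleftrightarrow> k \<in> uminus ` ?K"
      by (simp add: in_keys_iff lookup_star)
  qed
  have "0 = coef (a * star a) 0" using 0 by simp
  also have "\<dots> = (\<Sum>i\<in>?K. \<Sum>j\<in>?K. if i + - j = 0
      then coef a i * coef a j else 0)"
    unfolding lookup_mult_sum keys by (subst sum.reindex) (simp_all add: lookup_star cong: if_cong)
  also have "\<dots> = (\<Sum>i\<in>?K. coef a i * coef a i)"
  proof (rule sum.cong)
    fix i assume "i \<in> ?K"
    moreover have "i + - j = 0 \<longleftrightarrow> i = j" for j
      using add_right_cancel[of i "- j" j] by simp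
    ultimately show "(\<Sum>j\<in>?K. if i + - j = 0 then coef a i * coef a j else 0) =
        coef a i * coef a i"
      by simp
  qed simp
  also have "\<dots> = of_int (\<Sum>i\<in>?K. n i * n i)"
    by (simp add: n)
  finally have "of_int (\<Sum>i\<in>?K. n i * n i) = (0::'f)" by (rule HOL.sym)
  then have "(\<Sum>i\<in>?K. n i * n i) = 0" by (simp only: of_int_eq_0_iff)
  then have "\<forall>i\<in>?K. n i * n i = 0"
    by (subst (asm) sum_nonneg_eq_0_iff) auto
  then have "coef a k = 0" for k
    using n[of k] by (cases "k \<in> ?K") (auto simp: in_keys_iff)
  then have "a = 0" by (intro poly_mapping_eqI) simp
  then show False using assms(2) by simp
qed

lemma alt_sym_tableau_zero:
  fixes f :: "nat \<Rightarrow> nat" and z :: "'f::field_char_0 galgebra"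
  assumes "is_tableau \<nu> X r c" "(\<Sum>i<m. \<nu> i) < card {x\<in>X. f x < m}" "z \<in> galg X"
  shows "altz X c * z * symz X f = 0"
proof -
  have "star (altz X c * z * symz X f) = symz X f * star z * altz X c"
    by (simp add: star_mult mult.assoc)
  also have "\<dots> = 0" using assms by (intro sym_alt_tableau_zero star_galg) auto
  finally show ?thesis by (metis star_0 star_star)
qed

subsection \<open>Two-sided ideals of the algebra of permutations of X\<close>

text \<open>Membership is built up one summand \<open>a * s * b\<close> at a time, so that each
  induction step meets a single generator. Scalars are supplied by the factor
  \<open>a\<close>.\<close>

inductive_set gideal :: "nat set \<Rightarrow> 'f::field_char_0 galgebra set \<Rightarrow> 'f galgebra set"
  for X S where
  gideal_0: "0 \<in> gideal X S"
| gideal_step: "u \<in> gideal X S \<Longrightarrow> s \<in> S \<Longrightarrow> a \<in> galg X \<Longrightarrow> b \<in> galg X \<Longrightarrow> u + a * s * b \<in> gideal X S"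

lemma gideal_add: "v \<in> gideal X S \<Longrightarrow> u \<in> gideal X S \<Longrightarrow> u + v \<in> gideal X S"
  by (induction rule: gideal.induct) (auto simp flip: add.assoc intro: gideal.intros)

lemma gideal_gen: "s \<in> S \<Longrightarrow> a \<in> galg X \<Longrightarrow> b \<in> galg X \<Longrightarrow> a * s * b \<in> gideal X S"
  using gideal_step[OF gideal_0] by force

lemma gideal_mult:
  assumes "u \<in> gideal X S" "a \<in> galg X" "b \<in> galg X" shows "a * u * b \<in> gideal X S"
  using assms
proof (induction rule: gideal.induct)
  case (gideal_step u s p q)
  have "a * (u + p * s * q) * b = a * u * b + (a * p) * s * (q * b)"
    by (simp add: algebra_simps)
  then show ?case using gideal_step by (auto intro!: gideal.gideal_step galg_mult)
qed (simp add: gideal.gideal_0)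

lemma gideal_mult_left: "u \<in> gideal X S \<Longrightarrow> a \<in> galg X \<Longrightarrow> a * u \<in> gideal X S"
  using gideal_mult[of u X S a 1] by simp

lemma gideal_const: "u \<in> gideal X S \<Longrightarrow> const d * u \<in> gideal X S"
  by (rule gideal_mult_left) auto

lemma gideal_uminus: "u \<in> gideal X S \<Longrightarrow> - u \<in> gideal X S"
  using gideal_const[of u X S "- 1"] by (simp add: single_uminus)

lemma gideal_diff: "u \<in> gideal X S \<Longrightarrow> v \<in> gideal X S \<Longrightarrow> u - v \<in> gideal X S"
  using gideal_add[OF gideal_uminus[of v X S], of u] by (simp add: add_uminus_conv_diff)

lemma gideal_sum: "(\<And>i. i \<in> I \<Longrightarrow> h i \<in> gideal X S) \<Longrightarrow> sum h I \<in> gideal X S"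
  by (induction I rule: infinite_finite_induct) (auto intro: gideal_add gideal_0)

lemma gideal_least: "u \<in> gideal X S \<Longrightarrow> (\<And>s. s \<in> S \<Longrightarrow> s \<in> gideal X S') \<Longrightarrow> u \<in> gideal X S'"
  by (induction rule: gideal.induct) (auto intro: gideal_0 gideal_add gideal_mult)

subsection \<open>Raising operators\<close>

text \<open>Fixing \<open>x\<close> and then averaging over the fibre of \<open>i\<close> enlarged by \<open>x\<close> moves \<open>x\<close> to that fibre.\<close>

lemma sym_raise:
  assumes "finite X" "x \<in> X" "i \<noteq> r x"
  obtains d where
    "symz X r * (1 + (\<Sum>y\<in>{y\<in>X. r y = i}. gp (swp x y))) =
      const d * (symz X r * symz X (r(x := i)) :: 'f::field_char_0 galgebra)"
proof -
  let ?f = "r(x := i)"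
  have "{y\<in>X. ?f y = ?f x} = insert x {y\<in>X. r y = i}" "x \<notin> {y\<in>X. r y = i}" using assms by auto
  then have sum: "(\<Sum>y\<in>{y\<in>X. ?f y = ?f x}. gp (swp x y)) = 1 + (\<Sum>y\<in>{y\<in>X. r y = i}. gp (swp x y))"
    using assms(1) by simp
  have eq: "symz (X - {x}) ?f = symz (X - {x}) r" by (rule sym_cong) auto
  have "stab (X - {x}) r \<subseteq> stab X r" by (rule stab_mono) auto
  then obtain d where d: "symz X r = const d * (symz X r * symz (X - {x}) r :: 'f galgebra)"
    using sym_refine[of "X - {x}" r X r] assms(1) by blast
  have "symz X r * (1 + (\<Sum>y\<in>{y\<in>X. r y = i}. gp (swp x y))) =
      const d * (symz X r * (symz (X - {x}) ?f * (\<Sum>y\<in>{y\<in>X. ?f y = ?f x}. gp (swp x y))))"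
    by (subst d) (simp only: eq sum mult.assoc)
  also have "\<dots> = const d * (symz X r * symz X ?f)"
    by (simp only: sym_coset(1)[OF assms(1,2), of ?f])
  finally show ?thesis by (rule that)
qed

text \<open>One position has moved to an earlier row, which makes the fibres more dominant. When
  \<open>r\<close> gives the rows of a tableau, such symmetrizers are killed by its column
  antisymmetrizer, and the induction for completeness has already dealt with them.\<close>

definition raised :: "nat set \<Rightarrow> (nat \<Rightarrow> nat) \<Rightarrow> 'f::field_char_0 galgebra set" where
  "raised X r = gideal X {symz X (r(x := i)) | x i. x \<in> X \<and> i < r x}"

text \<open>
  The highest weight space of a row symmetrizer is a line. A double coset of the row group is
  rewritten by exchanging a position \<open>x\<close> that is in too low a row under \<open>g\<close> with all
  positions of its correct row.
\<close>

lemma sym_double_coset: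
  fixes r :: "nat \<Rightarrow> nat"
  assumes fin: "finite X" and g: "g \<in> perms_on X"
  shows "\<exists>d. symz X r * gp g * symz X r - const d * symz X r \<in> (raised X r :: 'f::field_char_0 galgebra set)"
  using g
proof (induction "card {y\<in>X. r (ap g y) \<noteq> r y}" arbitrary: g rule: less_induct)
  case less
  let ?S = "symz X r :: 'f galgebra" and ?N = "raised X r :: 'f galgebra set"
  let ?W = "{y\<in>X. r (ap g y) \<noteq> r y}"
  note g = less.prems
  show ?case
  proof (cases "?W = {}")
    case True
    then have "g \<in> stab X r" using g by (auto simp: stab_def)
    then have "?S * gp g * ?S = ?S * ?S" by (simp add: sym_gp)
    also have "\<dots> = const (of_nat (card (stab X r))) * ?S" by (rule sym_absorb(1)) simp
    finally show ?thesis by (intro exI[of _ "of_nat (card (stab X r))"]) (simp add: raised_def gideal_0)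
  next
    case False
    define i where "i = (LEAST i. i \<in> r ` ?W)"
    have "\<exists>i. i \<in> r ` ?W" using False by blast
    then have "i \<in> r ` ?W" unfolding i_def by (rule LeastI_ex)
    then obtain x where x: "x \<in> ?W" "r x = i" by auto
    have low: "r (ap g y) = r y" if "y \<in> X" "r y < i" for y
    proof -
      have "r y \<notin> r ` ?W" using not_less_Least[of "r y" "\<lambda>i. i \<in> r ` ?W"] that(2) unfolding i_def by blast
      then have "y \<notin> ?W" by blast
      then show ?thesis using that(1) by blast
    qed
    \<comment> \<open>Under \<open>g\<close> each row before \<open>i\<close> is already filled by
      its own positions, so a misplaced position of row \<open>i\<close> can only land in a later
      row. Moving its image back to row \<open>i\<close> is then a raising.\<close>
    have gx: "i < r (ap g x)"
    proof (rule ccontr)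
      assume "\<not> i < r (ap g x)"
      then have lt: "r (ap g x) < i" using x by auto
      define k where "k = r (ap g x)"
      have "card {y\<in>X. r (ap g y) = k} = card {y\<in>X. r y = k}"
        using card_perm_image[OF g, of "\<lambda>y. r y = k"] .
      moreover have "{y\<in>X. r y = k} \<subseteq> {y\<in>X. r (ap g y) = k}"
        using low lt unfolding k_def by auto
      ultimately have "{y\<in>X. r y = k} = {y\<in>X. r (ap g y) = k}"
        using fin by (intro card_subset_eq) auto
      moreover have "x \<in> {y\<in>X. r (ap g y) = k}" using x k_def by auto
      ultimately have "x \<in> {y\<in>X. r y = k}" by (rule ssubst)
      then have "r x = k" by simp
      then show False using x k_def by auto
    qed
    define x' where "x' = ap g x"
    have x': "x' \<in> X" "i \<noteq> r x'" using x g gx unfolding x'_def by auto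
    obtain d where d: "?S * (1 + (\<Sum>y\<in>{y\<in>X. r y = i}. gp (swp x' y))) = const d * (?S * symz X (r(x' := i)))"
      by (rule sym_raise[of X x' i r, OF fin x'])
    have "symz X (r(x' := i)) \<in> {symz X (r(x := i)) | x i. x \<in> X \<and> i < r x}"
      using x'(1) gx unfolding x'_def by blast
    then have "?S * symz X (r(x' := i)) * (gp g * ?S) \<in> ?N"
      unfolding raised_def using g by (intro gideal_gen galg_mult) auto
    then have "const d * (?S * symz X (r(x' := i)) * (gp g * ?S)) \<in> ?N"
      unfolding raised_def by (rule gideal_const)
    also have "const d * (?S * symz X (r(x' := i)) * (gp g * ?S)) =
        ?S * (1 + (\<Sum>y\<in>{y\<in>X. r y = i}. gp (swp x' y))) * (gp g * ?S)"
      by (simp only: d mult.assoc)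
    also have "\<dots> = ?S * gp g * ?S + (\<Sum>y\<in>{y\<in>X. r y = i}. ?S * gp (swp x' y + g) * ?S)"
      by (simp add: distrib_left distrib_right sum_distrib_left sum_distrib_right mult.assoc gp_mult_assoc)
    also have "(\<Sum>y\<in>{y\<in>X. r y = i}. ?S * gp (swp x' y + g) * ?S) =
        (\<Sum>y\<in>{y\<in>X. r (ap g y) = i}. ?S * gp (g + swp x y) * ?S)"
    \<comment> \<open>Conjugation moves the transpositions to the right of \<open>g\<close>, and
      each partner is replaced by the position that \<open>g\<close> sends to it.\<close>
    proof (rule sum.reindex_bij_witness[of _ "ap g" "ap (- g)"])
      fix y assume y: "y \<in> {y\<in>X. r y = i}"
      show "ap g (ap (- g) y) = y" by simp
      show "ap (- g) y \<in> {y\<in>X. r (ap g y) = i}" using y perms_on_uminus[OF g] by auto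
      show "?S * gp (g + swp x (ap (- g) y)) * ?S = ?S * gp (swp x' y + g) * ?S"
        unfolding x'_def by (simp flip: swp_conj)
    next
      fix y assume y: "y \<in> {y\<in>X. r (ap g y) = i}"
      show "ap (- g) (ap g y) = y" by simp
      show "ap g y \<in> {y\<in>X. r y = i}" using y g by auto
    qed
    finally have rel: "?S * gp g * ?S + (\<Sum>y\<in>{y\<in>X. r (ap g y) = i}. ?S * gp (g + swp x y) * ?S) \<in> ?N" .
    \<comment> \<open>For a partner in row \<open>i\<close> the right-hand symmetrizer absorbs the
      exchange with \<open>x\<close>. Together with the summand 1 these partners give the
      coefficient \<open>Suc (card ?G)\<close>, which is invertible.\<close>
    let ?G = "{y\<in>X. r (ap g y) = i \<and> r y = i}" and ?B = "{y\<in>X. r (ap g y) = i \<and> r y \<noteq> i}"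
    have "(\<Sum>y\<in>{y\<in>X. r (ap g y) = i}. ?S * gp (g + swp x y) * ?S) =
        (\<Sum>y\<in>?G. ?S * gp (g + swp x y) * ?S) + (\<Sum>y\<in>?B. ?S * gp (g + swp x y) * ?S)"
      by (subst sum.union_disjoint[symmetric]) (use fin in \<open>auto intro!: sum.cong\<close>)
    also have "(\<Sum>y\<in>?G. ?S * gp (g + swp x y) * ?S) = (\<Sum>y\<in>?G. ?S * gp g * ?S)"
    proof (rule sum.cong)
      fix y assume "y \<in> ?G"
      then have "swp x y \<in> stab X r" using x by (intro stab_swp) auto
      then have "gp (swp x y) * ?S = ?S" by (rule gp_sym)
      then show "?S * gp (g + swp x y) * ?S = ?S * gp g * ?S"
        by (simp only: mult.assoc gp_mult[symmetric])
    qed simp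
    finally have split: "?S * gp g * ?S + (\<Sum>y\<in>{y\<in>X. r (ap g y) = i}. ?S * gp (g + swp x y) * ?S) =
        const (of_nat (Suc (card ?G))) * (?S * gp g * ?S) + (\<Sum>y\<in>?B. ?S * gp (g + swp x y) * ?S)"
      by (simp add: single_add distrib_right)
    \<comment> \<open>The exchange puts \<open>x\<close> into its correct row, and \<open>y\<close>
      was misplaced beforehand, so the set of misplaced positions loses \<open>x\<close> and gains
      nothing.\<close>
    have "\<exists>e. ?S * gp (g + swp x y) * ?S - const e * ?S \<in> ?N" if y: "y \<in> ?B" for y
    proof (rule less.hyps)
      show "g + swp x y \<in> perms_on X" using g x y by (intro perms_on_plus perms_on_swp) auto
      have "{z\<in>X. r (ap (g + swp x y) z) \<noteq> r z} \<subseteq> ?W - {x}"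
        using x y gx by (auto simp: ap_swp transpose_def split: if_splits)
      then have "card {z\<in>X. r (ap (g + swp x y) z) \<noteq> r z} \<le> card (?W - {x})"
        using fin by (intro card_mono) auto
      also have "\<dots> < card ?W" using x fin by (intro card_Diff1_less) auto
      finally show "card {z\<in>X. r (ap (g + swp x y) z) \<noteq> r z} < card ?W" .
    qed
    then have "\<forall>y\<in>?B. \<exists>e. ?S * gp (g + swp x y) * ?S - const e * ?S \<in> ?N" by blast
    then obtain e where "\<forall>y\<in>?B. ?S * gp (g + swp x y) * ?S - const (e y) * ?S \<in> ?N"
      unfolding bchoice_iff ..
    then have e: "?S * gp (g + swp x y) * ?S - const (e y) * ?S \<in> ?N" if "y \<in> ?B" for y
      using that by blast
    have "(\<Sum>y\<in>?B. ?S * gp (g + swp x y) * ?S - const (e y) * ?S) \<in> ?N"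
      unfolding raised_def using e by (intro gideal_sum) (auto simp: raised_def)
    then have e': "(\<Sum>y\<in>?B. ?S * gp (g + swp x y) * ?S) - const (sum e ?B) * ?S \<in> ?N"
      by (simp add: sum_subtractf sum_const flip: sum_distrib_right)
    let ?m = "of_nat (Suc (card ?G)) :: 'f"
    have "const ?m * (?S * gp g * ?S) + const (sum e ?B) * ?S \<in> ?N"
      using gideal_diff[OF rel[unfolded raised_def] e'[unfolded raised_def]] unfolding split raised_def by simp
    then have "const (inverse ?m) * (const ?m * (?S * gp g * ?S) + const (sum e ?B) * ?S) \<in> ?N"
      unfolding raised_def by (rule gideal_const)
    also have "const (inverse ?m) * (const ?m * (?S * gp g * ?S) + const (sum e ?B) * ?S) =
        ?S * gp g * ?S - const (- (inverse ?m * sum e ?B)) * ?S"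
    proof -
      have "?m \<noteq> 0" using of_nat_neq_0 by blast
      then have "inverse ?m * ?m = 1" by (rule left_inverse)
      then show ?thesis
        unfolding distrib_left const_mult_assoc by (simp only: single_one single_uminus) simp
    qed
    finally show ?thesis by blast
  qed
qed

lemma sym_compress:
  fixes r :: "nat \<Rightarrow> nat"
  assumes fin: "finite X" and z: "z \<in> galg X"
  shows "\<exists>d. symz X r * z * symz X r - const d * symz X r \<in> (raised X r :: 'f::field_char_0 galgebra set)"
  using z
proof (induction rule: galg_induct)
  case (add a b)
  then obtain d e where "symz X r * a * symz X r - const d * symz X r \<in> (raised X r :: 'f galgebra set)"
    "symz X r * b * symz X r - const e * symz X r \<in> (raised X r :: 'f galgebra set)" by blast
  then have "symz X r * (a + b) * symz X r - const (d + e) * symz X r \<in> (raised X r :: 'f galgebra set)"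
    using gideal_add unfolding raised_def by (fastforce simp: algebra_simps single_add)
  then show ?case by blast
next
  case (gp c g)
  obtain d where "symz X r * gp g * symz X r - const d * symz X r \<in> (raised X r :: 'f galgebra set)"
    using sym_double_coset[OF fin gp] by blast
  then have "const c * (symz X r * gp g * symz X r - const d * symz X r) \<in> (raised X r :: 'f galgebra set)"
    unfolding raised_def by (rule gideal_const)
  also have "const c * (symz X r * gp g * symz X r - const d * symz X r) =
      symz X r * (const c * gp g) * symz X r - const (c * d) * symz X r"
    by (simp only: right_diff_distrib const_left_commute[of "symz X r"] const_mult_assoc mult.assoc)
  finally show ?case by blast
qed

subsection \<open>Quasi-idempotence and orthogonality\<close>

abbreviation yelem :: "nat set \<Rightarrow> (nat \<Rightarrow> nat) \<Rightarrow> (nat \<Rightarrow> nat) \<Rightarrow> 'f::field_char_0 galgebra" where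
  "yelem X r c \<equiv> symz X r * altz X c"

lemma lookup_yelem:
  assumes "finite X"
  shows "coef (yelem X r c) k =
    (\<Sum>p\<in>stab X r. \<Sum>q\<in>stab X c. if p + q = k then psgn q else 0)"
proof -
  have "yelem X r c = (\<Sum>p\<in>stab X r. \<Sum>q\<in>stab X c. Poly_Mapping.single (p + q) (psgn q))"
    unfolding symz_def altz_def sum_product by (simp add: mult_single)
  from arg_cong[OF this, of "\<lambda>a. coef a k"] show ?thesis
    by (simp only: lookup_sum lookup_single when_def)
qed

lemma tableau_stab_inter:
  assumes T: "is_tableau \<nu> X r c" and "g \<in> stab X r" "g \<in> stab X c" shows "g = 0"
proof (rule fperm_eqI)
  fix x show "ap g x = ap 0 x"
  proof (cases "x \<in> X")
    case True
    then show ?thesis using assms tableau_inj[OF T, of "ap g x" x] by (simp add: stab_def)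
  next
    case False
    then show ?thesis using assms(2) perms_on_fix stab_perms_on by fastforce
  qed
qed

text \<open>The row group and the column group meet only in the identity, so the coefficient of the
  identity is 1.\<close>

lemma yelem_nonzero:
  assumes T: "is_tableau \<nu> X r c" shows "yelem X r c \<noteq> (0 :: 'f::field_char_0 galgebra)"
proof -
  have fin: "finite X" using T by (rule tableau_finite)
  have "p = 0 \<and> q = 0" if "p \<in> stab X r" "q \<in> stab X c" "p + q = 0" for p q
  proof -
    have "q = - p" using minus_unique[OF that(3)] by simp
    then show ?thesis using that stab_uminus[of p X r] tableau_stab_inter[OF T, of q] by auto
  qed
  then have "(\<Sum>q\<in>stab X c. if p + q = 0 then psgn q else (0::'f)) =
      (if p = 0 then 1 else 0)" if "p \<in> stab X r" for p
  proof (cases "p = 0")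
    case True
    then have "(\<Sum>q\<in>stab X c. if p + q = 0 then psgn q else (0::'f)) =
        (\<Sum>q\<in>stab X c. if q = 0 then 1 else 0)" by (intro sum.cong) auto
    then show ?thesis using True fin by simp
  next
    case False
    then show ?thesis using \<open>\<And>q p. \<lbrakk>p \<in> stab X r; q \<in> stab X c; p + q = 0\<rbrakk> \<Longrightarrow> p = 0 \<and> q = 0\<close> that
      by (auto intro!: sum.neutral)
  qed
  then have "coef (yelem X r c) 0 = (\<Sum>p\<in>stab X r. if p = 0 then 1 else (0::'f))"
    unfolding lookup_yelem[OF fin] by (intro sum.cong) auto
  also have "\<dots> = 1" using fin by simp
  finally show ?thesis by auto
qed

lemma yelem_galg [simp]: "yelem X r c \<in> galg X"
  by (simp add: galg_mult)

text \<open>Raising \<open>x\<close> to row \<open>i\<close> puts one position too many into the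
  rows up to and including \<open>i\<close>; this is the pigeonhole situation with
  \<open>m = Suc i\<close>.\<close>

lemma raised_alt_zero:
  assumes T: "is_tableau \<nu> X r c" and "u \<in> raised X r" "z \<in> galg X"
  shows "u * z * altz X c = 0"
  using assms(2) unfolding raised_def
proof (induction rule: gideal.induct)
  case (gideal_step u s a b)
  obtain x i where s: "s = symz X (r(x := i))" "x \<in> X" "i < r x" using gideal_step by blast
  have fin: "finite X" using T by (rule tableau_finite)
  have "{y\<in>X. (r(x := i)) y < Suc i} = insert x {y\<in>X. r y < Suc i}" "x \<notin> {y\<in>X. r y < Suc i}"
    using s by auto
  then have "card {y\<in>X. (r(x := i)) y < Suc i} = Suc (\<Sum>j<Suc i. \<nu> j)"
    using fin tableau_card_rows[OF T, of "Suc i"] by simp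
  then have "s * (b * z) * altz X c = 0"
    unfolding s(1) using gideal_step assms(3)
    by (intro sym_alt_tableau_zero[OF T, where m = "Suc i"] galg_mult) auto
  then show ?case using gideal_step by (simp add: distrib_right mult.assoc)
qed simp

text \<open>The two inner sides form \<open>symz X r * (altz X c * z) * symz X r\<close>, a scalar
  multiple of the symmetrizer modulo \<open>raised\<close>; the antisymmetrizer on the right kills
  the remainder.\<close>

lemma yelem_compress:
  assumes T: "is_tableau \<nu> X r c" and z: "z \<in> galg X"
  obtains d where "yelem X r c * z * yelem X r c = const d * yelem X r c"
proof -
  have fin: "finite X" using T by (rule tableau_finite)
  obtain d where d: "symz X r * (altz X c * z) * symz X r - const d * symz X r \<in> raised X r"
    using sym_compress[OF fin] z galg_mult alt_galg by metis
  have "(symz X r * (altz X c * z) * symz X r - const d * symz X r) * 1 * altz X c = 0"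
    by (rule raised_alt_zero[OF T d galg_1])
  then show ?thesis by (intro that[of d]) (simp add: left_diff_distrib mult.assoc)
qed

text \<open>Positivity is applied twice: to \<open>?S * ?A\<close>, which gives
  \<open>?S * ?A * ?S \<noteq> 0\<close>, and then to that element. The second product contains the
  square of the Young element as a factor, so the scalar from \<open>yelem_compress\<close> is
  nonzero.\<close>

lemma yelem_square:
  assumes T: "is_tableau \<nu> X r c"
  obtains d where "d \<noteq> 0" "yelem X r c * yelem X r c = const d * (yelem X r c :: 'f::field_char_0 galgebra)"
proof -
  let ?S = "symz X r :: 'f galgebra" and ?A = "altz X c :: 'f galgebra"
  have int: "int_coeffs (?S * ?A * ?S)" "int_coeffs (?S * ?A)"
    by (simp_all add: int_coeffs_mult int_coeffs_sym int_coeffs_alt)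
  have AA: "?A * ?A = const (of_nat (card (stab X c))) * ?A" by (rule alt_absorb) simp
  have SS: "?S * ?S = const (of_nat (card (stab X r))) * ?S" by (rule sym_absorb) simp
  have "(?S * ?A) * star (?S * ?A) \<noteq> 0"
    by (rule star_pos[OF int(2) yelem_nonzero[OF T]])
  also have "(?S * ?A) * star (?S * ?A) = ?S * (?A * ?A) * ?S" by (simp add: star_mult mult.assoc)
  also have "\<dots> = const (of_nat (card (stab X c))) * (?S * ?A * ?S)"
    unfolding AA by (simp only: const_left_commute[of ?S] mult.assoc)
  finally have "?S * ?A * ?S \<noteq> 0" by auto
  then have "(?S * ?A * ?S) * star (?S * ?A * ?S) \<noteq> 0" by (rule star_pos[OF int(1)])
  also have "(?S * ?A * ?S) * star (?S * ?A * ?S) = ?S * ?A * (?S * ?S) * ?A * ?S"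
    by (simp add: star_mult mult.assoc)
  also have "\<dots> = const (of_nat (card (stab X r))) * ((?S * ?A * (?S * ?A)) * ?S)"
    unfolding SS by (simp only: const_left_commute[of ?S] const_left_commute[of ?A] mult.assoc)
  finally have ne: "?S * ?A * (?S * ?A) \<noteq> 0" by auto
  obtain d where "?S * ?A * 1 * (?S * ?A) = const d * (?S * ?A)"
    by (rule yelem_compress[OF T, of 1]) auto
  then show ?thesis using ne by (intro that[of d]) auto
qed

text \<open>Distinct partitions differ in some partial sum. The rows of the one with the larger sum
  are too full for the columns of the other, and the pigeonhole applies either to the two inner
  factors or to the two outer ones.\<close>

lemma yelem_orthogonal:
  assumes T: "is_tableau \<nu> X r c" and T': "is_tableau \<kappa> X r' c'" and ne: "\<nu> \<noteq> \<kappa>" and z: "z \<in> galg X"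
  shows "yelem X r c * z * yelem X r' c' = 0"
proof -
  have "\<exists>m. (\<Sum>i<m. \<nu> i) \<noteq> (\<Sum>i<m. \<kappa> i)"
  proof (rule ccontr)
    assume "\<nexists>m. (\<Sum>i<m. \<nu> i) \<noteq> (\<Sum>i<m. \<kappa> i)"
    then have eq: "(\<Sum>i<m. \<nu> i) = (\<Sum>i<m. \<kappa> i)" for m by blast
    have "\<nu> m = \<kappa> m" for m using eq[of m] eq[of "Suc m"] by simp
    then show False using ne by auto
  qed
  then obtain m where "(\<Sum>i<m. \<nu> i) < (\<Sum>i<m. \<kappa> i) \<or> (\<Sum>i<m. \<kappa> i) < (\<Sum>i<m. \<nu> i)"
    using nat_neq_iff by blast
  then show ?thesis
  proof
    assume "(\<Sum>i<m. \<nu> i) < (\<Sum>i<m. \<kappa> i)"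
    then have "altz X c * z * symz X r' = 0"
      using tableau_card_rows[OF T', of m] z by (intro alt_sym_tableau_zero[OF T, of m]) auto
    then have "symz X r * (altz X c * z * symz X r') * altz X c' = 0" by simp
    then show ?thesis by (simp only: mult.assoc)
  next
    assume "(\<Sum>i<m. \<kappa> i) < (\<Sum>i<m. \<nu> i)"
    then have "symz X r * (altz X c * z * symz X r') * altz X c' = 0"
      using tableau_card_rows[OF T, of m] z
      by (intro sym_alt_tableau_zero[OF T', of m] galg_mult) auto
    then show ?thesis by (simp only: mult.assoc)
  qed
qed

subsection \<open>Completeness and irreducibility\<close>

lemma exists_tableau:
  fixes f :: "nat \<Rightarrow> nat"
  assumes fin: "finite X"
  obtains \<nu> r c where "is_tableau \<nu> X r c" "\<And>x y. x \<in> X \<Longrightarrow> y \<in> X \<Longrightarrow> r x = r y \<longleftrightarrow> f x = f y"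
proof -
  \<comment> \<open>Negated so that ascending order lists the largest fibres first and the row
    lengths decrease.\<close>
  define key where "key v = - int (card {x\<in>X. f x = v})" for v
  define L where "L = sort_key key (sorted_list_of_set (f ` X))"
  have L: "set L = f ` X" "distinct L" "sorted (map key L)"
    using fin by (simp_all add: L_def)
  have "\<exists>i<length L. L ! i = f x" if "x \<in> X" for x
    using that L(1) by (metis imageI in_set_conv_nth)
  then obtain r where r: "\<And>x. x \<in> X \<Longrightarrow> r x < length L \<and> L ! r x = f x" by metis
  have "\<exists>h. bij_betw h {x\<in>X. f x = v} {0..<card {x\<in>X. f x = v}}" for v
    using fin by (intro ex_bij_betw_finite_nat) auto
  then obtain h where h: "\<And>v. bij_betw (h v) {x\<in>X. f x = v} {0..<card {x\<in>X. f x = v}}" by metis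
  define c where "c x = h (f x) x" for x
  define \<nu> where "\<nu> i = (if i < length L then card {x\<in>X. f x = L ! i} else 0)" for i
  have rf: "r x = r y \<longleftrightarrow> f x = f y" if "x \<in> X" "y \<in> X" for x y
    using r[OF that(1)] r[OF that(2)] L(2) nth_eq_iff_index_eq by metis
  have "antimono \<nu>"
  proof (rule antimonoI)
    fix i j :: nat assume "i \<le> j"
    then show "\<nu> j \<le> \<nu> i"
      using sorted_nth_mono[OF L(3), of i j] by (auto simp: \<nu>_def key_def)
  qed
  moreover have "inj_on (\<lambda>x. (r x, c x)) X"
  proof (rule inj_onI)
    fix x y assume xy: "x \<in> X" "y \<in> X" "(r x, c x) = (r y, c y)"
    then have "f x = f y" using rf by simp
    then show "x = y" using xy h[of "f x"] by (auto simp: c_def bij_betw_def inj_on_def)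
  qed
  moreover have "(\<lambda>x. (r x, c x)) ` X = {(i, j). j < \<nu> i}"
  proof (intro subset_antisym subsetI)
    fix p assume "p \<in> (\<lambda>x. (r x, c x)) ` X"
    then obtain x where x: "x \<in> X" "p = (r x, c x)" by blast
    have "h (f x) x \<in> {0..<card {y\<in>X. f y = f x}}"
      using h[of "f x"] x(1) unfolding bij_betw_def by blast
    then show "p \<in> {(i, j). j < \<nu> i}" using r[OF x(1)] x by (simp add: c_def \<nu>_def)
  next
    fix p assume "p \<in> {(i, j). j < \<nu> i}"
    then obtain i j where p: "p = (i, j)" "j < \<nu> i" by blast
    then have i: "i < length L" "j < card {x\<in>X. f x = L ! i}" by (auto simp: \<nu>_def split: if_splits)
    then have "j \<in> h (L ! i) ` {x\<in>X. f x = L ! i}" using h[of "L ! i"] by (simp add: bij_betw_def)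
    then obtain x where x: "x \<in> X" "f x = L ! i" "h (L ! i) x = j" by blast
    have "r x = i" using r[OF x(1)] x(2) i(1) L(2) nth_eq_iff_index_eq by metis
    then show "p \<in> (\<lambda>x. (r x, c x)) ` X" using x p by (auto simp: c_def)
  qed
  ultimately have "is_tableau \<nu> X r c" using fin by (simp add: is_tableau_def bij_betw_def)
  then show ?thesis using rf by (rule that)
qed

definition young_ideal :: "nat set \<Rightarrow> 'f::field_char_0 galgebra set" where
  "young_ideal X = gideal X {yelem X r c | \<nu> r c. is_tableau \<nu> X r c}"

text \<open>The number of ordered pairs in a common fibre is the sum of the squares of the fibre
  sizes, a numerical measure for dominance. Moving \<open>x\<close> to a fibre at least as large as
  its old one, which still counts \<open>x\<close>, makes it grow strictly.\<close>

lemma card_fibre_pairs_raise: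
  fixes r :: "nat \<Rightarrow> nat"
  assumes fin: "finite X" and x: "x \<in> X" "i \<noteq> r x"
    and le: "card {y\<in>X. r y = r x} \<le> card {y\<in>X. r y = i}"
  shows "card {(y, z). y \<in> X \<and> z \<in> X \<and> r y = r z} <
    card {(y, z). y \<in> X \<and> z \<in> X \<and> (r(x := i)) y = (r(x := i)) z}" (is "card ?P < card ?Q")
proof -
  let ?A = "{y\<in>X. r y = r x} - {x}" and ?B = "{y\<in>X. r y = i}"
  let ?C = "{(y, z). y \<in> X \<and> z \<in> X \<and> r y = r z \<and> (y = x \<longleftrightarrow> z = x)}"
  have finC: "finite ?C" by (rule finite_subset[of _ "X \<times> X"]) (use fin in auto)
  have star: "card (({x} \<times> D) \<union> (D \<times> {x})) = 2 * card D" if "finite D" "x \<notin> D" for D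
    using that by (subst card_Un_disjoint) (auto simp: card_cartesian_product)
  have P: "?P = ?C \<union> (({x} \<times> ?A) \<union> (?A \<times> {x}))" using x by auto
  have Q: "?Q = ?C \<union> (({x} \<times> ?B) \<union> (?B \<times> {x}))" using x by (auto split: if_splits)
  have "card ?P = card ?C + card (({x} \<times> ?A) \<union> (?A \<times> {x}))"
    unfolding P using fin finC by (intro card_Un_disjoint) auto
  also have "card (({x} \<times> ?A) \<union> (?A \<times> {x})) = 2 * card ?A" using fin by (intro star) auto
  finally have cP: "card ?P = card ?C + 2 * card ?A" .
  have "card ?Q = card ?C + card (({x} \<times> ?B) \<union> (?B \<times> {x}))"
    unfolding Q using fin finC x by (intro card_Un_disjoint) auto
  also have "card (({x} \<times> ?B) \<union> (?B \<times> {x})) = 2 * card ?B" using fin x by (intro star) auto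
  finally have cQ: "card ?Q = card ?C + 2 * card ?B" .
  have "card ?A < card {y\<in>X. r y = r x}" using fin x by (intro card_Diff1_less) auto
  then show ?thesis using le cP cQ by linarith
qed

text \<open>Induction from more dominant fibres to less dominant ones. Take a tableau whose rows are
  the fibres of \<open>f\<close>. The element \<open>?S * ?A * ?S\<close> lies in the ideal and
  differs from \<open>const d * ?S\<close> by raised terms, which lie in the ideal by induction;
  \<open>d = 0\<close> would make \<open>?S * ?A * ?S * ?A\<close> vanish, contrary to
  \<open>yelem_square\<close>.\<close>

lemma sym_in_young_ideal:
  fixes f :: "nat \<Rightarrow> nat"
  assumes fin: "finite X"
  shows "symz X f \<in> (young_ideal X :: 'f::field_char_0 galgebra set)"
proof (induction "card (X \<times> X) - card {(y, z). y \<in> X \<and> z \<in> X \<and> f y = f z}" arbitrary: f rule: less_induct)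
  case less
  obtain \<nu> r c where T: "is_tableau \<nu> X r c" and rf: "\<And>x y. x \<in> X \<Longrightarrow> y \<in> X \<Longrightarrow> r x = r y \<longleftrightarrow> f x = f y"
    by (rule exists_tableau[OF fin, of f]) blast
  have eq: "{(y, z). y \<in> X \<and> z \<in> X \<and> f y = f z} = {(y, z). y \<in> X \<and> z \<in> X \<and> r y = r z}"
    using rf by blast
  let ?S = "symz X r :: 'f galgebra" and ?A = "altz X c :: 'f galgebra"
  have "symz X (r(x := i)) \<in> (young_ideal X :: 'f galgebra set)" if "x \<in> X" "i < r x" for x i
  proof (rule less.hyps)
    have "\<nu> (r x) \<le> \<nu> i" using T that by (auto simp: is_tableau_def intro: antimonoD)
    then have "card {(y, z). y \<in> X \<and> z \<in> X \<and> r y = r z} <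
        card {(y, z). y \<in> X \<and> z \<in> X \<and> (r(x := i)) y = (r(x := i)) z}"
      using that tableau_card_row[OF T] by (intro card_fibre_pairs_raise[OF fin]) auto
    moreover have "card {(y, z). y \<in> X \<and> z \<in> X \<and> (r(x := i)) y = (r(x := i)) z} \<le> card (X \<times> X)"
      using fin by (intro card_mono) auto
    ultimately show "card (X \<times> X) - card {(y, z). y \<in> X \<and> z \<in> X \<and> (r(x := i)) y = (r(x := i)) z} <
        card (X \<times> X) - card {(y, z). y \<in> X \<and> z \<in> X \<and> f y = f z}"
      unfolding eq by linarith
  qed
  then have raised: "u \<in> young_ideal X" if "u \<in> (raised X r :: 'f galgebra set)" for u
    using that unfolding raised_def young_ideal_def by (elim gideal_least) auto
  obtain d where d: "?S * ?A * ?S - const d * ?S \<in> raised X r"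
    using sym_compress[OF fin, of ?A r] by auto
  have "d \<noteq> 0"
  proof
    assume "d = 0"
    then have "?S * ?A * ?S \<in> raised X r" using d by simp
    then have "?S * ?A * ?S * 1 * ?A = 0" by (rule raised_alt_zero[OF T]) simp
    moreover obtain e where "e \<noteq> 0" "yelem X r c * yelem X r c = const e * (?S * ?A)"
      by (rule yelem_square[OF T])
    ultimately have "const e * (?S * ?A) = 0" by (simp add: mult.assoc)
    then show False using const_cancel[OF \<open>e \<noteq> 0\<close>] yelem_nonzero[OF T] by blast
  qed
  have "1 * (?S * ?A) * ?S \<in> young_ideal X"
    unfolding young_ideal_def by (rule gideal_gen) (use T in auto)
  then have "?S * ?A * ?S \<in> young_ideal X" by simp
  then have "?S * ?A * ?S - (?S * ?A * ?S - const d * ?S) \<in> young_ideal X"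
    using raised[OF d] unfolding young_ideal_def by (rule gideal_diff)
  then have "const d * ?S \<in> young_ideal X" by simp
  then have "const (inverse d) * (const d * ?S) \<in> young_ideal X"
    unfolding young_ideal_def by (rule gideal_const)
  then have "?S \<in> young_ideal X" using \<open>d \<noteq> 0\<close> by (simp only: const_mult_assoc) simp
  also have "?S = symz X f" using rf by (intro sym_cong)
  finally show ?case .
qed

text \<open>The unit is the symmetrizer of the partition into single points. This is the
  completeness that later splits a tensor power into isotypic components.\<close>

lemma one_in_young_ideal:
  assumes "finite X" shows "1 \<in> (young_ideal X :: 'f::field_char_0 galgebra set)"
proof -
  have "stab X (\<lambda>x. x) = {0}"
  proof (intro subset_antisym subsetI)
    fix g assume g: "g \<in> stab X (\<lambda>x. x)"
    have "ap g x = x" for x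
      using g perms_on_fix[OF stab_perms_on[OF g], of x] by (cases "x \<in> X") (auto simp: stab_def)
    then show "g \<in> {0}" by (auto intro: fperm_eqI)
  qed simp
  then have "symz X (\<lambda>x. x) = (1 :: 'f galgebra)" by (simp add: symz_def)
  then show ?thesis using sym_in_young_ideal[OF assms, of "\<lambda>x. x", where 'f = 'f] by simp
qed

lemma tableau_conj:
  assumes T: "is_tableau \<nu> X r c" and T': "is_tableau \<nu> X r' c'"
  obtains g where "g \<in> perms_on X" "yelem X r' c' = gp (- g) * (yelem X r c :: 'f::field_char_0 galgebra) * gp g"
proof -
  have fin: "finite X" using T by (rule tableau_finite)
  define p where "p x = (r x, c x)" for x
  define p' where "p' x = (r' x, c' x)" for x
  have bij: "bij_betw p X {(i, j). j < \<nu> i}" "bij_betw p' X {(i, j). j < \<nu> i}"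
    using T T' unfolding is_tableau_def p_def p'_def by auto
  have b: "bij_betw (inv_into X p \<circ> p') X X"
    using bij by (meson bij_betw_inv_into bij_betw_trans)
  define \<sigma> where "\<sigma> x = (if x \<in> X then (inv_into X p \<circ> p') x else x)" for x
  have "bij_betw \<sigma> X X" using b by (subst bij_betw_cong[of X \<sigma> "inv_into X p \<circ> p'"]) (auto simp: \<sigma>_def)
  then have perm: "\<sigma> permutes X" by (rule bij_imp_permutes) (simp add: \<sigma>_def)
  define g where "g = FPerm \<sigma>"
  have pg: "ap g = \<sigma>" unfolding g_def by (rule ap_FPerm[OF fin perm])
  have g: "g \<in> perms_on X" using perm pg by (simp add: perms_on_def)
  have "p (ap g x) = p' x" if "x \<in> X" for x
  proof -
    have "p' x \<in> p ` X" using bij_betwE[OF bij(2)] bij_betw_imp_surj_on[OF bij(1)] that by simp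
    then show ?thesis using that by (simp add: pg \<sigma>_def f_inv_into_f)
  qed
  then have eq: "r' x = (r \<circ> ap g) x" "c' x = (c \<circ> ap g) x" if "x \<in> X" for x
    using that by (auto simp: p_def p'_def)
  have s: "symz X r' = (symz X (r \<circ> ap g) :: 'f galgebra)" by (rule sym_cong) (simp add: eq)
  have a: "altz X c' = (altz X (c \<circ> ap g) :: 'f galgebra)"
    unfolding altz_def using stab_cong[of X c' "c \<circ> ap g"] eq by simp
  have "gp (- g) * (yelem X r c :: 'f galgebra) * gp g = gp (- g) * (symz X r * (altz X c * gp g))"
    by (simp only: mult.assoc)
  also have "\<dots> = gp (- g) * ((symz X r * gp g) * altz X c')"
    unfolding a alt_conj[OF g, symmetric] by (simp only: mult.assoc)
  also have "\<dots> = yelem X r' c'"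
    unfolding s sym_conj[OF g, symmetric] by (simp add: mult.assoc gp_mult_assoc)
  finally show ?thesis using that[OF g] by simp
qed

text \<open>If \<open>e * y\<close> killed all translates of Young elements, it would kill the unit.
  Orthogonality forces a surviving one to have shape \<open>\<nu>\<close>; it is conjugate to
  \<open>e\<close>, and \<open>yelem_compress\<close> provides the scalar. In this form
  irreducibility makes a nonzero homomorphism out of the right ideal of \<open>e\<close>
  injective.\<close>

lemma yelem_irreducible:
  assumes T: "is_tableau \<nu> X r c" and y: "y \<in> galg X" and ne: "yelem X r c * y \<noteq> 0"
  obtains z d where "z \<in> galg X" "d \<noteq> 0"
    "yelem X r c * y * z * yelem X r c = const d * (yelem X r c :: 'f::field_char_0 galgebra)"
proof -
  let ?e = "yelem X r c :: 'f galgebra"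
  have "\<exists>a \<kappa> r' c'. a \<in> galg X \<and> is_tableau \<kappa> X r' c' \<and> ?e * y * a * yelem X r' c' \<noteq> 0"
  proof (rule ccontr)
    assume no: "\<not> ?thesis"
    have "?e * y * u = 0" if "u \<in> young_ideal X" for u
      using that unfolding young_ideal_def
    proof (induction rule: gideal.induct)
      case (gideal_step u s a b)
      then have "?e * y * a * s = 0" using no by blast
      moreover have "?e * y * (u + a * s * b) = ?e * y * u + (?e * y * a * s) * b"
        by (simp only: distrib_left mult.assoc)
      ultimately show ?case using gideal_step by simp
    qed simp
    from this[OF one_in_young_ideal[OF tableau_finite[OF T]]] show False using ne by simp
  qed
  then obtain a \<kappa> r' c' where a: "a \<in> galg X" and T': "is_tableau \<kappa> X r' c'"
    and ne': "?e * y * a * yelem X r' c' \<noteq> 0" by blast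
  have "\<nu> = \<kappa>"
  proof (rule ccontr)
    assume "\<nu> \<noteq> \<kappa>"
    then have "?e * (y * a) * yelem X r' c' = 0"
      by (rule yelem_orthogonal[OF T T']) (intro galg_mult y a)
    then show False using ne' by (simp add: mult.assoc)
  qed
  then have "is_tableau \<nu> X r' c'" using T' by simp
  then obtain g where g: "g \<in> perms_on X" "yelem X r' c' = gp (- g) * ?e * gp g"
    by (rule tableau_conj[OF T])
  have z: "a * gp (- g) \<in> galg X" using a g(1) by (intro galg_mult galg_single perms_on_uminus)
  obtain d where d: "?e * (y * (a * gp (- g))) * ?e = const d * ?e"
    by (rule yelem_compress[OF T galg_mult[OF y z]])
  have "d \<noteq> 0"
  proof
    assume "d = 0"
    then have "?e * (y * (a * gp (- g))) * ?e * gp g = 0" using d by simp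
    then show False using ne' unfolding g(2) by (simp add: mult.assoc)
  qed
  moreover have "?e * y * (a * gp (- g)) * ?e = const d * ?e" using d by (simp only: mult.assoc)
  ultimately show ?thesis using that[OF z] by blast
qed

subsection \<open>Factorizations and rectangles\<close>

text \<open>The inner factor is what a bound works with: a rectangle with \<open>X1 = X2\<close> for
  the lower bound, the first rows and the remaining parts of the first columns for the upper
  bound.\<close>

lemma yelem_factor:
  assumes "finite X" "X1 \<subseteq> X" "X2 \<subseteq> X"
  obtains d where "yelem X r c =
    const d * (symz X r * (symz X1 r * altz X2 c) * altz X c :: 'f::field_char_0 galgebra)"
proof -
  have fin: "finite X1" "finite X2" using assms finite_subset by auto
  have "stab X1 r \<subseteq> stab X r" "stab X2 c \<subseteq> stab X c" by (rule stab_mono; use assms in simp)+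
  then obtain d d' where d: "symz X r = const d * (symz X r * symz X1 r :: 'f galgebra)"
    and d': "altz X c = const d' * (altz X2 c * altz X c :: 'f galgebra)"
    using sym_refine[OF fin(1)] alt_refine[OF fin(2)] by metis
  have "yelem X r c = (const d * (symz X r * symz X1 r)) * (const d' * (altz X2 c * altz X c :: 'f galgebra))"
    by (simp flip: d d')
  also have "\<dots> = const (d * d') * (symz X r * (symz X1 r * altz X2 c) * altz X c)"
    by (simp only: const_left_commute[of "symz X r"] const_left_commute[of "symz X1 r"] const_mult[symmetric] mult.assoc)
  finally show ?thesis by (rule that)
qed

text \<open>A relation of Garnir type. In a rectangle each column meets row \<open>i\<close>, so
  once \<open>x\<close> has joined that row, two positions share both fibre and column, whichever
  row permutation intervenes. Hence the symmetrizer of the enlarged row kills the Young element, and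
  \<open>sym_coset\<close> rewrites it as the sum of transpositions.\<close>

lemma rectangle_relation:
  fixes r c :: "nat \<Rightarrow> nat"
  assumes fin: "finite X" and bij: "bij_betw (\<lambda>x. (r x, c x)) X ({..a} \<times> {..b})"
    and x: "x \<in> X" and i: "i \<le> a" "i \<noteq> r x"
  shows "(1 + (\<Sum>y\<in>{y\<in>X. r y = i}. gp (swp x y))) * (yelem X r c :: 'f::field_char_0 galgebra) = 0"
proof -
  let ?f = "r(x := i)" and ?S = "symz X r :: 'f galgebra" and ?A = "altz X c :: 'f galgebra"
  have zero: "symz X ?f * gp p * ?A = 0" if p: "p \<in> stab X r" for p
  proof -
    have px: "p \<in> perms_on X" using p by (rule stab_perms_on)
    \<comment> \<open>The position that \<open>p\<close> carries to \<open>x\<close>. It stays in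
      the row of \<open>x\<close>, and its column mate in row \<open>i\<close> shares its fibre
      under \<open>?f \<circ> ap p\<close>.\<close>
    define x' where "x' = ap (- p) x"
    have x': "x' \<in> X" "r x' = r x" "ap p x' = x"
      using stab_uminus[OF p] x perms_on_uminus[OF px] by (simp_all add: x'_def stab_def)
    have "(i, c x') \<in> (\<lambda>x. (r x, c x)) ` X"
    proof -
      have "(r x', c x') \<in> {..a} \<times> {..b}" using bij_betwE[OF bij] x'(1) by blast
      then show ?thesis using bij i unfolding bij_betw_def by simp
    qed
    then obtain y where y: "y \<in> X" "r y = i" "c y = c x'" by auto
    have "y \<noteq> x'" using y x' i by auto
    then have "ap p y \<noteq> x" using x'(3) ap_inj by metis
    then have f: "(?f \<circ> ap p) x' = (?f \<circ> ap p) y"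
      using x' y p by (simp add: stab_def)
    have "symz X (?f \<circ> ap p) * ?A = 0"
    proof (rule sym_alt_zero)
      show "swp x' y \<in> stab X (?f \<circ> ap p)" by (rule stab_swp[OF x'(1) y(1) f])
      show "swp x' y \<in> stab X c" by (rule stab_swp[OF x'(1) y(1)]) (simp add: y)
    qed (use \<open>y \<noteq> x'\<close> in simp)
    then show ?thesis unfolding sym_conj[OF px, symmetric] by (simp only: mult.assoc mult_zero_right)
  qed
  have "symz X ?f * (?S * ?A) = (\<Sum>p\<in>stab X r. symz X ?f * gp p * ?A)"
    by (simp add: symz_def[of X r] sum_distrib_left sum_distrib_right mult.assoc)
  then have 0: "symz X ?f * (?S * ?A) = 0" using zero by simp
  have "{y\<in>X. ?f y = ?f x} = insert x {y\<in>X. r y = i}" "x \<notin> {y\<in>X. r y = i}" using x i by auto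
  then have sum: "(\<Sum>y\<in>{y\<in>X. ?f y = ?f x}. gp (swp x y)) =
      (1 + (\<Sum>y\<in>{y\<in>X. r y = i}. gp (swp x y)) :: 'f galgebra)"
    using fin by simp
  have eq: "symz (X - {x}) ?f = (symz (X - {x}) r :: 'f galgebra)" by (rule sym_cong) auto
  have "stab (X - {x}) r \<subseteq> stab X r" by (rule stab_mono) auto
  then obtain d where d: "?S = const d * (symz (X - {x}) r * ?S)"
    using sym_refine[of "X - {x}" r X r] fin by (metis finite_Diff)
  let ?R = "1 + (\<Sum>y\<in>{y\<in>X. r y = i}. gp (swp x y)) :: 'f galgebra"
  have "?R * (?S * ?A) = ?R * ((const d * (symz (X - {x}) r * ?S)) * ?A)" by (simp flip: d)
  also have "\<dots> = const d * ((?R * symz (X - {x}) ?f) * (?S * ?A))"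
    by (simp only: eq const_left_commute[of ?R] mult.assoc)
  also have "?R * symz (X - {x}) ?f = symz X ?f"
    by (simp only: sym_coset(2)[OF fin x, of ?f] sum)
  finally show ?thesis using 0 by simp
qed

section \<open>The action on tensor powers\<close>

lemma prod_neg_one_if:
  assumes "finite D"
  shows "(\<Prod>p\<in>D. if P p then - 1 else (1::'f::comm_ring_1)) = (- 1) ^ card {p\<in>D. P p}"
proof -
  have "(\<Prod>p\<in>D. if P p then - 1 else (1::'f)) = (\<Prod>p\<in>{p\<in>D. P p}. - 1)"
    using prod.inter_filter[OF assms, of "\<lambda>_. - 1 :: 'f" P] by simp
  then show ?thesis by (simp only: prod_constant)
qed

text \<open>The cocycle rule for the Koszul sign. A pair contributes -1 exactly when both factors
  are odd and their order changes, and the change under \<open>\<sigma> \<circ> \<tau>\<close> is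
  the product of the change under \<open>\<tau>\<close> and the subsequent one under
  \<open>\<sigma>\<close>.\<close>

lemma (in super_vector_space) odd_inversions_comp:
  assumes \<sigma>: "\<sigma> permutes {..<n}" and \<tau>: "\<tau> permutes {..<n}"
  shows "(- 1) ^ odd_inversions n (\<sigma> \<circ> \<tau>) S =
    (- 1) ^ odd_inversions n \<sigma> S * ((- 1) ^ odd_inversions n \<tau> {i. i < n \<and> \<sigma> i \<in> S} :: 'f)"
proof -
  let ?D = "{(i, j). i < j \<and> j < n}" and ?S = "{i. i < n \<and> \<sigma> i \<in> S}"
  have fin: "finite ?D" by (rule finite_subset[of _ "{..<n} \<times> {..<n}"]) auto
  define t where "t \<rho> U = (\<lambda>(i, j). if \<rho> i \<in> U \<and> \<rho> j \<in> U \<and> ((i < j) \<noteq> (\<rho> i < \<rho> j)) then - 1 else (1::'f))"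
    for \<rho> :: "nat \<Rightarrow> nat" and U
  have inj: "\<rho> i = \<rho> j \<longleftrightarrow> i = j" if "\<rho> permutes {..<n}" for \<rho> i j
    using permutes_inj[OF that] by (simp add: inj_eq)
  have eq: "(- 1) ^ odd_inversions n \<rho> U = (\<Prod>p\<in>?D. t \<rho> U p)" if "\<rho> permutes {..<n}" for \<rho> U
  proof -
    have set_eq: "{(i, j). i < j \<and> j < n \<and> \<rho> i \<in> U \<and> \<rho> j \<in> U \<and> \<rho> i > \<rho> j} =
        {p\<in>?D. case p of (i, j) \<Rightarrow> \<rho> i \<in> U \<and> \<rho> j \<in> U \<and> ((i < j) \<noteq> (\<rho> i < \<rho> j))}"
      using inj[OF that] by (auto simp: not_less le_less)
    show ?thesis
      unfolding odd_inversions_def set_eq prod_neg_one_if[OF fin, symmetric]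
      by (rule prod.cong) (simp_all add: t_def case_prod_unfold)
  qed
  have \<tau>n: "\<tau> i < n \<longleftrightarrow> i < n" "inv \<tau> i < n \<longleftrightarrow> i < n" for i
    using permutes_in_image[OF \<tau>, of i] permutes_in_image[OF permutes_inv[OF \<tau>], of i] by auto
  have \<tau>inv: "\<tau> (inv \<tau> i) = i" "inv \<tau> (\<tau> i) = i" for i
    using permutes_inverses[OF \<tau>] by auto
  have neq: "\<tau> i < \<tau> j \<longleftrightarrow> \<not> \<tau> j < \<tau> i" if "i < j" for i j
    using inj[OF \<tau>, of i j] that by auto
  have neq': "inv \<tau> i < inv \<tau> j \<longleftrightarrow> \<not> inv \<tau> j < inv \<tau> i" if "i < j" for i j
    using inj[OF permutes_inv[OF \<tau>], of i j] that by auto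
  \<comment> \<open>The sign \<open>t \<sigma> S\<close> does not depend on the order of the two
    positions. Sorting therefore turns the bijection that \<open>\<tau>\<close> induces on unordered
    pairs into a reindexing of increasing pairs.\<close>
  define srt where "srt = (\<lambda>(i, j). if i < j then (i, j) else (j, i :: nat))"
  have "(\<Prod>p\<in>?D. t (\<sigma> \<circ> \<tau>) S p) = (\<Prod>(i, j)\<in>?D. t \<sigma> S (\<tau> i, \<tau> j) * t \<tau> ?S (i, j))"
  proof (rule prod.cong[OF refl])
    fix p assume "p \<in> ?D"
    then obtain i j where ij: "p = (i, j)" "i < j" "j < n" by blast
    then have "\<tau> i < n" "\<tau> j < n" using \<tau>n by auto
    then show "t (\<sigma> \<circ> \<tau>) S p = (case p of (i, j) \<Rightarrow> t \<sigma> S (\<tau> i, \<tau> j) * t \<tau> ?S (i, j))"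
      using ij(2) unfolding ij(1)
      by (cases "\<sigma> (\<tau> i) \<in> S"; cases "\<sigma> (\<tau> j) \<in> S"; cases "\<tau> i < \<tau> j"; cases "\<sigma> (\<tau> i) < \<sigma> (\<tau> j)")
         (simp_all add: t_def)
  qed
  also have "\<dots> = (\<Prod>(i, j)\<in>?D. t \<sigma> S (\<tau> i, \<tau> j)) * (\<Prod>p\<in>?D. t \<tau> ?S p)"
    by (simp add: prod.distrib case_prod_unfold)
  also have "(\<Prod>(i, j)\<in>?D. t \<sigma> S (\<tau> i, \<tau> j)) = (\<Prod>p\<in>?D. t \<sigma> S p)"
  proof (rule prod.reindex_bij_witness[of _ "\<lambda>(i, j). srt (inv \<tau> i, inv \<tau> j)" "\<lambda>(i, j). srt (\<tau> i, \<tau> j)"])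
    fix p assume p: "p \<in> ?D"
    obtain i j where ij: "p = (i, j)" "i < j" "j < n" using p by auto
    show "(\<lambda>(i, j). srt (\<tau> i, \<tau> j)) p \<in> ?D"
      using ij neq[of i j] \<tau>n by (auto simp: srt_def)
    show "(\<lambda>(i, j). srt (inv \<tau> i, inv \<tau> j)) p \<in> ?D"
      using ij neq'[of i j] \<tau>n by (auto simp: srt_def)
    show "(\<lambda>(i, j). srt (inv \<tau> i, inv \<tau> j)) ((\<lambda>(i, j). srt (\<tau> i, \<tau> j)) p) = p"
      using ij by (auto simp: srt_def \<tau>inv)
    show "(\<lambda>(i, j). srt (\<tau> i, \<tau> j)) ((\<lambda>(i, j). srt (inv \<tau> i, inv \<tau> j)) p) = p"
      using ij by (auto simp: srt_def \<tau>inv)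
    show "t \<sigma> S ((\<lambda>(i, j). srt (\<tau> i, \<tau> j)) p) = (case p of (i, j) \<Rightarrow> t \<sigma> S (\<tau> i, \<tau> j))"
      using ij neq[of i j] inj[OF \<sigma>, of "\<tau> i" "\<tau> j"] by (auto simp: srt_def t_def)
  qed
  finally show ?thesis
    unfolding eq[OF \<sigma>] eq[OF \<tau>] eq[OF permutes_compose[OF \<tau> \<sigma>]] .
qed

lemma (in super_vector_space) odd_inversions_id [simp]: "odd_inversions n id S = 0"
proof -
  have "{(i, j). i < j \<and> j < n \<and> id i \<in> S \<and> id j \<in> S \<and> id i > id j} = {}" by auto
  then show ?thesis by (simp only: odd_inversions_def card.empty)
qed

text \<open>Exchanging two odd positions reverses their own pair and, for each odd position between
  them, two further pairs, so the count is odd. Two even positions reverse no pair of odd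
  factors.\<close>

lemma (in super_vector_space) odd_inversions_transpose:
  assumes "x < n" "y < n" "x \<noteq> y" and "x \<in> S \<longleftrightarrow> y \<in> S"
  shows "(- 1) ^ odd_inversions n (transpose x y) S = (if x \<in> S then - 1 else (1::'f))"
  using assms
proof (induction x y rule: linorder_wlog)
  case (sym x y)
  then show ?case by (simp add: transpose_commute)
next
  case (le x y)
  then have "x < y" by simp
  let ?I = "{(i, j). i < j \<and> j < n \<and> transpose x y i \<in> S \<and> transpose x y j \<in> S \<and> transpose x y i > transpose x y j}"
  show ?case
  proof (cases "x \<in> S")
    case False
    then have "?I = {}" using le by (auto simp: transpose_def split: if_splits)
    then show ?thesis using False by (simp only: odd_inversions_def card.empty power_0 if_False)
  next
    case True
    let ?M = "{j \<in> S. x < j \<and> j < y}"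
    have fin: "finite ?M" by (rule finite_subset[of _ "{..<y}"]) auto
    have I: "?I = insert (x, y) ({x} \<times> ?M \<union> ?M \<times> {y})"
    proof (rule set_eqI)
      fix p :: "nat \<times> nat"
      obtain i j where p: "p = (i, j)" by force
      show "p \<in> ?I \<longleftrightarrow> p \<in> insert (x, y) ({x} \<times> ?M \<union> ?M \<times> {y})"
        unfolding p using le True \<open>x < y\<close>
        by (cases "i = x"; cases "i = y"; cases "j = x"; cases "j = y") (auto simp: transpose_def)
    qed
    have "card ?I = Suc (card ({x} \<times> ?M \<union> ?M \<times> {y}))"
      unfolding I using fin by (subst card_insert_disjoint) auto
    also have "card ({x} \<times> ?M \<union> ?M \<times> {y}) = 2 * card ?M"
      using fin by (subst card_Un_disjoint) (auto simp: card_cartesian_product)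
    finally have "odd_inversions n (transpose x y) S = Suc (2 * card ?M)"
      unfolding odd_inversions_def .
    then show ?thesis using True by (simp del: mult_Suc_right)
  qed
qed

declare zero_fun_apply [simp del] plus_fun_apply [simp del]

section \<open>Words in a homogeneous basis and the right action of the group algebra\<close>

locale homogeneous_basis = super_vector_space scale V0 V1
  for scale :: "'f::field_char_0 \<Rightarrow> 'v::ab_group_add \<Rightarrow> 'v" and V0 V1 +
  fixes B0 B1 :: "'v set"
  assumes fin: "finite B0" "finite B1" and B0: "B0 \<subseteq> V0" and B1: "B1 \<subseteq> V1"
    and disj: "B0 \<inter> B1 = {}"
    and indep: "local.independent (B0 \<union> B1)" and spanning: "local.span (B0 \<union> B1) = UNIV"
begin

abbreviation "pos n \<equiv> {..<n::nat}"

definition words :: "nat \<Rightarrow> 'v list set" where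
  "words n = {w. length w = n \<and> set w \<subseteq> B0 \<union> B1}"

definition permute :: "fperm \<Rightarrow> 'v list \<Rightarrow> 'v list" where
  "permute g w = map (\<lambda>i. w ! ap g i) [0..<length w]"

definition koszul :: "fperm \<Rightarrow> 'v list \<Rightarrow> 'f" where
  "koszul g w = (- 1) ^ odd_inversions (length w) (ap g) {i. i < length w \<and> w ! i \<in> B1}"

lemma koszul_cases: "koszul g w = 1 \<or> koszul g w = - 1"
  by (cases "even (odd_inversions (length w) (ap g) {i. i < length w \<and> w ! i \<in> B1})")
     (auto simp: koszul_def)

lemma finite_words: "finite (words n)"
  using finite_lists_length_eq[of "B0 \<union> B1" n] fin by (simp add: words_def conj_commute)

lemma length_permute [simp]: "length (permute g w) = length w"
  by (simp add: permute_def)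

lemma nth_permute [simp]: "i < length w \<Longrightarrow> permute g w ! i = w ! ap g i"
  by (simp add: permute_def)

lemma permute_words:
  assumes "w \<in> words n" "g \<in> perms_on (pos n)" shows "permute g w \<in> words n"
proof -
  have "permute g w ! i \<in> B0 \<union> B1" if "i < n" for i
  proof -
    have "ap g i < n" using perms_on_in[OF assms(2), of i] that by simp
    then have "w ! ap g i \<in> set w" using assms(1) by (auto simp: words_def)
    then show ?thesis using assms(1) that by (auto simp: words_def)
  qed
  then have "x \<in> B0 \<union> B1" if "x \<in> set (permute g w)" for x
    using that assms(1) by (auto simp: words_def in_set_conv_nth simp del: nth_permute Un_iff)
  then show ?thesis using assms(1) by (auto simp: words_def)
qed

lemma place_act_word:
  assumes w: "w \<in> words n" and g: "g \<in> perms_on (pos n)"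
  shows "place_act n (ap g) (tensor w) = fscale (koszul g w) (tensor (permute g w))"
proof -
  have "w ! i \<in> (if i \<in> {i. i < n \<and> w ! i \<in> B1} then V1 else V0)" if "i < n" for i
  proof -
    have "w ! i \<in> B0 \<union> B1" using w that by (auto simp: words_def subset_iff)
    then show ?thesis using B0 B1 that by auto
  qed
  then show ?thesis
    using w g place_act_homogeneous[of "ap g" n w "{i. i < n \<and> w ! i \<in> B1}"]
    by (auto simp: words_def sym_group_def perms_on_def koszul_def permute_def)
qed

lemma tensor_power_span: "tensor_power n = fun_vs.span (tensor ` words n)"
  using tensor_span[OF spanning, of n] by (simp add: words_def)

lemma place_act_0 [simp]: "place_act n \<sigma> 0 = 0"
  by (simp add: place_act_def fun_eq_iff zero_fun_apply)

lemma tensor_power_induct [consumes 1, case_names zero step]: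
  assumes "t \<in> tensor_power n" "P 0"
    and "\<And>c w t. w \<in> words n \<Longrightarrow> t \<in> tensor_power n \<Longrightarrow> P t \<Longrightarrow> P (fscale c (tensor w) + t)"
  shows "P t"
proof -
  have "t \<in> tensor_power n \<and> P t"
    using assms(1) unfolding tensor_power_span
  proof (induction rule: fun_vs.span_induct_alt)
    case base
    show ?case using assms(2) by (simp add: fun_vs.span_zero)
  next
    case (step c x y)
    then obtain w where w: "w \<in> words n" "x = tensor w" by blast
    have "fscale c x + y \<in> fun_vs.span (tensor ` words n)"
      using step by (intro fun_vs.span_add fun_vs.span_scale fun_vs.span_base[of x]) auto
    moreover have "P (fscale c x + y)"
      using assms(3)[OF w(1), of y c] step(2) unfolding w(2) tensor_power_span by simp
    ultimately show ?case by simp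
  qed
  then show ?thesis by simp
qed

lemma tensor_power_subspace: "fun_vs.subspace (tensor_power n)"
  unfolding tensor_power_span by (rule fun_vs.subspace_span)

lemma tensor_in_power: "w \<in> words n \<Longrightarrow> tensor w \<in> tensor_power n"
  unfolding tensor_power_span by (auto intro: fun_vs.span_base)

lemma place_act_closed:
  assumes "t \<in> tensor_power n" and g: "g \<in> perms_on (pos n)"
  shows "place_act n (ap g) t \<in> tensor_power n"
  using assms(1)
proof (induction rule: tensor_power_induct)
  case zero
  show ?case using fun_vs.subspace_0[OF tensor_power_subspace] by simp
next
  case (step c w t)
  then show ?case
    unfolding place_act_add place_act_scale place_act_word[OF step(1) g]
    by (intro fun_vs.subspace_add[OF tensor_power_subspace] fun_vs.subspace_scale[OF tensor_power_subspace]
        tensor_in_power permute_words g)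
qed

lemma place_act_comp:
  assumes "t \<in> tensor_power n" and g: "g \<in> perms_on (pos n)" and h: "h \<in> perms_on (pos n)"
  shows "place_act n (ap (g + h)) t = place_act n (ap h) (place_act n (ap g) t)"
  using assms(1)
proof (induction rule: tensor_power_induct)
  case (step c w t)
  have len: "length w = n" using step by (simp add: words_def)
  have hn: "ap h i < n \<longleftrightarrow> i < n" for i using perms_on_in[OF h, of i] by simp
  have gn: "ap g i < n \<longleftrightarrow> i < n" for i using perms_on_in[OF g, of i] by simp
  have perm: "permute (g + h) w = permute h (permute g w)"
    by (rule nth_equalityI) (auto simp: len hn)
  have eq: "{i. i < n \<and> permute g w ! i \<in> B1} = {i. i < n \<and> ap g i \<in> {i. i < n \<and> w ! i \<in> B1}}"
    by (auto simp: len gn)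
  have kos: "koszul (g + h) w = koszul g w * koszul h (permute g w)"
    unfolding koszul_def length_permute len eq ap_plus using g h
    by (intro odd_inversions_comp) (auto simp: perms_on_def)
  have "place_act n (ap (g + h)) (tensor w) = place_act n (ap h) (place_act n (ap g) (tensor w))"
    unfolding place_act_word[OF step(1) perms_on_plus[OF g h]] place_act_word[OF step(1) g]
      place_act_scale place_act_word[OF permute_words[OF step(1) g] h]
    by (simp add: perm kos)
  then show ?case unfolding place_act_add place_act_scale step(3) by simp
qed simp

lemma place_act_id:
  assumes "t \<in> tensor_power n" shows "place_act n id t = t"
  using assms
proof (induction rule: tensor_power_induct)
  case (step c w t)
  have "permute 0 w = w" by (rule nth_equalityI) auto
  then have "place_act n id (tensor w) = tensor w"
    using place_act_word[OF step(1), of 0] by (simp add: koszul_def)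
  then show ?case unfolding place_act_add place_act_scale step(3) by simp
qed simp

text \<open>Coefficients outside \<open>perms_on (pos n)\<close> are dropped, which makes the action
  total and linear on the whole algebra; \<open>act_mult\<close> is available on
  \<open>galg (pos n)\<close>.\<close>

definition act :: "nat \<Rightarrow> (('v list \<Rightarrow> 'f) \<Rightarrow> 'f) \<Rightarrow> 'f galgebra \<Rightarrow> ('v list \<Rightarrow> 'f) \<Rightarrow> 'f" where
  "act n t a = (\<Sum>g\<in>perms_on (pos n). fscale (coef a g) (place_act n (ap g) t))"

lemma act_0_left [simp]: "act n 0 a = 0"
  by (simp add: act_def)

lemma act_0_right [simp]: "act n t 0 = 0"
  by (simp add: act_def)

lemma act_add_left: "act n (s + t) a = act n s a + act n t a"
  by (simp add: act_def place_act_add fun_vs.scale_right_distrib sum.distrib)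

lemma act_scale_left: "act n (fscale c t) a = fscale c (act n t a)"
  by (simp add: act_def place_act_scale fun_vs.scale_sum_right mult.commute)

lemma act_add_right: "act n t (a + b) = act n t a + act n t b"
  by (simp add: act_def lookup_add fun_vs.scale_left_distrib sum.distrib)

lemma act_sum_right: "act n t (sum h I) = (\<Sum>i\<in>I. act n t (h i))"
  by (induction I rule: infinite_finite_induct) (auto simp: act_add_right)

lemma act_single:
  assumes "g \<in> perms_on (pos n)"
  shows "act n t (Poly_Mapping.single g c) = fscale c (place_act n (ap g) t)"
proof -
  have "act n t (Poly_Mapping.single g c) =
      (\<Sum>h\<in>perms_on (pos n). if h = g then fscale c (place_act n (ap g) t) else 0)"
    unfolding act_def by (rule sum.cong) (auto simp: lookup_single when_def)
  then show ?thesis using assms by (simp add: finite_perms_on)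
qed

lemma act_closed:
  assumes "t \<in> tensor_power n" shows "act n t a \<in> tensor_power n"
  unfolding act_def using assms
  by (intro fun_vs.subspace_sum[OF tensor_power_subspace] fun_vs.subspace_scale[OF tensor_power_subspace]
      place_act_closed)

lemma act_const: "act n t (const c * a) = fscale c (act n t a)"
  by (simp add: act_def fun_vs.scale_sum_right lookup_const_mult)

lemma act_gp: "g \<in> perms_on (pos n) \<Longrightarrow> act n t (gp g) = place_act n (ap g) t"
  by (simp add: act_single)

lemma act_1: "t \<in> tensor_power n \<Longrightarrow> act n t 1 = t"
  using act_gp[of 0 n t] by (simp add: place_act_id)

lemma act_mult:
  assumes t: "t \<in> tensor_power n" and a: "a \<in> galg (pos n)" and b: "b \<in> galg (pos n)"
  shows "act n t (a * b) = act n (act n t a) b"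
  using a
proof (induction rule: galg_induct)
  case (add a a')
  then show ?case by (simp add: distrib_right act_add_right act_add_left)
next
  case (gp c g)
  have "act n t (gp g * b) = act n (act n t (gp g)) b"
    using b
  proof (induction rule: galg_induct)
    case (add b b')
    then show ?case by (simp add: distrib_left act_add_right)
  next
    case h: (gp d h)
    have "act n t (gp g * (const d * gp h)) = fscale d (act n t (gp (g + h)))"
      by (simp only: const_left_commute[of "gp g"] act_const gp_mult)
    also have "\<dots> = fscale d (act n (act n t (gp g)) (gp h))"
      using place_act_comp[OF t gp h] gp h by (simp add: act_gp perms_on_plus)
    finally show ?case by (simp only: act_const)
  qed
  then show ?case by (simp only: act_const act_scale_left mult.assoc)
qed

lemma act_uminus_right: "act n t (- a) = - act n t a"
  using act_add_right[of n t a "- a"] by (simp add: eq_neg_iff_add_eq_0 add.commute)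

lemma act_word:
  assumes "w \<in> words n" "g \<in> perms_on (pos n)"
  shows "act n (tensor w) (gp g) = fscale (koszul g w) (tensor (permute g w))"
  using assms by (simp add: act_gp place_act_word)

lemma act_word_swp:
  assumes w: "w \<in> words n" and xy: "x < n" "y < n" "x \<noteq> y" "w ! x = w ! y"
  shows "act n (tensor w) (gp (swp x y)) = fscale (if w ! x \<in> B1 then - 1 else 1) (tensor w)"
proof -
  have len: "length w = n" using w by (simp add: words_def)
  have "permute (swp x y) w = w"
    using xy by (intro nth_equalityI) (auto simp: ap_swp transpose_def)
  moreover have "koszul (swp x y) w = (if w ! x \<in> B1 then - 1 else 1)"
    unfolding koszul_def len ap_swp using xy by (subst odd_inversions_transpose) auto
  ultimately show ?thesis using act_word[OF w, of "swp x y"] xy by (simp add: perms_on_swp)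
qed

end

section \<open>Specht modules and isotypic components\<close>

lemma tableau_partition:
  assumes T: "is_tableau \<nu> X r c"
  shows "\<nu> \<in> partitions" "psize \<nu> = card X"
proof -
  have fin: "finite X" using T by (rule tableau_finite)
  have "{i. \<nu> i \<noteq> 0} \<subseteq> r ` X"
  proof
    fix i assume "i \<in> {i. \<nu> i \<noteq> 0}"
    then obtain x where "x \<in> X" "r x = i" by (auto elim: tableau_ex[OF T, of 0 i])
    then show "i \<in> r ` X" by blast
  qed
  then have fin\<nu>: "finite {i. \<nu> i \<noteq> 0}" using fin finite_surj by blast
  then show "\<nu> \<in> partitions" using T by (simp add: partitions_def is_tableau_def)
  have "psize \<nu> = (\<Sum>i | \<nu> i \<noteq> 0. card {x\<in>X. r x = i})"
    unfolding psize_def by (simp add: tableau_card_row[OF T])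
  also have "\<dots> = card (\<Union>i\<in>{i. \<nu> i \<noteq> 0}. {x\<in>X. r x = i})"
    by (rule card_UN_disjoint[symmetric]) (use fin fin\<nu> in auto)
  also have "(\<Union>i\<in>{i. \<nu> i \<noteq> 0}. {x\<in>X. r x = i}) = X"
    using tableau_in[OF T] by fastforce
  finally show "psize \<nu> = card X" .
qed

lemma standard_tableau:
  assumes "\<nu> \<in> partitions"
  obtains r c where "is_tableau \<nu> {..<psize \<nu>} r c"
    "\<And>x. x < psize \<nu> \<Longrightarrow> tableau \<nu> (r x) (c x) = x"
proof -
  define D where "D = {(i, j). j < \<nu> i}"
  define t where "t = (\<lambda>(i, j). tableau \<nu> i j)"
  have anti: "antimono \<nu>" and fin: "finite {i. \<nu> i \<noteq> 0}" using assms by (auto simp: partitions_def)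
  obtain N where N: "\<And>i. \<nu> i \<noteq> 0 \<Longrightarrow> i < N" using fin finite_nat_set_iff_bounded by auto
  have psize: "psize \<nu> = (\<Sum>i<N. \<nu> i)"
    unfolding psize_def by (rule sum.mono_neutral_left) (use N in auto)
  have mono: "(\<Sum>r<i. \<nu> r) \<le> (\<Sum>r<i'. \<nu> r)" if "i \<le> i'" for i i'
    using that by (intro sum_mono2) auto
  have lt: "t (i, j) < t (i', j')" if "(i, j) \<in> D" "i < i'" for i j i' j'
  proof -
    have "t (i, j) < (\<Sum>r<Suc i. \<nu> r)" using that by (simp add: t_def tableau_def D_def)
    also have "\<dots> \<le> (\<Sum>r<i'. \<nu> r)" using that by (intro mono) simp
    finally show ?thesis by (simp add: t_def tableau_def)
  qed
  have "inj_on t D"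
  proof (rule inj_onI)
    fix p q assume pq: "p \<in> D" "q \<in> D" "t p = t q"
    obtain i j i' j' where ij: "p = (i, j)" "q = (i', j')" by force
    have "i = i'" using lt[of i j i' j'] lt[of i' j' i j] pq ij by (cases i i' rule: linorder_cases) auto
    then show "p = q" using pq ij by (simp add: t_def tableau_def)
  qed
  moreover have "t ` D = {..<psize \<nu>}"
  proof (intro subset_antisym subsetI)
    fix x assume "x \<in> t ` D"
    then obtain i j where ij: "(i, j) \<in> D" "x = t (i, j)" by auto
    then have "i < N" using N[of i] by (auto simp: D_def)
    have "x < (\<Sum>r<Suc i. \<nu> r)" using ij by (simp add: t_def tableau_def D_def)
    also have "\<dots> \<le> psize \<nu>" unfolding psize using \<open>i < N\<close> by (intro mono) simp
    finally show "x \<in> {..<psize \<nu>}" by simp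
  next
    fix x assume "x \<in> {..<psize \<nu>}"
    then have ex: "\<exists>i. x < (\<Sum>r<i. \<nu> r)" unfolding psize by auto
    \<comment> \<open>The first row start beyond \<open>x\<close>, so \<open>x\<close> lies in the
      row before; \<open>k\<close> is positive because the empty sum is 0.\<close>
    define k where "k = (LEAST i. x < (\<Sum>r<i. \<nu> r))"
    have k: "x < (\<Sum>r<k. \<nu> r)" unfolding k_def using ex by (rule LeastI_ex)
    then obtain i where i: "k = Suc i" by (cases k) auto
    have "\<not> x < (\<Sum>r<i. \<nu> r)" using not_less_Least[of i "\<lambda>i. x < (\<Sum>r<i. \<nu> r)"] i unfolding k_def by simp
    then have "(i, x - (\<Sum>r<i. \<nu> r)) \<in> D \<and> t (i, x - (\<Sum>r<i. \<nu> r)) = x"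
      using k i by (simp add: D_def t_def tableau_def)
    then show "x \<in> t ` D" by force
  qed
  ultimately have bij: "bij_betw t D {..<psize \<nu>}" by (simp add: bij_betw_def)
  define s where "s = inv_into D t"
  have bij_s: "bij_betw s {..<psize \<nu>} D" unfolding s_def by (rule bij_betw_inv_into[OF bij])
  have "is_tableau \<nu> {..<psize \<nu>} (fst \<circ> s) (snd \<circ> s)"
    using anti bij_s by (simp add: is_tableau_def D_def)
  moreover have "tableau \<nu> ((fst \<circ> s) x) ((snd \<circ> s) x) = x" if "x < psize \<nu>" for x
  proof -
    have "t (s x) = x" unfolding s_def using bij that by (simp add: bij_betw_inv_into_right)
    then show ?thesis by (simp add: t_def case_prod_unfold)
  qed
  ultimately show ?thesis by (rule that)
qed

text \<open>Setwise invariance of fibres is the form in which \<open>row_group\<close> and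
  \<open>column_group\<close> are given.\<close>

lemma stab_iff_fibres:
  assumes "finite X" "\<And>i. F i = {x\<in>X. f x = i}"
  shows "g \<in> stab X f \<longleftrightarrow> ap g permutes X \<and> (\<forall>i. ap g ` F i = F i)"
proof
  assume g: "g \<in> stab X f"
  have "ap g ` F i = F i" for i
  proof (rule endo_inj_surj)
    show "finite (F i)" using assms by simp
    show "ap g ` F i \<subseteq> F i" using g stab_perms_on[OF g] by (auto simp: assms(2) stab_def)
    show "inj_on (ap g) (F i)" by (simp add: inj_on_def)
  qed
  then show "ap g permutes X \<and> (\<forall>i. ap g ` F i = F i)"
    using g by (simp add: stab_def perms_on_def)
next
  assume g: "ap g permutes X \<and> (\<forall>i. ap g ` F i = F i)"
  have "f (ap g x) = f x" if "x \<in> X" for x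
  proof -
    have "ap g x \<in> ap g ` F (f x)" using that assms(2) by simp
    then have "ap g x \<in> F (f x)" using g by blast
    then show ?thesis using assms(2) by simp
  qed
  then show "g \<in> stab X f" using g by (simp add: stab_def perms_on_def)
qed

lemma ap_image_perms_on: "ap ` perms_on {..<n} = sym_group n"
proof (intro subset_antisym subsetI)
  fix \<sigma> assume "\<sigma> \<in> sym_group n"
  then have perm: "\<sigma> permutes {..<n}" by (simp add: sym_group_def)
  have eq: "ap (FPerm \<sigma>) = \<sigma>" by (rule ap_FPerm[OF _ perm]) simp
  then have "FPerm \<sigma> \<in> perms_on {..<n}" using perm by (simp add: perms_on_def)
  then show "\<sigma> \<in> ap ` perms_on {..<n}" using eq by force
qed (auto simp: perms_on_def sym_group_def)

lemma sym_group_ap: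
  assumes "\<sigma> \<in> sym_group n" obtains g where "g \<in> perms_on {..<n}" "\<sigma> = ap g"
  using assms ap_image_perms_on by blast

lemma ap_image_stab:
  "ap ` stab {..<n} f = {\<sigma> \<in> sym_group n. \<forall>i. \<sigma> ` {x\<in>{..<n}. f x = i} = {x\<in>{..<n}. f x = i}}"
proof (rule set_eqI)
  fix \<sigma>
  note fib = stab_iff_fibres[of "{..<n}" "\<lambda>i. {x\<in>{..<n}. f x = i}" f, OF finite_lessThan refl]
  show "\<sigma> \<in> ap ` stab {..<n} f \<longleftrightarrow>
      \<sigma> \<in> {\<sigma> \<in> sym_group n. \<forall>i. \<sigma> ` {x\<in>{..<n}. f x = i} = {x\<in>{..<n}. f x = i}}"
  proof
    assume "\<sigma> \<in> ap ` stab {..<n} f"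
    then show "\<sigma> \<in> {\<sigma> \<in> sym_group n. \<forall>i. \<sigma> ` {x\<in>{..<n}. f x = i} = {x\<in>{..<n}. f x = i}}"
      using fib by (auto simp: sym_group_def simp del: lessThan_iff)
  next
    assume \<sigma>: "\<sigma> \<in> {\<sigma> \<in> sym_group n. \<forall>i. \<sigma> ` {x\<in>{..<n}. f x = i} = {x\<in>{..<n}. f x = i}}"
    then obtain g where g: "g \<in> perms_on {..<n}" "\<sigma> = ap g" using sym_group_ap by blast
    then have "g \<in> stab {..<n} f" using fib[of g] \<sigma> by (simp add: sym_group_def del: lessThan_iff)
    then show "\<sigma> \<in> ap ` stab {..<n} f" using g(2) by blast
  qed
qed

text \<open>The passage from finitely supported functions on \<open>fperm\<close> to the coefficient
  functions in which Specht modules are stated. The value 0 off \<open>sym_group n\<close> agrees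
  with \<open>young_symmetrizer\<close>, whose defining sum is empty there.\<close>

definition coeff_fun :: "nat \<Rightarrow> 'f::field_char_0 galgebra \<Rightarrow> (nat \<Rightarrow> nat) \<Rightarrow> 'f" where
  "coeff_fun n a = (\<lambda>\<tau>. if \<tau> \<in> sym_group n then coef a (FPerm \<tau>) else 0)"

lemma coeff_fun_ap: "g \<in> perms_on {..<n} \<Longrightarrow> coeff_fun n a (ap g) = coef a g"
  by (simp add: coeff_fun_def ap_inverse) (auto simp: perms_on_def sym_group_def)

lemma coeff_fun_outside: "\<tau> \<notin> sym_group n \<Longrightarrow> coeff_fun n a \<tau> = 0"
  by (simp add: coeff_fun_def)

lemma coeff_fun_eqI:
  assumes "\<And>g. g \<in> perms_on {..<n} \<Longrightarrow> s (ap g) = coef a g"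
    and "\<And>\<tau>. \<tau> \<notin> sym_group n \<Longrightarrow> s \<tau> = 0"
  shows "s = coeff_fun n a"
proof
  fix \<tau> show "s \<tau> = coeff_fun n a \<tau>"
  proof (cases "\<tau> \<in> sym_group n")
    case True
    then obtain g where "g \<in> perms_on {..<n}" "\<tau> = ap g" by (rule sym_group_ap)
    then show ?thesis using assms(1)[of g] coeff_fun_ap[of g n a] by simp
  qed (simp add: assms(2) coeff_fun_outside)
qed

lemma coeff_fun_add: "coeff_fun n (a + b) = coeff_fun n a + coeff_fun n b"
  by (auto simp: coeff_fun_def lookup_add plus_fun_apply)

lemma coeff_fun_0 [simp]: "coeff_fun n 0 = 0"
  by (auto simp: coeff_fun_def zero_fun_apply)

lemma coeff_fun_const: "coeff_fun n (const c * a) = fscale c (coeff_fun n a)"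
  by (auto simp: coeff_fun_def fscale_def lookup_const_mult)

lemma lookup_mult_gp: "coef (a * gp g) k = coef a (k + - g)"
proof (rule galg_induct[of a UNIV])
  fix c h
  have "h + g = k \<longleftrightarrow> h = k + - g" by (metis add.assoc add.right_inverse add.left_inverse add.right_neutral)
  then show "coef (const c * gp h * gp g) k = coef (const c * gp h) (k + - g)"
    by (simp add: mult_single lookup_single when_def)
qed (simp_all add: distrib_right lookup_add)

lemma group_alg_act_coeff_fun:
  assumes g: "g \<in> perms_on {..<n}"
  shows "group_alg_act (ap g) (coeff_fun n a) = coeff_fun n (a * gp g)"
proof (rule coeff_fun_eqI)
  fix h assume h: "h \<in> perms_on {..<n}"
  have "group_alg_act (ap g) (coeff_fun n a) (ap h) = coeff_fun n a (ap (h + - g))"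
    by (simp add: group_alg_act_def ap_plus ap_uminus)
  then show "group_alg_act (ap g) (coeff_fun n a) (ap h) = coef (a * gp g) h"
    using h g by (simp add: coeff_fun_ap perms_on_plus perms_on_uminus lookup_mult_gp)
next
  fix \<tau> assume \<tau>: "\<tau> \<notin> sym_group n"
  have "\<tau> \<circ> inv (ap g) \<notin> sym_group n"
  proof
    assume "\<tau> \<circ> inv (ap g) \<in> sym_group n"
    moreover have "ap g permutes {..<n}" using g by (simp add: perms_on_def)
    ultimately have "(\<tau> \<circ> inv (ap g)) \<circ> ap g \<in> sym_group n"
      unfolding sym_group_def using permutes_compose by blast
    moreover have "(\<tau> \<circ> inv (ap g)) \<circ> ap g = \<tau>"
      by (simp add: comp_assoc inv_o_cancel bij_ap bij_is_inj)
    ultimately show False using \<tau> by simp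
  qed
  then show "group_alg_act (ap g) (coeff_fun n a) \<tau> = 0"
    by (simp add: group_alg_act_def coeff_fun_outside)
qed

lemma young_symmetrizer_eq:
  assumes "\<nu> \<in> partitions"
  obtains r c where "is_tableau \<nu> {..<psize \<nu>} r c"
    "young_symmetrizer \<nu> = coeff_fun (psize \<nu>) (yelem {..<psize \<nu>} r c :: 'f::field_char_0 galgebra)"
proof -
  let ?n = "psize \<nu>" and ?X = "{..<psize \<nu>}"
  obtain r c where T: "is_tableau \<nu> ?X r c" and t: "\<And>x. x < ?n \<Longrightarrow> tableau \<nu> (r x) (c x) = x"
    by (rule standard_tableau[OF assms]) blast
  have t': "tableau \<nu> i j < ?n \<and> r (tableau \<nu> i j) = i \<and> c (tableau \<nu> i j) = j" if "j < \<nu> i" for i j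
  proof -
    obtain x where "x \<in> ?X" "r x = i" "c x = j" using tableau_ex[OF T \<open>j < \<nu> i\<close>] by blast
    then show ?thesis using t[of x] by auto
  qed
  have rows: "{tableau \<nu> i j | j. j < \<nu> i} = {x\<in>?X. r x = i}" for i
    using t t' tableau_in[OF T] by (auto; metis lessThan_iff)
  have cols: "{tableau \<nu> i j | i. j < \<nu> i} = {x\<in>?X. c x = j}" for j
    using t t' tableau_in[OF T] by (auto; metis lessThan_iff)
  have R: "row_group \<nu> = ap ` stab ?X r"
    unfolding row_group_def rows by (simp add: ap_image_stab)
  have C: "column_group \<nu> = ap ` stab ?X c"
    unfolding column_group_def cols by (simp add: ap_image_stab)
  have "young_symmetrizer \<nu> = coeff_fun ?n (yelem ?X r c :: 'f galgebra)"
  proof (rule coeff_fun_eqI)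
    fix k assume k: "k \<in> perms_on ?X"
    have "{(p, q). p \<in> row_group \<nu> \<and> q \<in> column_group \<nu> \<and> p \<circ> q = ap k} =
        map_prod ap ap ` {(p, q). p \<in> stab ?X r \<and> q \<in> stab ?X c \<and> p + q = k}"
      unfolding R C by (auto simp: ap_plus[symmetric] ap_inject image_iff)
    moreover have "inj_on (map_prod ap ap) A" for A
      by (auto simp: inj_on_def ap_inject)
    ultimately have "young_symmetrizer \<nu> (ap k) =
        (\<Sum>(p, q) | p \<in> stab ?X r \<and> q \<in> stab ?X c \<and> p + q = k. psgn q :: 'f)"
      unfolding young_symmetrizer_def by (simp add: sum.reindex case_prod_unfold psgn_def)
    also have "\<dots> = (\<Sum>(p, q)\<in>stab ?X r \<times> stab ?X c. if p + q = k then psgn q else 0)"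
      by (rule sum.mono_neutral_cong_left) (auto split: if_splits)
    also have "\<dots> = coef (yelem ?X r c) k"
      by (simp add: lookup_yelem sum.cartesian_product)
    finally show "young_symmetrizer \<nu> (ap k) = coef (yelem ?X r c :: 'f galgebra) k" .
  next
    fix \<tau> assume "\<tau> \<notin> sym_group ?n"
    then have "{(p, q). p \<in> row_group \<nu> \<and> q \<in> column_group \<nu> \<and> p \<circ> q = \<tau>} = {}"
      by (auto simp: row_group_def column_group_def sym_group_def permutes_compose)
    then show "young_symmetrizer \<nu> \<tau> = (0::'f)" unfolding young_symmetrizer_def by (simp only: sum.empty)
  qed
  then show ?thesis by (rule that[OF T])
qed

lemma subspace_galg_image:
  fixes h :: "'f::field_char_0 galgebra \<Rightarrow> 'x \<Rightarrow> 'f"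
  assumes add: "\<And>a b. h (a + b) = h a + h b" and const: "\<And>c a. h (const c * a) = fscale c (h a)"
  shows "fun_vs.subspace (h ` galg X)"
  unfolding fun_vs.subspace_def
proof (intro conjI ballI allI)
  have "h 0 = 0" using add[of 0 0] by simp
  then show "0 \<in> h ` galg X" by (metis galg_0 imageI)
next
  fix s t assume "s \<in> h ` galg X" "t \<in> h ` galg X"
  then obtain a b where "a \<in> galg X" "b \<in> galg X" "s = h a" "t = h b" by blast
  then show "s + t \<in> h ` galg X" using add[of a b] galg_add[of a X b] by force
next
  fix c s assume "s \<in> h ` galg X"
  then obtain a where "a \<in> galg X" "s = h a" by blast
  then show "fscale c s \<in> h ` galg X"
    using const[of c a] galg_mult[of "const c" X a] galg_single[OF perms_on_0] by force
qed

lemma specht_eq: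
  assumes "young_symmetrizer \<nu> = coeff_fun n e" "psize \<nu> = n"
  shows "specht \<nu> = (\<lambda>y. coeff_fun n (e * y)) ` (galg {..<n} :: 'f::field_char_0 galgebra set)"
proof
  have gens: "(\<lambda>\<sigma>. group_alg_act \<sigma> (young_symmetrizer \<nu>)) ` sym_group (psize \<nu>) =
      (\<lambda>g. coeff_fun n (e * gp g)) ` perms_on {..<n}"
    unfolding assms ap_image_perms_on[symmetric] image_image
    by (rule image_cong) (auto simp: group_alg_act_coeff_fun)
  show "specht \<nu> \<subseteq> (\<lambda>y. coeff_fun n (e * y)) ` galg {..<n}"
    unfolding specht_def gens
  proof (rule fun_vs.span_minimal)
    show "(\<lambda>g. coeff_fun n (e * gp g)) ` perms_on {..<n} \<subseteq> (\<lambda>y. coeff_fun n (e * y)) ` galg {..<n}"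
      by auto
    show "fun_vs.subspace ((\<lambda>y. coeff_fun n (e * y)) ` galg {..<n})"
      by (rule subspace_galg_image)
         (simp_all only: distrib_left coeff_fun_add const_left_commute[of e] coeff_fun_const)
  qed
  have "coeff_fun n (e * y) \<in> specht \<nu>" if "y \<in> galg {..<n}" for y
    using that unfolding specht_def gens
  proof (induction rule: galg_induct)
    case (add a b)
    then show ?case by (simp add: distrib_left coeff_fun_add fun_vs.span_add)
  next
    case (gp d g)
    then show ?case
      by (auto simp: const_left_commute[of e] coeff_fun_const intro: fun_vs.span_scale fun_vs.span_base)
  qed
  then show "(\<lambda>y. coeff_fun n (e * y)) ` galg {..<n} \<subseteq> specht \<nu>" by blast
qed

section \<open>Isotypic components as images of Young elements\<close>

context homogeneous_basis
begin

text \<open>An isomorphism from the Specht module is determined by the image \<open>t\<close> of the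
  generator \<open>e\<close>. Since \<open>e * e = const d * e\<close>, this image is a scalar
  multiple of \<open>act n t e\<close>, so every element of \<open>M\<close> arises from the action
  of some \<open>e * y\<close>.\<close>

lemma affords_act:
  assumes e: "young_symmetrizer \<nu> = coeff_fun n e" "psize \<nu> = n" "e \<in> galg (pos n)"
    and M: "submodule n M" "affords M \<nu>" and sq: "d \<noteq> 0" "e * e = const d * e"
    and m: "m \<in> M"
  obtains t y where "t \<in> tensor_power n" "y \<in> galg (pos n)" "m = act n t (e * y)"
proof -
  note specht = specht_eq[OF e(1,2)]
  obtain f where bij: "bij_betw f (specht \<nu>) M"
    and f_add: "\<And>a b. a \<in> specht \<nu> \<Longrightarrow> b \<in> specht \<nu> \<Longrightarrow> f (a + b) = f a + f b"
    and f_scale: "\<And>c a. a \<in> specht \<nu> \<Longrightarrow> f (fscale c a) = fscale c (f a)"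
    and f_act: "\<And>\<sigma> a. \<sigma> \<in> sym_group n \<Longrightarrow> a \<in> specht \<nu> \<Longrightarrow>
      f (group_alg_act \<sigma> a) = place_act n \<sigma> (f a)"
    using M(2) e(2) unfolding affords_def by blast
  have in_specht: "coeff_fun n (e * y) \<in> specht \<nu>" if "y \<in> galg (pos n)" for y
    using that specht by blast
  define t where "t = f (coeff_fun n e)"
  have in_e: "coeff_fun n e \<in> specht \<nu>" using in_specht[of 1] by simp
  have "t \<in> M" unfolding t_def using bij in_e by (auto simp: bij_betw_def)
  then have t: "t \<in> tensor_power n" using M(1) by (auto simp: submodule_def)
  have f_eq: "f (coeff_fun n (e * y)) = act n t y" if "y \<in> galg (pos n)" for y
    using that
  proof (induction rule: galg_induct)
    case (add a b)
    then show ?case using f_add[OF in_specht in_specht] by (simp add: distrib_left coeff_fun_add act_add_right)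
  next
    case (gp c g)
    have \<sigma>: "ap g \<in> sym_group n" using gp by (auto simp: sym_group_def perms_on_def)
    have "coeff_fun n (e * (const c * gp g)) = fscale c (coeff_fun n (e * gp g))"
      by (simp only: const_left_commute[of e] coeff_fun_const)
    then have "f (coeff_fun n (e * (const c * gp g))) = fscale c (f (coeff_fun n (e * gp g)))"
      using f_scale[OF in_specht[of "gp g"]] gp by simp
    also have "f (coeff_fun n (e * gp g)) = place_act n (ap g) t"
      unfolding t_def f_act[OF \<sigma> in_e, symmetric] group_alg_act_coeff_fun[OF gp] ..
    finally show ?case using gp by (simp add: act_const act_gp)
  qed
  have "m \<in> f ` specht \<nu>" using m bij_betw_imp_surj_on[OF bij] by simp
  then obtain y where y: "y \<in> galg (pos n)" "m = f (coeff_fun n (e * y))"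
    unfolding specht by blast
  have "act n t e = f (coeff_fun n (const d * e))" using f_eq[OF e(3)] sq(2) by simp
  also have "\<dots> = fscale d t" unfolding coeff_fun_const t_def by (rule f_scale[OF in_e])
  finally have t_eq: "fscale (inverse d) (act n t e) = t" using sq(1) by simp
  have "m = act n (fscale (inverse d) (act n t e)) y" using y f_eq[OF y(1)] by (simp add: t_eq)
  also have "\<dots> = act n (fscale (inverse d) t) (e * y)"
    by (simp add: act_scale_left act_mult[OF t e(3) y(1)])
  finally show ?thesis
    using that[OF fun_vs.subspace_scale[OF tensor_power_subspace t] y(1)] by blast
qed

text \<open>Surjectivity is built into \<open>M\<close>. If two elements of the right ideal of
  \<open>e\<close> had the same image, irreducibility would carry their difference to a nonzero
  multiple of \<open>e\<close>, and \<open>act n t e\<close> would be 0.\<close>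

lemma act_affords:
  assumes \<nu>: "young_symmetrizer \<nu> = coeff_fun n e" "psize \<nu> = n" and e: "e = yelem (pos n) r c"
    and T: "is_tableau \<nu> (pos n) r c" and t: "t \<in> tensor_power n" and ne: "act n t e \<noteq> 0"
  defines "M \<equiv> (\<lambda>y. act n t (e * y)) ` galg (pos n)"
  shows "submodule n M" "affords M \<nu>"
proof -
  have eg: "e \<in> galg (pos n)" unfolding e by simp
  have sub: "M \<subseteq> tensor_power n" unfolding M_def using act_closed[OF t] by blast
  have "fun_vs.subspace M"
    unfolding M_def
    by (rule subspace_galg_image) (simp_all only: distrib_left act_add_right const_left_commute[of e] act_const)
  moreover have place: "place_act n (ap g) (act n t (e * y)) = act n t (e * (y * gp g))"
    if "y \<in> galg (pos n)" "g \<in> perms_on (pos n)" for y g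
    using act_mult[OF t galg_mult[OF eg that(1)], of "gp g"] that(2) by (simp add: act_gp mult.assoc)
  moreover have "place_act n \<sigma> s \<in> M" if \<sigma>: "\<sigma> \<in> sym_group n" and s: "s \<in> M" for \<sigma> s
  proof -
    obtain g where g: "g \<in> perms_on (pos n)" "\<sigma> = ap g" using \<sigma> by (rule sym_group_ap)
    obtain y where y: "y \<in> galg (pos n)" "s = act n t (e * y)" using s M_def by blast
    show ?thesis unfolding g y(2) place[OF y(1) g(1)] M_def using y(1) g(1) by (simp add: galg_mult)
  qed
  ultimately show "submodule n M" using sub by (simp add: submodule_def)
  note specht = specht_eq[OF \<nu>]
  have inj: "y = y'" if yy: "y \<in> (\<lambda>y. e * y) ` galg (pos n)" "y' \<in> (\<lambda>y. e * y) ` galg (pos n)"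
    "act n t y = act n t y'" for y y'
  proof (rule ccontr)
    assume "y \<noteq> y'"
    obtain u u' where u: "u \<in> galg (pos n)" "u' \<in> galg (pos n)" "y = e * u" "y' = e * u'" using yy(1,2) by blast
    let ?u = "u + - u'"
    have ug: "?u \<in> galg (pos n)" using u by (simp add: galg_add galg_uminus)
    have eu: "e * ?u = y + - y'" using u by (simp add: distrib_left)
    then have "e * ?u \<noteq> 0" using \<open>y \<noteq> y'\<close> by (simp add: add_uminus_conv_diff)
    then obtain z d where z: "z \<in> galg (pos n)" "d \<noteq> 0" "e * ?u * z * e = const d * e"
      unfolding e by (rule yelem_irreducible[OF T ug])
    have "act n t (e * ?u) = 0" unfolding eu act_add_right act_uminus_right using yy(3) by simp
    then have "act n t ((e * ?u) * (z * e)) = 0"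
      using act_mult[OF t galg_mult[OF eg ug] galg_mult[OF z(1) eg]] by simp
    moreover have "act n t ((e * ?u) * (z * e)) = fscale d (act n t e)"
      using z(3) by (simp only: mult.assoc act_const)
    ultimately have "fscale d (act n t e) = 0" by simp
    then show False using ne z(2) by simp
  qed
  \<comment> \<open>Reads a coefficient function back into the group algebra and lets the result act
    on \<open>t\<close>.\<close>
  define f where "f s = act n t (\<Sum>g\<in>perms_on (pos n). Poly_Mapping.single g (s (ap g)))"
    for s :: "(nat \<Rightarrow> nat) \<Rightarrow> 'f"
  have f_coeff: "f (coeff_fun n a) = act n t a" if "a \<in> galg (pos n)" for a
  proof -
    have "a = (\<Sum>g\<in>perms_on (pos n). Poly_Mapping.single g (coef a g))"
    proof (rule poly_mapping_eqI)
      fix k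
      show "coef a k =
          coef (\<Sum>g\<in>perms_on (pos n). Poly_Mapping.single g (coef a g)) k"
        using that by (auto simp: lookup_sum lookup_single when_def finite_perms_on galg_def in_keys_iff)
    qed
    then show ?thesis by (simp add: f_def coeff_fun_ap)
  qed
  have f_specht: "f (coeff_fun n (e * y)) = act n t (e * y)" if "y \<in> galg (pos n)" for y
    by (rule f_coeff) (simp add: galg_mult eg that)
  show "affords M \<nu>"
    unfolding affords_def \<nu>(2)
  proof (intro exI[of _ f] conjI ballI allI)
    show "bij_betw f (specht \<nu>) M"
      unfolding bij_betw_def
    proof
      show "f ` specht \<nu> = M" unfolding specht M_def image_image by (rule image_cong) (auto simp: f_specht)
      show "inj_on f (specht \<nu>)"
      proof (rule inj_onI)
        fix s s' :: "(nat \<Rightarrow> nat) \<Rightarrow> 'f" assume s: "s \<in> specht \<nu>" "s' \<in> specht \<nu>" "f s = f s'"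
        obtain y y' where y: "y \<in> galg (pos n)" "y' \<in> galg (pos n)"
          "s = coeff_fun n (e * y)" "s' = coeff_fun n (e * y')" using s(1,2) specht by blast
        have "e * y = e * y'" using inj[of "e * y" "e * y'"] s(3) y f_specht by simp
        then show "s = s'" using y by simp
      qed
    qed
  next
    fix s s' :: "(nat \<Rightarrow> nat) \<Rightarrow> 'f" assume s: "s \<in> specht \<nu>" "s' \<in> specht \<nu>"
    obtain y y' where y: "y \<in> galg (pos n)" "y' \<in> galg (pos n)"
      "s = coeff_fun n (e * y)" "s' = coeff_fun n (e * y')" using s(1,2) specht by blast
    then have "s + s' = coeff_fun n (e * (y + y'))" by (simp add: distrib_left coeff_fun_add)
    then show "f (s + s') = f s + f s'"
      using y by (simp add: f_specht galg_add) (simp add: distrib_left act_add_right)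
  next
    fix d and s :: "(nat \<Rightarrow> nat) \<Rightarrow> 'f" assume s: "s \<in> specht \<nu>"
    obtain y where y: "y \<in> galg (pos n)" "s = coeff_fun n (e * y)" using s specht by blast
    then have "fscale d s = coeff_fun n (e * (const d * y))"
      by (simp only: const_left_commute[of e] coeff_fun_const)
    then have "f (fscale d s) = act n t (e * (const d * y))" using y by (simp add: f_specht galg_mult)
    then show "f (fscale d s) = fscale d (f s)"
      using y by (simp add: f_specht const_left_commute[of e] act_const)
  next
    fix \<sigma> and s :: "(nat \<Rightarrow> nat) \<Rightarrow> 'f" assume \<sigma>: "\<sigma> \<in> sym_group n" and s: "s \<in> specht \<nu>"
    obtain g where g: "g \<in> perms_on (pos n)" "\<sigma> = ap g" using \<sigma> by (rule sym_group_ap)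
    obtain y where y: "y \<in> galg (pos n)" "s = coeff_fun n (e * y)" using s specht by blast
    have "f (group_alg_act \<sigma> s) = act n t (e * (y * gp g))"
      unfolding g(2) y(2) group_alg_act_coeff_fun[OF g(1)] mult.assoc
      using y(1) g(1) by (simp add: f_specht galg_mult)
    then show "f (group_alg_act \<sigma> s) = place_act n \<sigma> (f s)"
      unfolding g(2) y(2) f_specht[OF y(1)] place[OF y(1) g(1)] .
  qed
qed

text \<open>Any tableau of shape \<open>\<nu>\<close> serves, since the Young elements of one shape
  are conjugate. If \<open>e\<close> sends a tensor to 0, so does every \<open>e * y\<close>;
  otherwise the images form a submodule that affords \<open>\<nu>\<close>.\<close>

lemma isotypic_eq:
  assumes T: "is_tableau \<nu> (pos n) r c"
  shows "isotypic \<nu> = fun_vs.span {act n t (yelem (pos n) r c * y) | t y. t \<in> tensor_power n \<and> y \<in> galg (pos n)}"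
proof -
  have \<nu>: "\<nu> \<in> partitions" "psize \<nu> = n" using tableau_partition[OF T] by auto
  obtain r' c' where T': "is_tableau \<nu> (pos n) r' c'"
    and ys: "young_symmetrizer \<nu> = coeff_fun n (yelem (pos n) r' c' :: 'f galgebra)"
    by (rule young_symmetrizer_eq[OF \<nu>(1), where 'f = 'f, unfolded \<nu>(2)])
  let ?e = "yelem (pos n) r c :: 'f galgebra" and ?e' = "yelem (pos n) r' c' :: 'f galgebra"
  obtain d where d: "d \<noteq> 0" "?e' * ?e' = const d * ?e'" by (rule yelem_square[OF T'])
  obtain g where g: "g \<in> perms_on (pos n)" "?e' = gp (- g) * ?e * gp g" by (rule tableau_conj[OF T T'])
  obtain h where h: "h \<in> perms_on (pos n)" "?e = gp (- h) * ?e' * gp h" by (rule tableau_conj[OF T' T])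
  show ?thesis
  proof
    show "isotypic \<nu> \<subseteq> fun_vs.span {act n t (?e * y) | t y. t \<in> tensor_power n \<and> y \<in> galg (pos n)}"
      unfolding isotypic_def \<nu>(2)
    proof (rule fun_vs.span_mono, rule subsetI)
      fix m assume "m \<in> \<Union> {M. submodule n M \<and> affords M \<nu>}"
      then obtain M where M: "submodule n M" "affords M \<nu>" "m \<in> M" by blast
      obtain t y where ty: "t \<in> tensor_power n" "y \<in> galg (pos n)" "m = act n t (?e' * y)"
        by (rule affords_act[OF ys \<nu>(2) yelem_galg M(1,2) d M(3)])
      have "m = act n t (gp (- g) * (?e * (gp g * y)))" unfolding ty(3) g(2) by (simp only: mult.assoc)
      also have "\<dots> = act n (act n t (gp (- g))) (?e * (gp g * y))"
        using ty g(1) by (intro act_mult galg_mult) (auto simp: perms_on_uminus)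
      finally show "m \<in> {act n t (?e * y) | t y. t \<in> tensor_power n \<and> y \<in> galg (pos n)}"
        using act_closed[OF ty(1)] ty(2) g(1) galg_mult galg_single by blast
    qed
    have "act n t (?e * y) \<in> isotypic \<nu>" if ty: "t \<in> tensor_power n" "y \<in> galg (pos n)" for t y
    proof -
      define t' where "t' = act n t (gp (- h))"
      have t': "t' \<in> tensor_power n" unfolding t'_def by (rule act_closed[OF ty(1)])
      have hy: "gp h * y \<in> galg (pos n)" using h(1) ty by (simp add: galg_mult)
      have "act n t (?e * y) = act n t (gp (- h) * (?e' * (gp h * y)))"
        unfolding h(2) by (simp only: mult.assoc)
      also have "\<dots> = act n t' (?e' * (gp h * y))"
        unfolding t'_def using ty h(1) by (intro act_mult galg_mult) (auto simp: perms_on_uminus)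
      finally have eq: "act n t (?e * y) = act n t' (?e' * (gp h * y))" .
      show ?thesis
      proof (cases "act n t' ?e' = 0")
        case True
        then have "act n t (?e * y) = 0" unfolding eq using act_mult[OF t' yelem_galg hy] by simp
        then show ?thesis unfolding isotypic_def by (simp add: fun_vs.span_zero)
      next
        case False
        have "act n t' (?e' * (gp h * y)) \<in> (\<lambda>y. act n t' (?e' * y)) ` galg (pos n)" using hy by blast
        then show ?thesis
          unfolding eq isotypic_def \<nu>(2) using act_affords[OF ys \<nu>(2) refl T' t' False]
          by (intro fun_vs.span_base) blast
      qed
    qed
    then show "fun_vs.span {act n t (?e * y) | t y. t \<in> tensor_power n \<and> y \<in> galg (pos n)} \<subseteq> isotypic \<nu>"
      unfolding isotypic_def by (intro fun_vs.span_minimal fun_vs.subspace_span) auto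
  qed
qed

lemma act_in_isotypic:
  assumes "is_tableau \<nu> (pos n) r c" "t \<in> tensor_power n" "y \<in> galg (pos n)"
  shows "act n t (yelem (pos n) r c * y) \<in> isotypic \<nu>"
  unfolding isotypic_eq[OF assms(1)] using assms(2,3) by (intro fun_vs.span_base) blast

text \<open>Let the expression of the unit as an element of the Young ideal act on \<open>t\<close>:
  each summand \<open>a * s * b\<close> lands in an isotypic component.\<close>

lemma tensor_power_decomposition:
  "tensor_power n \<subseteq> fun_vs.span (\<Union>\<nu>\<in>{\<nu>\<in>partitions. psize \<nu> = n}. isotypic \<nu>)" (is "_ \<subseteq> ?S")
proof
  fix t assume t: "t \<in> tensor_power n"
  have "act n t u \<in> ?S" if "u \<in> young_ideal (pos n)" for u
    using that unfolding young_ideal_def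
  proof (induction rule: gideal.induct)
    case gideal_0
    show ?case by (simp add: fun_vs.span_zero)
  next
    case (gideal_step u s a b)
    obtain \<nu> r c where T: "is_tableau \<nu> (pos n) r c" and s: "s = yelem (pos n) r c" using gideal_step by blast
    have "act n t (a * s * b) = act n (act n t a) (s * b)"
      using act_mult[OF t gideal_step(3), of "s * b"] gideal_step(4) s by (simp add: mult.assoc galg_mult)
    also have "\<dots> \<in> isotypic \<nu>"
      unfolding s by (rule act_in_isotypic[OF T act_closed[OF t] gideal_step(4)])
    finally have "act n t (a * s * b) \<in> ?S"
      using tableau_partition[OF T] by (intro fun_vs.span_base) auto
    then show ?case using gideal_step unfolding act_add_right by (intro fun_vs.span_add) auto
  qed
  from this[OF one_in_young_ideal] show "t \<in> ?S" by (simp add: act_1[OF t])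
qed

section \<open>The lower bound\<close>

lemma isotypic_subset: "isotypic \<nu> \<subseteq> tensor_power (psize \<nu>)"
  unfolding isotypic_def
  by (rule fun_vs.span_minimal[OF _ tensor_power_subspace]) (auto simp: submodule_def)

text \<open>The projection of the tensor algebra onto degree \<open>n\<close>. All degrees live in
  one function space, and they are separated by testing on forms that vanish off lists of length
  \<open>n\<close>.\<close>

definition truncate :: "nat \<Rightarrow> (('v list \<Rightarrow> 'f) \<Rightarrow> 'f) \<Rightarrow> ('v list \<Rightarrow> 'f) \<Rightarrow> 'f" where
  "truncate n t = (\<lambda>\<phi>. if multilinear \<phi> then t (\<lambda>xs. if length xs = n then \<phi> xs else 0) else 0)"

lemma multilinear_truncate:
  assumes "multilinear \<phi>" shows "multilinear (\<lambda>xs. if length xs = n then \<phi> xs else 0)"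
  unfolding multilinear_def linear_form_iff
  using multilinear_add[OF assms] multilinear_scale[OF assms] by simp

lemma truncate_add: "truncate n (s + t) = truncate n s + truncate n t"
  and truncate_scale: "truncate n (fscale c t) = fscale c (truncate n t)"
  and truncate_0 [simp]: "truncate n 0 = 0"
  by (auto simp: truncate_def fscale_def fun_eq_iff plus_fun_apply zero_fun_apply)

lemma truncate_tensor_power:
  assumes "t \<in> tensor_power m" shows "truncate n t = (if m = n then t else 0)"
  using assms
proof (induction rule: tensor_power_induct)
  case (step c w t)
  have "truncate n (tensor w) = (if m = n then tensor w else 0)"
    using step(1) by (auto simp: truncate_def tensor_def fun_eq_iff words_def multilinear_truncate zero_fun_apply)
  then show ?case using step(3) by (simp add: truncate_add truncate_scale)
qed simp

text \<open>Projection to degree \<open>n\<close> keeps exactly the generators that belong to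
  partitions of \<open>n\<close>, and a tensor of degree \<open>n\<close> is its own
  projection.\<close>

lemma filter_ideal_inter:
  assumes "t \<in> filter_ideal \<Omega>" "t \<in> tensor_power n"
  shows "t \<in> fun_vs.span (\<Union>\<nu>\<in>{\<nu>\<in>\<Omega>. psize \<nu> = n}. isotypic \<nu>)" (is "_ \<in> ?S")
proof -
  have "truncate n t \<in> ?S"
    using assms(1) unfolding filter_ideal_def
  proof (induction rule: fun_vs.span_induct_alt)
    case base
    show ?case by (simp add: fun_vs.span_zero)
  next
    case (step c x y)
    then obtain \<nu> where \<nu>: "\<nu> \<in> \<Omega>" "x \<in> isotypic \<nu>" by blast
    then have "truncate n x = (if psize \<nu> = n then x else 0)"
      using isotypic_subset by (intro truncate_tensor_power) auto
    then have "truncate n x \<in> ?S" using \<nu> by (auto intro: fun_vs.span_base fun_vs.span_zero)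
    then show ?case
      unfolding truncate_add truncate_scale using step by (intro fun_vs.span_add fun_vs.span_scale) auto
  qed
  then show ?thesis using truncate_tensor_power[OF assms(2), of n] by simp
qed

lemma vec_two_cancel:
  fixes v :: "('v list \<Rightarrow> 'f) \<Rightarrow> 'f"
  assumes "v = - v" shows "v = 0"
proof
  fix \<phi>
  have "v \<phi> = - v \<phi>" using fun_cong[OF assms, of \<phi>] by simp
  then show "v \<phi> = 0 \<phi>" by (simp add: zero_fun_apply eq_neg_iff_add_eq_0 flip: mult_2)
qed

text \<open>
  In a word with at most \<open>a\<close> even and \<open>b\<close> odd letters, the rectangle relation moves the
  \<open>i\<close>-th even letter into row \<open>i\<close>. Row \<open>a\<close> then has \<open>b + 1\<close> odd letters, one of which is repeated.
\<close>

lemma rectangle_kills_word: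
  assumes A: "A0 \<subseteq> B0" "A1 \<subseteq> B1" "card A0 \<le> a" "card A1 \<le> b"
    and X: "X \<subseteq> pos n" "bij_betw (\<lambda>x. (r x, c x)) X ({..a} \<times> {..b})"
    and w: "w \<in> words n" "set w \<subseteq> A0 \<union> A1"
  shows "act n (tensor w) (yelem X r c) = 0"
proof -
  have finX: "finite X" using X(1) finite_subset by blast
  have finA: "finite A0" "finite A1" using A fin finite_subset by auto
  obtain idx where idx: "bij_betw idx A0 {0..<card A0}" using ex_bij_betw_finite_nat[OF finA(1)] by blast
  have idx_lt: "idx u < a" if "u \<in> A0" for u using bij_betwE[OF idx] that A(3) by fastforce
  have idx_inj: "u = v" if "u \<in> A0" "v \<in> A0" "idx u = idx v" for u v
    using idx that by (auto simp: bij_betw_def inj_on_def)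
  \<comment> \<open>The positions of even letters already in the row prescribed by their index; the
    number of remaining positions is the induction measure.\<close>
  define good where "good w = {x\<in>X. w ! x \<in> A0 \<and> idx (w ! x) = r x}" for w
  have yg: "yelem X r c \<in> galg (pos n)" using yelem_galg galg_mono[OF X(1)] by blast
  have sg: "gp (swp x y) \<in> galg (pos n)" if "x \<in> X" "y \<in> X" for x y
    by (rule galg_single, rule perms_on_swp) (use that X(1) in auto)
  show ?thesis
    using w
  proof (induction "card X - card (good w)" arbitrary: w rule: less_induct)
    case less
    note w = less.prems
    have len: "length w = n" using w by (simp add: words_def)
    have tw: "tensor w \<in> tensor_power n" by (rule tensor_in_power[OF w(1)])
    have letter: "w ! x \<in> A0 \<union> A1" if "x \<in> X" for x using that w(2) len X(1) by (auto simp: subset_iff)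
    let ?v = "act n (tensor w) (yelem X r c)"
    show ?case
    proof (cases "\<exists>x\<in>X. w ! x \<in> A0 \<and> idx (w ! x) \<noteq> r x")
      case True
      then obtain x where x: "x \<in> X" "w ! x \<in> A0" "idx (w ! x) \<noteq> r x" by blast
      define i where "i = idx (w ! x)"
      let ?Y = "{y\<in>X. r y = i}"
      have "i < a" unfolding i_def by (rule idx_lt[OF x(2)])
      then have rel: "(1 + (\<Sum>y\<in>?Y. gp (swp x y))) * (yelem X r c :: 'f galgebra) = 0"
        using x by (intro rectangle_relation[OF finX X(2)]) (auto simp: i_def)
      have "0 = act n (tensor w) ((1 + (\<Sum>y\<in>?Y. gp (swp x y))) * yelem X r c)" unfolding rel by simp
      also have "\<dots> = ?v + (\<Sum>y\<in>?Y. act n (tensor w) (gp (swp x y) * yelem X r c))"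
        by (simp only: distrib_right sum_distrib_right act_add_right act_sum_right mult_1)
      also have "(\<Sum>y\<in>?Y. act n (tensor w) (gp (swp x y) * yelem X r c)) =
          (\<Sum>y\<in>?Y. if w ! y = w ! x then ?v else 0)"
      proof (rule sum.cong[OF refl])
        fix y assume y: "y \<in> ?Y"
        then have yX: "y \<in> X" by simp
        have xy: "x < n" "y < n" "x \<noteq> y" using x y X(1) by (auto simp: i_def)
        have "act n (tensor w) (gp (swp x y) * yelem X r c) =
            act n (act n (tensor w) (gp (swp x y))) (yelem X r c)"
          by (rule act_mult[OF tw sg[OF x(1) yX] yg])
        also have "\<dots> = (if w ! y = w ! x then ?v else 0)"
        \<comment> \<open>Equal letters are even here, so their exchange acts as 1 and returns
          \<open>?v\<close>. A different letter makes \<open>y\<close> good and spoils no good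
          position, since neither \<open>x\<close> nor \<open>y\<close> was good before, so
          induction gives 0.\<close>
        proof (cases "w ! y = w ! x")
          case True
          have "w ! x \<notin> B1" using x A disj by blast
          then show ?thesis using True act_word_swp[OF w(1) xy] by simp
        next
          case False
          let ?g = "swp x y"
          have g: "?g \<in> perms_on (pos n)" using xy by (simp add: perms_on_swp)
          have px: "permute ?g w ! x = w ! y" "permute ?g w ! y = w ! x"
            using xy by (auto simp: len ap_swp)
          have pz: "permute ?g w ! z = w ! z" if "z < n" "z \<noteq> x" "z \<noteq> y" for z
            using that by (simp add: len ap_swp transpose_def)
          have "y \<notin> good w" using False y x idx_inj[of "w ! y" "w ! x"] by (auto simp: good_def i_def)
          moreover have "insert y (good w) \<subseteq> good (permute ?g w)"
          proof
            fix z assume z: "z \<in> insert y (good w)"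
            show "z \<in> good (permute ?g w)"
            proof (cases "z = y")
              case True
              then show ?thesis using px y x by (simp add: good_def i_def)
            next
              case False
              then have "z \<in> good w" "z \<noteq> x" using z x by (auto simp: good_def)
              then show ?thesis using False pz[of z] X(1) by (auto simp: good_def)
            qed
          qed
          moreover have fing: "finite (good w)" "finite (good (permute ?g w))" using finX by (auto simp: good_def)
          ultimately have "card (good w) < card (good (permute ?g w))"
            by (metis card_insert_disjoint card_mono Suc_le_eq)
          moreover have "card (good (permute ?g w)) \<le> card X"
            using finX by (intro card_mono) (auto simp: good_def)
          moreover have "set (permute ?g w) \<subseteq> A0 \<union> A1"
          proof
            fix u assume "u \<in> set (permute ?g w)"
            then obtain z where "z < n" "u = w ! ap ?g z" by (auto simp: in_set_conv_nth len)
            moreover have "ap ?g z < n" using perms_on_in[OF g, of z] \<open>z < n\<close> by simp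
            ultimately show "u \<in> A0 \<union> A1" using w(2) len by (auto simp: subset_iff)
          qed
          ultimately have "act n (tensor (permute ?g w)) (yelem X r c) = 0"
            using permute_words[OF w(1) g] by (intro less.hyps) auto
          then show ?thesis using False by (simp add: act_word[OF w(1) g] act_scale_left)
        qed
        finally show "act n (tensor w) (gp (swp x y) * yelem X r c) = (if w ! y = w ! x then ?v else 0)" .
      qed
      also have "\<dots> = fscale (of_nat (card {y\<in>?Y. w ! y = w ! x})) ?v"
        using sum.inter_filter[of ?Y "\<lambda>_. ?v" "\<lambda>y. w ! y = w ! x"] finX
        by (simp add: fun_vs.sum_constant_scale del: sum_constant)
      \<comment> \<open>The summand 1 and the partners with an equal letter add up to a positive
        integer multiple of \<open>?v\<close>.\<close>
      finally have "fscale (of_nat (Suc (card {y\<in>?Y. w ! y = w ! x}))) ?v = 0"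
        by (simp add: fun_vs.scale_left_distrib del: of_nat_Suc add: of_nat_Suc)
      moreover have "(of_nat (Suc (card {y\<in>?Y. w ! y = w ! x})) :: 'f) \<noteq> 0" by (rule of_nat_neq_0)
      ultimately show ?thesis using fun_vs.scale_eq_0_iff by blast
    next
      case False
      let ?R = "{x\<in>X. r x = a}"
      have "(\<lambda>x. w ! x) ` ?R \<subseteq> A1"
        using False letter idx_lt by (fastforce simp: image_subset_iff)
      moreover have "card ?R = Suc b"
      proof -
        have "bij_betw c ?R {..b}"
          unfolding bij_betw_def
        proof
          show "inj_on c ?R" using X(2) by (auto simp: bij_betw_def inj_on_def)
          show "c ` ?R = {..b}"
          proof (intro subset_antisym subsetI)
            fix j assume "j \<in> c ` ?R"
            then show "j \<in> {..b}" using bij_betwE[OF X(2)] by auto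
          next
            fix j assume "j \<in> {..b}"
            then have "(a, j) \<in> (\<lambda>x. (r x, c x)) ` X" using X(2) by (simp add: bij_betw_def)
            then show "j \<in> c ` ?R" by auto
          qed
        qed
        then show ?thesis using bij_betw_same_card by fastforce
      qed
      ultimately have "\<not> inj_on (\<lambda>x. w ! x) ?R"
        using card_inj_on_le[of "\<lambda>x. w ! x" ?R A1] finA(2) A(4) by auto
      then obtain x y where xy: "x \<in> ?R" "y \<in> ?R" "w ! x = w ! y" "x \<noteq> y" by (auto simp: inj_on_def)
      then have n: "x < n" "y < n" using X(1) by auto
      have "w ! x \<in> A1" using \<open>(\<lambda>x. w ! x) ` ?R \<subseteq> A1\<close> xy by blast
      then have odd: "w ! x \<in> B1" using A by blast
      have "gp (swp x y) * symz X r = (symz X r :: 'f galgebra)"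
        using xy by (intro gp_sym stab_swp) auto
      then have "gp (swp x y) * yelem X r c = (yelem X r c :: 'f galgebra)"
        by (simp flip: mult.assoc)
      \<comment> \<open>The row symmetrizer absorbs the exchange of the two equal odd letters as 1,
        while the word answers with -1.\<close>
      then have "?v = act n (act n (tensor w) (gp (swp x y))) (yelem X r c)"
        using act_mult[OF tw sg[of x y] yg] xy by simp
      also have "\<dots> = - ?v"
      proof -
        have "act n (tensor w) (gp (swp x y)) = fscale (- 1) (tensor w)"
          using act_word_swp[OF w(1) n xy(4,3)] odd by (simp only: if_True)
        then show ?thesis by (simp only: act_scale_left) simp
      qed
      finally show ?thesis by (rule vec_two_cancel)
    qed
  qed
qed

lemma set_permute:
  assumes "length w = n" "g \<in> perms_on (pos n)" shows "set (permute g w) = set w"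
proof -
  have "set (permute g w) = (\<lambda>i. w ! i) ` (ap g ` {..<n})"
    using assms(1) by (auto simp: permute_def)
  also have "\<dots> = set w" unfolding perms_on_image[OF assms(2)] using assms(1) by (auto simp: set_conv_nth)
  finally show ?thesis .
qed

lemma act_word_span:
  assumes w: "w \<in> words n" and a: "a \<in> galg (pos n)"
    and P: "\<And>g. g \<in> perms_on (pos n) \<Longrightarrow> P (permute g w)"
  shows "act n (tensor w) a \<in> fun_vs.span (tensor ` {w \<in> words n. P w})"
  using a
proof (induction rule: galg_induct)
  case (add a b)
  then show ?case by (simp add: act_add_right fun_vs.span_add)
next
  case (gp c g)
  then have "tensor (permute g w) \<in> fun_vs.span (tensor ` {w \<in> words n. P w})"
    using P permute_words[OF w] by (intro fun_vs.span_base) auto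
  then show ?case by (simp only: act_const act_word[OF w gp] fun_vs.span_scale)
qed

text \<open>The condition \<open>b < \<nu> a\<close> places a rectangle with \<open>a + 1\<close>
  rows and \<open>b + 1\<close> columns inside the diagram. In a right action the outer row
  symmetrizer comes first and only permutes the letters; the factor of the rectangle then kills all
  resulting words.\<close>

lemma hook_kills_word:
  assumes A: "A0 \<subseteq> B0" "A1 \<subseteq> B1" "card A0 \<le> a" "card A1 \<le> b"
    and T: "is_tableau \<nu> (pos n) r c" "b < \<nu> a"
    and w: "w \<in> words n" "set w \<subseteq> A0 \<union> A1"
  shows "act n (tensor w) (yelem (pos n) r c) = 0"
proof -
  define X where "X = {x\<in>pos n. r x \<le> a \<and> c x \<le> b}"
  have X: "X \<subseteq> pos n" by (auto simp: X_def)
  have "antimono \<nu>" using T by (simp add: is_tableau_def)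
  then have big: "b < \<nu> i" if "i \<le> a" for i using antimonoD[of \<nu> i a] that T(2) by simp
  have bij: "bij_betw (\<lambda>x. (r x, c x)) X ({..a} \<times> {..b})"
    unfolding bij_betw_def
  proof
    show "inj_on (\<lambda>x. (r x, c x)) X" using tableau_inj[OF T(1)] by (auto simp: X_def inj_on_def)
    show "(\<lambda>x. (r x, c x)) ` X = {..a} \<times> {..b}"
    proof (intro subset_antisym subsetI)
      fix p assume "p \<in> {..a} \<times> {..b}"
      then obtain i j where ij: "p = (i, j)" "i \<le> a" "j \<le> b" by auto
      then have "j < \<nu> i" using big by fastforce
      then obtain x where "x \<in> pos n" "r x = i" "c x = j" by (rule tableau_ex[OF T(1)])
      then show "p \<in> (\<lambda>x. (r x, c x)) ` X" using ij by (auto simp: X_def)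
    qed (auto simp: X_def)
  qed
  obtain d where d: "yelem (pos n) r c =
      const d * (symz (pos n) r * (symz X r * altz X c) * altz (pos n) c :: 'f galgebra)"
    by (rule yelem_factor[OF finite_lessThan X X])
  have tw: "tensor w \<in> tensor_power n" by (rule tensor_in_power[OF w(1)])
  have yg: "yelem X r c \<in> galg (pos n)" using yelem_galg galg_mono[OF X] by blast
  let ?G = "{w \<in> words n. set w \<subseteq> A0 \<union> A1}"
  have "act n t (yelem X r c) = 0" if "t \<in> fun_vs.span (tensor ` ?G)" for t
    using that
  proof (induction rule: fun_vs.span_induct_alt)
    case (step k x y)
    then obtain u where u: "u \<in> words n" "set u \<subseteq> A0 \<union> A1" "x = tensor u" by blast
    show ?case
      unfolding act_add_left act_scale_left u(3) rectangle_kills_word[OF A X bij u(1,2)] using step by simp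
  qed simp
  moreover have "act n (tensor w) (symz (pos n) r) \<in> fun_vs.span (tensor ` ?G)"
    using w set_permute by (intro act_word_span) (auto simp: words_def)
  ultimately have 0: "act n (act n (tensor w) (symz (pos n) r)) (yelem X r c) = 0" by blast
  have "act n (tensor w) (symz (pos n) r * yelem X r c * altz (pos n) c) =
      act n (act n (act n (tensor w) (symz (pos n) r)) (yelem X r c)) (altz (pos n) c)"
    unfolding act_mult[OF tw galg_mult[OF sym_galg[of "pos n" r] yg] alt_galg[of "pos n" c]]
      act_mult[OF tw sym_galg[of "pos n" r] yg] ..
  then show ?thesis using 0 unfolding d act_const by simp
qed

section \<open>Dimensions of the quotient and the lower estimate\<close>

lemma dim_tensor_power: "fun_vs.dim (tensor_power n) = card (words n)"
proof -
  have "fun_vs.independent (tensor ` words n)" "inj_on tensor (words n)"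
    using tensor_independent[OF indep spanning, of n] tensor_inj_on[OF indep spanning, of n]
    by (simp_all add: words_def)
  then show ?thesis
    unfolding tensor_power_span by (simp add: fun_vs.dim_eq_card_independent card_image)
qed

lemma A_dim_eq:
  "A_dim \<Omega> n = card (words n) - fun_vs.dim (filter_ideal \<Omega> \<inter> tensor_power n)"
proof -
  have "fun_vs.subspace (filter_ideal \<Omega> \<inter> tensor_power n)"
    unfolding filter_ideal_def by (intro fun_vs.subspace_inter fun_vs.subspace_span tensor_power_subspace)
  then have "A_dim \<Omega> n = fun_vs.dim (tensor_power n) - fun_vs.dim (filter_ideal \<Omega> \<inter> tensor_power n)"
    unfolding A_dim_def
    by (rule fun_vs.quotient_dim_eq[OF tensor_power_subspace _ _ finite_imageI[OF finite_words[of n], of tensor]])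
       (auto simp: tensor_power_span)
  then show ?thesis by (simp add: dim_tensor_power)
qed

lemma A_dim_lower:
  assumes A: "A0 \<subseteq> B0" "A1 \<subseteq> B1" "card A0 = a" "card A1 = b"
    and \<Omega>: "\<Omega> \<subseteq> partitions" "\<And>\<nu>. \<nu> \<in> \<Omega> \<Longrightarrow> b < \<nu> a"
  shows "(a + b) ^ n \<le> A_dim \<Omega> n"
proof -
  let ?bad = "{w \<in> words n. \<not> set w \<subseteq> A0 \<union> A1}" and ?G = "{w \<in> words n. set w \<subseteq> A0 \<union> A1}"
  \<comment> \<open>Words in the chosen letters are killed by the Young element; any other word
    keeps a foreign letter under every permutation.\<close>
  have "filter_ideal \<Omega> \<inter> tensor_power n \<subseteq> fun_vs.span (tensor ` ?bad)"
  proof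
    fix t assume "t \<in> filter_ideal \<Omega> \<inter> tensor_power n"
    then have "t \<in> fun_vs.span (\<Union>\<nu>\<in>{\<nu>\<in>\<Omega>. psize \<nu> = n}. isotypic \<nu>)" by (intro filter_ideal_inter) auto
    moreover have "isotypic \<nu> \<subseteq> fun_vs.span (tensor ` ?bad)" if \<nu>: "\<nu> \<in> \<Omega>" "psize \<nu> = n" for \<nu>
    proof -
      have "\<nu> \<in> partitions" using \<Omega>(1) \<nu>(1) by blast
      then obtain r c where T: "is_tableau \<nu> (pos n) r c" unfolding \<nu>(2)[symmetric] by (rule standard_tableau)
      let ?e = "yelem (pos n) r c :: 'f galgebra"
      have "act n t (?e * y) \<in> fun_vs.span (tensor ` ?bad)" if t: "t \<in> tensor_power n" and y: "y \<in> galg (pos n)" for t y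
        using t
      proof (induction rule: tensor_power_induct)
        case zero
        show ?case by (simp add: fun_vs.span_zero)
      next
        case (step k w t)
        have "act n (tensor w) (?e * y) \<in> fun_vs.span (tensor ` ?bad)"
        proof (cases "set w \<subseteq> A0 \<union> A1")
          case True
          have "act n (tensor w) ?e = 0"
            using A step True \<Omega>(2)[OF \<nu>(1)] by (intro hook_kills_word[of A0 A1 a b, OF _ _ _ _ T]) auto
          then show ?thesis
            using act_mult[OF tensor_in_power[OF step(1)] yelem_galg y] by (simp add: fun_vs.span_zero)
        next
          case False
          then show ?thesis
            using step(1) y set_permute by (intro act_word_span galg_mult yelem_galg) (auto simp: words_def)
        qed
        then show ?case unfolding act_add_left act_scale_left using step by (intro fun_vs.span_add fun_vs.span_scale)
      qed
      then show ?thesis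
        unfolding isotypic_eq[OF T] by (intro fun_vs.span_minimal fun_vs.subspace_span) auto
    qed
    then have "(\<Union>\<nu>\<in>{\<nu>\<in>\<Omega>. psize \<nu> = n}. isotypic \<nu>) \<subseteq> fun_vs.span (tensor ` ?bad)" by blast
    then have "fun_vs.span (\<Union>\<nu>\<in>{\<nu>\<in>\<Omega>. psize \<nu> = n}. isotypic \<nu>) \<subseteq> fun_vs.span (tensor ` ?bad)"
      by (rule fun_vs.span_minimal[OF _ fun_vs.subspace_span])
    ultimately show "t \<in> fun_vs.span (tensor ` ?bad)" by blast
  qed
  then have "fun_vs.dim (filter_ideal \<Omega> \<inter> tensor_power n) \<le> card (tensor ` ?bad)"
    using finite_words by (intro fun_vs.dim_le_card) auto
  also have "\<dots> \<le> card ?bad" using finite_words by (intro card_image_le) auto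
  finally have le: "fun_vs.dim (filter_ideal \<Omega> \<inter> tensor_power n) \<le> card ?bad" .
  have "card (words n) = card ?G + card ?bad"
  proof -
    have "words n = ?G \<union> ?bad" by blast
    then show ?thesis using finite_words[of n] card_Un_disjoint[of ?G ?bad] by auto
  qed
  moreover have "?G = {w. set w \<subseteq> A0 \<union> A1 \<and> length w = n}" using A by (auto simp: words_def)
  moreover have "finite A0" "finite A1" "A0 \<inter> A1 = {}" using A fin disj finite_subset by auto
  ultimately have "card (words n) = (a + b) ^ n + card ?bad"
    using A(3,4) by (simp add: card_lists_length_eq card_Un_disjoint)
  then show ?thesis unfolding A_dim_eq using le by linarith
qed

end

section \<open>The upper bound\<close>

lemma perms_on_restrict:
  assumes "finite Y" "ap g ` Y \<subseteq> Y"
  obtains g1 where "g1 \<in> perms_on Y" "\<And>x. x \<in> Y \<Longrightarrow> ap g1 x = ap g x"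
proof -
  define \<sigma> where "\<sigma> x = (if x \<in> Y then ap g x else x)" for x
  have "ap g ` Y = Y" by (rule endo_inj_surj) (use assms in \<open>auto simp: inj_on_def\<close>)
  then have "bij_betw (ap g) Y Y" by (simp add: bij_betw_def inj_on_def)
  then have "bij_betw \<sigma> Y Y" by (subst bij_betw_cong[of Y \<sigma> "ap g"]) (auto simp: \<sigma>_def)
  then have perm: "\<sigma> permutes Y" by (rule bij_imp_permutes) (simp add: \<sigma>_def)
  have "ap (FPerm \<sigma>) = \<sigma>" by (rule ap_FPerm[OF assms(1) perm])
  then show ?thesis using perm by (intro that[of "FPerm \<sigma>"]) (auto simp: perms_on_def \<sigma>_def)
qed

lemma perms_on_commute:
  assumes "g \<in> perms_on Y" "h \<in> perms_on Z" "Y \<inter> Z = {}"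
  shows "g + h = h + g"
proof (rule fperm_eqI)
  fix x
  consider "x \<in> Y" | "x \<in> Z" | "x \<notin> Y" "x \<notin> Z" by blast
  then show "ap (g + h) x = ap (h + g) x"
  proof cases
    case 1
    then have "x \<notin> Z" "ap g x \<notin> Z" using assms(3) perms_on_in[OF assms(1), of x] by auto
    then show ?thesis using perms_on_fix[OF assms(2)] by simp
  next
    case 2
    then have "x \<notin> Y" "ap h x \<notin> Y" using assms(3) perms_on_in[OF assms(2), of x] by auto
    then show ?thesis using perms_on_fix[OF assms(1)] by simp
  next
    case 3
    then show ?thesis using perms_on_fix[OF assms(1)] perms_on_fix[OF assms(2)] by simp
  qed
qed

lemma galg_commute_gp:
  assumes "a \<in> galg Y" "h \<in> perms_on Z" "Y \<inter> Z = {}"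
  shows "gp h * a = a * gp h"
  using assms(1)
proof (induction rule: galg_induct)
  case (gp c g)
  then show ?case using perms_on_commute[OF gp assms(2,3)] by (simp add: mult_single)
qed (simp add: algebra_simps)

text \<open>
  The factor \<open>s\<close> symmetrizes the first \<open>a\<close> rows and antisymmetrizes the first \<open>b\<close> columns of the
  remaining diagram; the label of a position names its row or column, respectively, and the
  leftover positions get distinct labels.
\<close>

lemma tableau_label:
  assumes T: "is_tableau \<nu> X r c" and ab: "a + b \<le> \<alpha>"
    and rest: "card {x\<in>X. a \<le> r x \<and> b \<le> c x} \<le> K"
  obtains s :: "'f::field_char_0 galgebra" and l :: "nat \<Rightarrow> nat" and d p q where
    "s \<in> galg X" "p \<in> galg X" "q \<in> galg X" "yelem X r c = const d * (p * s * q)"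
    "\<And>h. h \<in> stab X l \<Longrightarrow> (gp h * s = s \<or> gp h * s = - s) \<and> (s * gp h = s \<or> s * gp h = - s)"
    "\<And>x. x \<in> X \<Longrightarrow> l x < \<alpha> + K" "inj_on l {x\<in>X. \<alpha> \<le> l x}"
proof -
  have fin: "finite X" using T by (rule tableau_finite)
  define X1 where "X1 = {x\<in>X. r x < a}"
  define X2 where "X2 = {x\<in>X. a \<le> r x \<and> c x < b}"
  define R where "R = {x\<in>X. a \<le> r x \<and> b \<le> c x}"
  have sub: "X1 \<subseteq> X" "X2 \<subseteq> X" "X1 \<inter> X2 = {}" and finR: "finite R" "finite X1" "finite X2"
    using fin by (auto simp: X1_def X2_def R_def)
  obtain h where h: "bij_betw h R {0..<card R}" using ex_bij_betw_finite_nat[OF finR(1)] by blast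
  define l where "l x = (if r x < a then r x else if c x < b then a + c x else \<alpha> + h x)" for x
  have lR: "\<alpha> \<le> l x \<longleftrightarrow> x \<in> R" if "x \<in> X" for x
    using that ab by (auto simp: l_def R_def)
  have bound: "l x < \<alpha> + K" if "x \<in> X" for x
  proof (cases "x \<in> R")
    case True
    then have "h x < K" using bij_betwE[OF h] rest by (fastforce simp: R_def)
    then show ?thesis using True by (simp add: l_def R_def)
  next
    case False
    then show ?thesis using lR[OF that] by simp
  qed
  have inj: "inj_on l {x\<in>X. \<alpha> \<le> l x}"
  proof (rule inj_onI)
    fix x y assume xy: "x \<in> {x\<in>X. \<alpha> \<le> l x}" "y \<in> {x\<in>X. \<alpha> \<le> l x}" "l x = l y"
    then have R: "x \<in> R" "y \<in> R" using lR[of x] lR[of y] by simp_all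
    then have "h x = h y" using xy by (simp add: l_def R_def)
    then show "x = y" using R h by (auto simp: bij_betw_def inj_on_def)
  qed
  define s where "s = (symz X1 r * altz X2 c :: 'f galgebra)"
  have s: "s \<in> galg X"
    unfolding s_def using sym_galg alt_galg galg_mono[OF sub(1)] galg_mono[OF sub(2)] by (intro galg_mult) auto
  obtain d where d: "yelem X r c = const d * (symz X r * s * altz X c)"
    unfolding s_def by (rule yelem_factor[OF fin sub(1,2)])
  have st: "(gp g * s = s \<or> gp g * s = - s) \<and> (s * gp g = s \<or> s * gp g = - s)" if g: "g \<in> stab X l" for g
  proof -
    have gX: "g \<in> perms_on X" and lg: "\<And>x. x \<in> X \<Longrightarrow> l (ap g x) = l x" using g by (auto simp: stab_def)
    have cls: "(x \<in> X1 \<longleftrightarrow> l x < a) \<and> (x \<in> X2 \<longleftrightarrow> a \<le> l x \<and> l x < a + b)" if "x \<in> X" for x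
      using that ab by (auto simp: l_def X1_def X2_def)
    have "(ap g x \<in> X1 \<longleftrightarrow> x \<in> X1) \<and> (ap g x \<in> X2 \<longleftrightarrow> x \<in> X2)" if "x \<in> X" for x
    proof -
      have "ap g x \<in> X" using that perms_on_in[OF gX, of x] by simp
      then show ?thesis using cls[OF that] cls[of "ap g x"] lg[OF that] by simp
    qed
    then have img: "ap g ` X1 \<subseteq> X1" "ap g ` X2 \<subseteq> X2" using sub by blast+
    obtain g1 where g1: "g1 \<in> perms_on X1" "\<And>x. x \<in> X1 \<Longrightarrow> ap g1 x = ap g x"
      by (rule perms_on_restrict[OF finR(2) img(1)]) blast
    obtain g2 where g2: "g2 \<in> perms_on X2" "\<And>x. x \<in> X2 \<Longrightarrow> ap g2 x = ap g x"
      by (rule perms_on_restrict[OF finR(3) img(2)]) blast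
    have st1: "g1 \<in> stab X1 r"
      using g1 lg img(1) by (fastforce simp: stab_def l_def X1_def)
    have st2: "g2 \<in> stab X2 c"
    proof -
      have "c (ap g x) = c x" if "x \<in> X2" for x
        using that lg[of x] img(2) by (fastforce simp: l_def X2_def)
      then show ?thesis using g2 by (simp add: stab_def)
    qed
    have comm: "g1 + g2 = g2 + g1" by (rule perms_on_commute[OF g1(1) g2(1) sub(3)])
    \<comment> \<open>The leftover positions carry distinct labels and are fixed, so
      \<open>g\<close> splits into a row part, which the symmetrizer absorbs, and a column part,
      which contributes its sign. The two parts commute because \<open>X1\<close> and
      \<open>X2\<close> are disjoint.\<close>
    have eq: "g = g1 + g2"
    proof (rule fperm_eqI)
      fix x
      consider "x \<in> X1" | "x \<in> X2" | "x \<in> R" | "x \<notin> X" by (force simp: X1_def X2_def R_def)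
      then show "ap g x = ap (g1 + g2) x"
      proof cases
        case 1
        then have "x \<notin> X2" using sub(3) by blast
        then show ?thesis using 1 g1 perms_on_fix[OF g2(1)] by simp
      next
        case 2
        then have "ap g x \<notin> X1" using img(2) sub(3) by blast
        then show ?thesis using 2 g2 perms_on_fix[OF g1(1)] by simp
      next
        case 3
        then have x: "x \<in> X" "x \<notin> X1" "x \<notin> X2" by (auto simp: R_def X1_def X2_def)
        have "ap g x \<in> X" using x gX by simp
        then have "ap g x = x"
          using inj lg[OF x(1)] x lR[OF x(1)] 3 by (auto simp: inj_on_def)
        then show ?thesis using x perms_on_fix[OF g1(1)] perms_on_fix[OF g2(1)] by simp
      next
        case 4
        then have "x \<notin> X1" "x \<notin> X2" using sub by auto
        then show ?thesis using perms_on_fix[OF gX 4] perms_on_fix[OF g1(1)] perms_on_fix[OF g2(1)] by simp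
      qed
    qed
    have c1: "gp g2 * symz X1 r = (symz X1 r * gp g2 :: 'f galgebra)"
      by (rule galg_commute_gp[OF sym_galg g2(1) sub(3)])
    have c2: "gp g1 * altz X2 c = (altz X2 c * gp g1 :: 'f galgebra)"
      by (rule galg_commute_gp[OF alt_galg g1(1)]) (use sub in blast)
    have "gp g * s = gp g2 * (gp g1 * symz X1 r) * altz X2 c"
      unfolding s_def eq comm gp_mult[symmetric] by (simp only: mult.assoc)
    also have "\<dots> = symz X1 r * (gp g2 * altz X2 c)"
      unfolding gp_sym[OF st1] c1 by (simp only: mult.assoc)
    also have "\<dots> = const (psgn g2) * s"
      unfolding gp_alt[OF st2] s_def by (rule const_left_commute)
    finally have 1: "gp g * s = const (psgn g2) * s" .
    have "s * gp g = symz X1 r * (altz X2 c * gp g1) * gp g2"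
      unfolding s_def eq gp_mult[symmetric] by (simp only: mult.assoc)
    also have "\<dots> = (symz X1 r * gp g1) * (altz X2 c * gp g2)"
      unfolding c2[symmetric] by (simp only: mult.assoc)
    also have "\<dots> = const (psgn g2) * s"
      unfolding sym_gp[OF st1] alt_gp[OF st2] s_def by (rule const_left_commute)
    finally show ?thesis using 1 psgn_cases[of g2, where 'f = 'f] by (auto simp: single_uminus)
  qed
  show ?thesis by (rule that[OF s sym_galg alt_galg d st bound inj])
qed

definition labellings :: "nat \<Rightarrow> nat \<Rightarrow> nat \<Rightarrow> (nat \<Rightarrow> nat) set" where
  "labellings \<alpha> K n = {f \<in> {..<n} \<rightarrow>\<^sub>E {..<\<alpha> + K}. inj_on f {x\<in>{..<n}. \<alpha> \<le> f x}}"

lemma finite_labellings: "finite (labellings \<alpha> K n)"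
  by (rule finite_subset[of _ "{..<n} \<rightarrow>\<^sub>E {..<\<alpha> + K}"]) (auto simp: labellings_def finite_PiE)

text \<open>Without repeatable labels more than \<open>K\<close> positions cannot be labelled. This
  makes the dimensions vanish eventually when the exponent is 0.\<close>

lemma labellings_0: "K < n \<Longrightarrow> labellings 0 K n = {}"
proof (rule ccontr)
  assume n: "K < n" and "labellings 0 K n \<noteq> {}"
  then obtain f where "f \<in> {..<n} \<rightarrow>\<^sub>E {..<K}" "inj_on f {..<n}" by (auto simp: labellings_def lessThan_def)
  then have "card {..<n} \<le> card {..<K}" by (intro card_inj_on_le[of f]) auto
  then show False using n by simp
qed

text \<open>A labelling is determined by the positions of the labels above \<open>\<alpha>\<close> and its remaining values.\<close>

lemma card_labellings:
  assumes "0 < \<alpha>" shows "card (labellings \<alpha> K n) \<le> Suc n ^ K * \<alpha> ^ n"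
proof -
  \<comment> \<open>\<open>P f\<close> inverts \<open>f\<close> on the labels from
    \<open>\<alpha>\<close> on, with the value \<open>n\<close> for labels that do not occur.
    \<open>Q f\<close> overwrites these labels by 0, which lies in its range because
    \<open>0 < \<alpha>\<close>.\<close>
  define P where "P f = (\<lambda>i\<in>{\<alpha>..<\<alpha> + K}. if \<exists>x<n. f x = i then SOME x. x < n \<and> f x = i else n)"
    for f :: "nat \<Rightarrow> nat"
  define Q where "Q f = (\<lambda>x\<in>{..<n}. if f x < \<alpha> then f x else 0)" for f :: "nat \<Rightarrow> nat"
  have P: "P f (f x) = x" if f: "f \<in> labellings \<alpha> K n" and x: "x < n" "\<alpha> \<le> f x" for f x
  proof -
    have "(SOME y. y < n \<and> f y = f x) = x"
      using f x by (intro some_equality) (auto simp: labellings_def inj_on_def)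
    moreover have "f x < \<alpha> + K" using f x by (auto simp: labellings_def)
    ultimately show ?thesis using x by (auto simp: P_def)
  qed
  have P': "x < n \<and> f x = i" if "P f i = x" "x \<noteq> n" "i \<in> {\<alpha>..<\<alpha> + K}" for f i x
    using that someI_ex[of "\<lambda>x. x < n \<and> f x = i"] by (auto simp: P_def split: if_splits)
  have "inj_on (\<lambda>f. (P f, Q f)) (labellings \<alpha> K n)"
  proof (rule inj_onI)
    fix f g assume f: "f \<in> labellings \<alpha> K n" and g: "g \<in> labellings \<alpha> K n" and eq: "(P f, Q f) = (P g, Q g)"
    have PQ: "P f = P g" "Q f = Q g" using eq by simp_all
    have imp: "g x = f x" if f: "f \<in> labellings \<alpha> K n" and x: "x < n" "\<alpha> \<le> f x" and "P f = P g" for f g x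
    proof -
      have "P g (f x) = x" using P[OF f x] that by simp
      moreover have "f x \<in> {\<alpha>..<\<alpha> + K}" using f x by (auto simp: labellings_def)
      ultimately show ?thesis using P'[of g "f x" x] x by simp
    qed
    show "f = g"
    proof
      fix x show "f x = g x"
      proof (cases "x < n")
        case True
        show ?thesis
        proof (cases "\<alpha> \<le> f x \<or> \<alpha> \<le> g x")
          case True
          then show ?thesis
          proof
            assume "\<alpha> \<le> f x"
            then show ?thesis using imp[OF f \<open>x < n\<close> _ PQ(1)] by simp
          next
            assume "\<alpha> \<le> g x"
            then show ?thesis using imp[OF g \<open>x < n\<close> _ PQ(1)[symmetric]] by simp
          qed
        next
          case False
          have "Q f x = Q g x" using PQ(2) by simp
          then show ?thesis using False True by (simp add: Q_def)
        qed
      next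
        case False
        then show ?thesis using f g by (auto simp: labellings_def PiE_def extensional_def)
      qed
    qed
  qed
  moreover have "(\<lambda>f. (P f, Q f)) ` labellings \<alpha> K n \<subseteq>
      ({\<alpha>..<\<alpha> + K} \<rightarrow>\<^sub>E {..n}) \<times> ({..<n} \<rightarrow>\<^sub>E {..<\<alpha>})"
  proof (rule image_subsetI)
    fix f :: "nat \<Rightarrow> nat"
    have "P f i \<le> n" if "i \<in> {\<alpha>..<\<alpha> + K}" for i
      using P'[of f i "P f i"] that by (cases "P f i = n") auto
    then have "P f \<in> {\<alpha>..<\<alpha> + K} \<rightarrow>\<^sub>E {..n}" by (auto simp: P_def)
    moreover have "Q f \<in> {..<n} \<rightarrow>\<^sub>E {..<\<alpha>}" using assms by (auto simp: Q_def)
    ultimately show "(P f, Q f) \<in> ({\<alpha>..<\<alpha> + K} \<rightarrow>\<^sub>E {..n}) \<times> ({..<n} \<rightarrow>\<^sub>E {..<\<alpha>})" by simp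
  qed
  ultimately have "card (labellings \<alpha> K n) \<le>
      card (({\<alpha>..<\<alpha> + K} \<rightarrow>\<^sub>E {..n}) \<times> ({..<n} \<rightarrow>\<^sub>E {..<\<alpha>}))"
    by (rule card_inj_on_le) (simp add: finite_PiE)
  then show ?thesis by (simp add: card_cartesian_product card_PiE)
qed

section \<open>Counting the partitions in a hook\<close>

lemma partition_le_psize:
  assumes "\<nu> \<in> partitions" shows "\<nu> i \<le> psize \<nu>" "\<nu> i \<noteq> 0 \<Longrightarrow> i < psize \<nu>"
proof -
  have fin: "finite {i. \<nu> i \<noteq> 0}" and anti: "antimono \<nu>" using assms by (auto simp: partitions_def)
  show "\<nu> i \<le> psize \<nu>"
    unfolding psize_def using fin member_le_sum[of i "{i. \<nu> i \<noteq> 0}" \<nu>] by (cases "\<nu> i = 0") auto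
  assume "\<nu> i \<noteq> 0"
  then have pos: "\<nu> j \<noteq> 0" if "j \<le> i" for j using antimonoD[OF anti that] by simp
  have "Suc i = (\<Sum>j\<le>i. 1)" by simp
  also have "\<dots> \<le> (\<Sum>j\<le>i. \<nu> j)" by (intro sum_mono) (use pos in \<open>auto simp: Suc_le_eq\<close>)
  also have "\<dots> \<le> psize \<nu>" unfolding psize_def using fin pos by (intro sum_mono2) auto
  finally show "i < psize \<nu>" by simp
qed

text \<open>Such a partition is determined by its first \<open>k\<close> row lengths and its first
  \<open>l\<close> column heights, each of which is at most \<open>n\<close>.\<close>

lemma hook_partitions:
  fixes k l n :: nat
  defines "H \<equiv> {\<nu> \<in> partitions. psize \<nu> = n \<and> \<nu> k \<le> l}"
  shows "finite H" "card H \<le> Suc n ^ (k + l)"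
proof -
  define arm where "arm \<nu> = (\<lambda>i\<in>{..<k}. \<nu> i)" for \<nu> :: "nat \<Rightarrow> nat"
  define leg where "leg \<nu> = (\<lambda>j\<in>{..<l}. card {i. j < \<nu> i})" for \<nu> :: "nat \<Rightarrow> nat"
  have fin: "finite {i. j < \<nu> i} \<and> card {i. j < \<nu> i} \<le> n" if "\<nu> \<in> H" for \<nu> j
  proof -
    have sub: "{i. j < \<nu> i} \<subseteq> {..<n}" using partition_le_psize(2)[of \<nu>] that by (force simp: H_def)
    then show ?thesis using card_mono[OF _ sub] finite_subset[OF sub] by simp
  qed
  have seg: "j < \<nu> i \<longleftrightarrow> i < card {i. j < \<nu> i}" if \<nu>: "\<nu> \<in> H" for \<nu> i j
  proof -
    have anti: "antimono \<nu>" using \<nu> by (simp add: H_def partitions_def)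
    show ?thesis
    proof
      assume "j < \<nu> i"
      then have "{..i} \<subseteq> {i. j < \<nu> i}" using antimonoD[OF anti] by (auto intro: less_le_trans)
      then have "card {..i} \<le> card {i. j < \<nu> i}" using fin[OF \<nu>] by (intro card_mono) auto
      then show "i < card {i. j < \<nu> i}" by simp
    next
      assume i: "i < card {i. j < \<nu> i}"
      show "j < \<nu> i"
      proof (rule ccontr)
        assume "\<not> j < \<nu> i"
        have "{i. j < \<nu> i} \<subseteq> {..<i}"
        proof
          fix i' assume "i' \<in> {i. j < \<nu> i}"
          then show "i' \<in> {..<i}" using antimonoD[OF anti, of i i'] \<open>\<not> j < \<nu> i\<close> by (cases "i \<le> i'") auto
        qed
        then have "card {i. j < \<nu> i} \<le> card {..<i}" by (intro card_mono) auto
        then show False using i by simp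
      qed
    qed
  qed
  have inj: "inj_on (\<lambda>\<nu>. (arm \<nu>, leg \<nu>)) H"
  proof (rule inj_onI)
    fix \<nu> \<kappa> assume \<nu>: "\<nu> \<in> H" and \<kappa>: "\<kappa> \<in> H" and eq: "(arm \<nu>, leg \<nu>) = (arm \<kappa>, leg \<kappa>)"
    show "\<nu> = \<kappa>"
    proof
      fix i show "\<nu> i = \<kappa> i"
      proof (cases "i < k")
        case True
        have "arm \<nu> i = arm \<kappa> i" using eq by simp
        then show ?thesis using True by (simp add: arm_def)
      next
        case False
        have le: "\<mu> i \<le> l" if "\<mu> \<in> H" for \<mu>
          using that False antimonoD[of \<mu> k i] by (auto simp: H_def partitions_def)
        have "j < \<nu> i \<longleftrightarrow> j < \<kappa> i" for j
        proof (cases "j < l")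
          case True
          have "leg \<nu> j = leg \<kappa> j" using eq by simp
          then have cards: "card {i. j < \<nu> i} = card {i. j < \<kappa> i}" using True by (simp add: leg_def)
          have "j < \<nu> i \<longleftrightarrow> i < card {i. j < \<nu> i}" by (rule seg[OF \<nu>])
          also have "\<dots> \<longleftrightarrow> i < card {i. j < \<kappa> i}" by (simp only: cards)
          also have "\<dots> \<longleftrightarrow> j < \<kappa> i" by (rule seg[OF \<kappa>, symmetric])
          finally show ?thesis .
        next
          case False
          then show ?thesis using le[OF \<nu>] le[OF \<kappa>] by auto
        qed
        then show ?thesis by (metis linorder_neqE_nat less_irrefl)
      qed
    qed
  qed
  have img: "(\<lambda>\<nu>. (arm \<nu>, leg \<nu>)) ` H \<subseteq> ({..<k} \<rightarrow>\<^sub>E {..n}) \<times> ({..<l} \<rightarrow>\<^sub>E {..n})"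
  proof (rule image_subsetI)
    fix \<nu> assume \<nu>: "\<nu> \<in> H"
    have "\<nu> i \<le> n" for i using partition_le_psize(1)[of \<nu> i] \<nu> by (auto simp: H_def)
    then show "(arm \<nu>, leg \<nu>) \<in> ({..<k} \<rightarrow>\<^sub>E {..n}) \<times> ({..<l} \<rightarrow>\<^sub>E {..n})"
      using fin[OF \<nu>] by (auto simp: arm_def leg_def)
  qed
  have fin': "finite (({..<k} \<rightarrow>\<^sub>E {..n}) \<times> ({..<l} \<rightarrow>\<^sub>E {..n}))" by (simp add: finite_PiE)
  show "finite H" using inj_on_finite[OF inj img fin'] .
  show "card H \<le> Suc n ^ (k + l)"
    using card_inj_on_le[OF inj img fin'] by (simp add: card_cartesian_product card_PiE power_add)
qed

section \<open>Small spanning sets modulo the ideal\<close>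

context homogeneous_basis
begin

text \<open>One representative for each key spans all vectors. A key that does not occur contributes
  an arbitrary vector, which only enlarges the spanning set.\<close>

lemma span_by_keys:
  assumes fin: "finite Keys" and key: "\<And>i. i \<in> I \<Longrightarrow> key i \<in> Keys"
    and eq: "\<And>i j. i \<in> I \<Longrightarrow> j \<in> I \<Longrightarrow> key i = key j \<Longrightarrow> v i = v j \<or> v i = - v j"
  obtains Y :: "(('v list \<Rightarrow> 'f) \<Rightarrow> 'f) set"
  where "finite Y" "card Y \<le> card Keys" "v ` I \<subseteq> fun_vs.span Y"
proof
  let ?Y = "(\<lambda>\<kappa>. v (SOME i. i \<in> I \<and> key i = \<kappa>)) ` Keys"
  show "finite ?Y" using fin by simp
  show "card ?Y \<le> card Keys" using fin by (rule card_image_le)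
  show "v ` I \<subseteq> fun_vs.span ?Y"
  proof (rule image_subsetI)
    fix i assume i: "i \<in> I"
    define j where "j = (SOME j. j \<in> I \<and> key j = key i)"
    have j: "j \<in> I \<and> key j = key i" unfolding j_def by (rule someI[of _ i]) (simp add: i)
    have "v j \<in> fun_vs.span ?Y" unfolding j_def using key[OF i] by (intro fun_vs.span_base) auto
    then show "v i \<in> fun_vs.span ?Y" using eq[of i j] i j fun_vs.span_neg by auto
  qed
qed

text \<open>Up to sign, \<open>s\<close> absorbs label-preserving permutations on both sides. On its
  right this leaves only the labelling \<open>x \<mapsto> l (ap h x)\<close>; on its left it leaves
  only how often each letter occurs under each label, a family of
  \<open>(\<alpha> + K) * card (B0 \<union> B1)\<close> numbers between 0 and \<open>n\<close>. The
  outer factor \<open>p\<close> changes the tensor, and \<open>q\<close> joins the group algebra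
  element on the right.\<close>

lemma isotypic_span:
  assumes T: "is_tableau \<nu> (pos n) r c" and ab: "a + b \<le> \<alpha>"
    and rest: "card {x\<in>pos n. a \<le> r x \<and> b \<le> c x} \<le> K"
  obtains Y where "finite Y" "isotypic \<nu> \<subseteq> fun_vs.span Y"
    "card Y \<le> Suc n ^ ((\<alpha> + K) * card (B0 \<union> B1)) * card (labellings \<alpha> K n)"
proof -
  obtain s :: "'f galgebra" and l d p q where
    g: "s \<in> galg (pos n)" "p \<in> galg (pos n)" "q \<in> galg (pos n)" and e: "yelem (pos n) r c = const d * (p * s * q)"
    and st: "\<And>h. h \<in> stab (pos n) l \<Longrightarrow> (gp h * s = s \<or> gp h * s = - s) \<and> (s * gp h = s \<or> s * gp h = - s)"
    and l: "\<And>x. x \<in> pos n \<Longrightarrow> l x < \<alpha> + K" "inj_on l {x\<in>pos n. \<alpha> \<le> l x}"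
    by (rule tableau_label[OF T ab rest]) blast
  let ?P = "{..<\<alpha> + K} \<times> (B0 \<union> B1)"
  define I where "I = words n \<times> perms_on (pos n)"
  define v where "v = (\<lambda>(w, h). act n (tensor w) (s * gp h))"
  define cnt where "cnt w = (\<lambda>u\<in>?P. card {x\<in>pos n. (l x, w ! x) = u})" for w
  define key where "key = (\<lambda>(w, h). (cnt w, restrict (\<lambda>x. l (ap h x)) (pos n)))"
  let ?Keys = "(?P \<rightarrow>\<^sub>E {..n}) \<times> labellings \<alpha> K n"
  have fin_keys: "finite ?Keys" using fin by (auto simp: finite_PiE finite_labellings)
  have key: "key i \<in> ?Keys" if i: "i \<in> I" for i
  proof -
    obtain w h where wh: "i = (w, h)" "w \<in> words n" "h \<in> perms_on (pos n)" using i by (auto simp: I_def)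
    have "card {x\<in>pos n. (l x, w ! x) = u} \<le> n" for u
      using card_mono[of "pos n" "{x\<in>pos n. (l x, w ! x) = u}"] by auto
    then have "cnt w \<in> ?P \<rightarrow>\<^sub>E {..n}" by (auto simp: cnt_def)
    moreover have "restrict (\<lambda>x. l (ap h x)) (pos n) \<in> labellings \<alpha> K n"
    proof -
      have hx: "ap h x \<in> pos n" if "x \<in> pos n" for x
        using that perms_on_in[OF wh(3), of x] by simp
      have "inj_on (\<lambda>x. l (ap h x)) {x\<in>pos n. \<alpha> \<le> l (ap h x)}"
      proof (rule inj_onI)
        fix x y assume "x \<in> {x\<in>pos n. \<alpha> \<le> l (ap h x)}" "y \<in> {x\<in>pos n. \<alpha> \<le> l (ap h x)}"
          "l (ap h x) = l (ap h y)"
        then have "ap h x \<in> {x\<in>pos n. \<alpha> \<le> l x}" "ap h y \<in> {x\<in>pos n. \<alpha> \<le> l x}"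
          and eq: "l (ap h x) = l (ap h y)" using hx by blast+
        then have "ap h x = ap h y" using inj_onD[OF l(2) eq] by blast
        then show "x = y" by simp
      qed
      then have "inj_on (restrict (\<lambda>x. l (ap h x)) (pos n)) {x\<in>pos n. \<alpha> \<le> restrict (\<lambda>x. l (ap h x)) (pos n) x}"
        by (auto simp: inj_on_def)
      moreover have "restrict (\<lambda>x. l (ap h x)) (pos n) \<in> pos n \<rightarrow>\<^sub>E {..<\<alpha> + K}"
        using hx l(1) by auto
      ultimately show ?thesis by (simp add: labellings_def)
    qed
    ultimately show ?thesis by (simp add: key_def wh)
  qed
  have eq: "v i = v j \<or> v i = - v j" if ij: "i \<in> I" "j \<in> I" "key i = key j" for i j
  proof -
    obtain w h w' h' where wh: "i = (w, h)" "w \<in> words n" "h \<in> perms_on (pos n)"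
      "j = (w', h')" "w' \<in> words n" "h' \<in> perms_on (pos n)" using ij by (auto simp: I_def)
    have len: "length w = n" "length w' = n" using wh by (auto simp: words_def)
    have tw: "tensor w \<in> tensor_power n" "tensor w' \<in> tensor_power n" using wh tensor_in_power by auto
    have "l (ap h x) = l (ap h' x)" if "x \<in> pos n" for x
    proof -
      have "restrict (\<lambda>x. l (ap h x)) (pos n) x = restrict (\<lambda>x. l (ap h' x)) (pos n) x"
        using ij(3) by (simp add: key_def wh)
      then show ?thesis using that by simp
    qed
    then have "l (ap (h + - h') x) = l x" if "x \<in> pos n" for x
      using that perms_on_in[OF perms_on_uminus[OF wh(6)], of x] by simp
    then have "h + - h' \<in> stab (pos n) l"
      using wh by (simp add: stab_def perms_on_plus perms_on_uminus)
    then have "s * gp (h + - h') = s \<or> s * gp (h + - h') = - s" using st by blast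
    moreover have "s * gp h = s * gp (h + - h') * gp h'" by (simp add: mult.assoc gp_mult add.assoc)
    ultimately have sh: "s * gp h = s * gp h' \<or> s * gp h = - (s * gp h')" by auto
    have cnt_out: "card {x\<in>pos n. (l x, u ! x) = y} = 0" if "y \<notin> ?P" "u \<in> words n" for u y
    proof -
      have "u ! x \<in> B0 \<union> B1" if "x < n" for x using that \<open>u \<in> words n\<close> by (auto simp: words_def subset_iff)
      then have "{x\<in>pos n. (l x, u ! x) = y} = {}" using \<open>y \<notin> ?P\<close> l(1) by auto
      then show ?thesis by simp
    qed
    have "card {x\<in>pos n. (l x, w ! x) = y} = card {x\<in>pos n. (l x, w' ! x) = y}" for y
    proof (cases "y \<in> ?P")
      case True
      have "cnt w y = cnt w' y" using ij(3) by (simp add: key_def wh)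
      then show ?thesis using True by (simp add: cnt_def)
    next
      case False
      then show ?thesis using cnt_out[OF False wh(2)] cnt_out[OF False wh(5)] by (simp only:)
    qed
    \<comment> \<open>Equal counts mean equal multisets of pairs of label and letter, so some
      permutation matches them; it preserves labels and carries \<open>w'\<close> to
      \<open>w\<close>.\<close>
    then have "image_mset (\<lambda>x. (l x, w ! x)) (mset_set (pos n)) = image_mset (\<lambda>x. (l x, w' ! x)) (mset_set (pos n))"
      by (intro multiset_eqI) (simp add: count_image_mset_eq_card_vimage)
    then obtain \<sigma> where \<sigma>: "\<sigma> permutes pos n" "\<forall>x\<in>pos n. (l x, w ! x) = (l (\<sigma> x), w' ! \<sigma> x)"
      by (rule image_mset_eq_implies_permutes[OF finite_lessThan])
    define g where "g = FPerm \<sigma>"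
    have pg: "ap g = \<sigma>" unfolding g_def by (rule ap_FPerm[OF finite_lessThan \<sigma>(1)])
    have gX: "g \<in> perms_on (pos n)" using \<sigma>(1) pg by (simp add: perms_on_def)
    have gst: "g \<in> stab (pos n) l" using gX \<sigma>(2) pg by (simp add: stab_def)
    have "permute g w' = w" by (rule nth_equalityI) (use \<sigma>(2) pg len in auto)
    then have "act n (tensor w') (gp g) = tensor w \<or> act n (tensor w') (gp g) = - tensor w"
      using act_word[OF wh(5) gX] koszul_cases[of g w'] by auto
    then have "act n (tensor w) (s * gp h') = act n (tensor w') (gp g * (s * gp h')) \<or>
        act n (tensor w) (s * gp h') = - act n (tensor w') (gp g * (s * gp h'))"
    proof -
      have "act n (tensor w') (gp g * (s * gp h')) = act n (act n (tensor w') (gp g)) (s * gp h')"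
        using tw(2) gX g(1) wh(6) by (intro act_mult galg_mult) auto
      moreover have "act n (- tensor w) a = - act n (tensor w) a" for a
        using act_scale_left[of n "- 1" "tensor w" a] by simp
      ultimately show ?thesis
        using \<open>act n (tensor w') (gp g) = tensor w \<or> act n (tensor w') (gp g) = - tensor w\<close> by auto
    qed
    moreover have "gp g * (s * gp h') = s * gp h' \<or> gp g * (s * gp h') = - (s * gp h')"
    proof -
      have "gp g * (s * gp h') = (gp g * s) * gp h'" by (simp only: mult.assoc)
      then show ?thesis using st[OF gst] by auto
    qed
    ultimately show ?thesis using sh by (auto simp: v_def wh act_uminus_right)
  qed
  obtain Y where Y: "finite Y" "card Y \<le> card ?Keys" "v ` I \<subseteq> fun_vs.span Y"
    by (rule span_by_keys[OF fin_keys key eq])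
  have vY: "act n (tensor w) (s * z) \<in> fun_vs.span Y" if w: "w \<in> words n" and z: "z \<in> galg (pos n)" for w z
    using z
  proof (induction rule: galg_induct)
    case (add a b)
    then show ?case by (simp add: distrib_left act_add_right fun_vs.span_add)
  next
    case (gp k h)
    have "act n (tensor w) (s * gp h) = v (w, h)" by (simp add: v_def)
    also have "\<dots> \<in> fun_vs.span Y" using Y(3) w gp by (auto simp: I_def)
    finally show ?case by (simp only: const_left_commute[of s] act_const fun_vs.span_scale)
  qed
  have tY: "act n t (s * z) \<in> fun_vs.span Y" if t: "t \<in> tensor_power n" and z: "z \<in> galg (pos n)" for t z
    using t
  proof (induction rule: tensor_power_induct)
    case zero
    show ?case by (simp add: fun_vs.span_zero)
  next
    case (step k w t)
    then show ?case unfolding act_add_left act_scale_left by (intro fun_vs.span_add fun_vs.span_scale vY z)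
  qed
  have "act n t (yelem (pos n) r c * y) \<in> fun_vs.span Y" if t: "t \<in> tensor_power n" and y: "y \<in> galg (pos n)" for t y
  proof -
    have "act n t (yelem (pos n) r c * y) = fscale d (act n t (p * (s * (q * y))))"
      unfolding e by (simp only: mult.assoc act_const)
    also have "act n t (p * (s * (q * y))) = act n (act n t p) (s * (q * y))"
      using t y g by (intro act_mult galg_mult)
    finally show ?thesis using tY[OF act_closed[OF t] galg_mult[OF g(3) y]] by (simp add: fun_vs.span_scale)
  qed
  then have "isotypic \<nu> \<subseteq> fun_vs.span Y"
    unfolding isotypic_eq[OF T] by (intro fun_vs.span_minimal fun_vs.subspace_span) auto
  moreover have "card ?Keys = Suc n ^ ((\<alpha> + K) * card (B0 \<union> B1)) * card (labellings \<alpha> K n)"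
    using fin by (simp add: card_cartesian_product card_PiE)
  ultimately show ?thesis using that[OF Y(1)] Y(2) by simp
qed

lemma A_dim_le_card:
  assumes Y: "finite Y" and sub: "tensor_power n \<subseteq> fun_vs.span ((filter_ideal \<Omega> \<inter> tensor_power n) \<union> Y)"
  shows "A_dim \<Omega> n \<le> card Y"
proof -
  let ?W = "filter_ideal \<Omega> \<inter> tensor_power n"
  obtain C where C: "C \<subseteq> ?W" "fun_vs.independent C" "?W \<subseteq> fun_vs.span C" "card C = fun_vs.dim ?W"
    by (rule fun_vs.basis_exists)
  have "C \<subseteq> fun_vs.span (tensor ` words n)" using C(1) tensor_power_span by auto
  then have finC: "finite C" using fun_vs.independent_span_bound[OF finite_imageI[OF finite_words] C(2)] by blast
  have "?W \<union> Y \<subseteq> fun_vs.span (C \<union> Y)"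
    using C(3) fun_vs.span_mono[of C "C \<union> Y"] fun_vs.span_superset[of "C \<union> Y"] by blast
  then have "fun_vs.span (?W \<union> Y) \<subseteq> fun_vs.span (C \<union> Y)"
    by (rule fun_vs.span_minimal[OF _ fun_vs.subspace_span])
  then have "tensor_power n \<subseteq> fun_vs.span (C \<union> Y)" using sub by (rule order_trans[rotated])
  then have "fun_vs.dim (tensor_power n) \<le> card (C \<union> Y)"
    using finC Y by (intro fun_vs.dim_le_card) auto
  also have "\<dots> \<le> card C + card Y" by (rule card_Un_le)
  finally show ?thesis unfolding A_dim_eq dim_tensor_power C(4) by simp
qed

lemma isotypic_in_filter_ideal:
  "\<nu> \<in> \<Omega> \<Longrightarrow> isotypic \<nu> \<subseteq> filter_ideal \<Omega> \<inter> tensor_power (psize \<nu>)"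
  using isotypic_subset unfolding filter_ideal_def by (auto intro: fun_vs.span_base)

text \<open>One half of the hook theorem of Berele and Regev: every word is a word in the
  \<open>card B0\<close> even and \<open>card B1\<close> odd basis letters, so
  \<open>hook_kills_word\<close> applies to all of them.\<close>

lemma isotypic_outside_hook:
  assumes "\<nu> \<in> partitions" "card B1 < \<nu> (card B0)"
  shows "isotypic \<nu> \<subseteq> {0}"
proof -
  let ?n = "psize \<nu>"
  obtain r c where T: "is_tableau \<nu> (pos ?n) r c" by (rule standard_tableau[OF assms(1)])
  have "act ?n t (yelem (pos ?n) r c) = 0" if "t \<in> tensor_power ?n" for t
    using that
  proof (induction rule: tensor_power_induct)
    case (step k w t)
    have "act ?n (tensor w) (yelem (pos ?n) r c) = 0"
      by (rule hook_kills_word[of B0 B1, OF _ _ _ _ T assms(2)]) (use step in \<open>auto simp: words_def\<close>)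
    then show ?case unfolding act_add_left act_scale_left using step by simp
  qed simp
  then have "act ?n t (yelem (pos ?n) r c * y) = 0" if "t \<in> tensor_power ?n" "y \<in> galg (pos ?n)" for t y
    using that act_mult[OF that(1) yelem_galg that(2)] by simp
  then show ?thesis
    unfolding isotypic_eq[OF T] by (intro fun_vs.span_minimal fun_vs.subspace_single_0) auto
qed

text \<open>Modulo the ideal the tensor power is spanned by the components of hook partitions
  outside \<open>\<Omega>\<close>. There are polynomially many of them, and each is spanned by at
  most the number of vectors given by \<open>isotypic_span\<close>.\<close>

lemma A_dim_upper:
  assumes rest: "\<And>\<nu>. \<nu> \<in> partitions \<Longrightarrow> \<nu> \<notin> \<Omega> \<Longrightarrow> \<nu> (card B0) \<le> card B1 \<Longrightarrow>
      \<exists>a b. a + b \<le> \<alpha> \<and> finite {(i, j). a \<le> i \<and> b \<le> j \<and> j < \<nu> i} \<and>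
        card {(i, j). a \<le> i \<and> b \<le> j \<and> j < \<nu> i} \<le> K"
  shows "A_dim \<Omega> n \<le> Suc n ^ (card B0 + card B1 + (\<alpha> + K) * card (B0 \<union> B1)) * card (labellings \<alpha> K n)"
proof -
  let ?H = "{\<nu> \<in> partitions. psize \<nu> = n \<and> \<nu> (card B0) \<le> card B1}"
  let ?N = "Suc n ^ ((\<alpha> + K) * card (B0 \<union> B1)) * card (labellings \<alpha> K n)"
  have "\<exists>Y. finite Y \<and> isotypic \<nu> \<subseteq> fun_vs.span Y \<and> card Y \<le> ?N" if \<nu>: "\<nu> \<in> ?H - \<Omega>" for \<nu>
  proof -
    obtain a b where ab: "a + b \<le> \<alpha>" and fin: "finite {(i, j). a \<le> i \<and> b \<le> j \<and> j < \<nu> i}"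
      and card: "card {(i, j). a \<le> i \<and> b \<le> j \<and> j < \<nu> i} \<le> K"
      using rest[of \<nu>] \<nu> by blast
    have "\<nu> \<in> partitions" and n: "psize \<nu> = n" using \<nu> by auto
    from this(1) obtain r c where T: "is_tableau \<nu> (pos n) r c" unfolding n[symmetric] by (rule standard_tableau)
    have "card {x\<in>pos n. a \<le> r x \<and> b \<le> c x} \<le> card {(i, j). a \<le> i \<and> b \<le> j \<and> j < \<nu> i}"
      by (rule card_inj_on_le[of "\<lambda>x. (r x, c x)", OF _ _ fin])
         (use tableau_inj[OF T] tableau_in[OF T] in \<open>auto simp: inj_on_def\<close>)
    then have "card {x\<in>pos n. a \<le> r x \<and> b \<le> c x} \<le> K" using card by simp
    then obtain Y where "finite Y" "isotypic \<nu> \<subseteq> fun_vs.span Y" "card Y \<le> ?N"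
      by (rule isotypic_span[OF T ab])
    then show ?thesis by blast
  qed
  then have "\<forall>\<nu>\<in>?H - \<Omega>. \<exists>Y. finite Y \<and> isotypic \<nu> \<subseteq> fun_vs.span Y \<and> card Y \<le> ?N" by blast
  then obtain Y where Y: "\<forall>\<nu>\<in>?H - \<Omega>. finite (Y \<nu>) \<and> isotypic \<nu> \<subseteq> fun_vs.span (Y \<nu>) \<and> card (Y \<nu>) \<le> ?N"
    unfolding bchoice_iff ..
  let ?Y = "\<Union>\<nu>\<in>?H - \<Omega>. Y \<nu>" and ?W = "filter_ideal \<Omega> \<inter> tensor_power n"
  have finH: "finite (?H - \<Omega>)" using hook_partitions(1) by (rule finite_Diff)
  then have finY: "finite ?Y" using Y by blast
  have "isotypic \<nu> \<subseteq> fun_vs.span (?W \<union> ?Y)" if \<nu>: "\<nu> \<in> partitions" "psize \<nu> = n" for \<nu>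
  proof -
    consider "\<nu> \<in> \<Omega>" | "card B1 < \<nu> (card B0)" | "\<nu> \<in> ?H - \<Omega>" using \<nu> by force
    then show ?thesis
    proof cases
      case 1
      then have "isotypic \<nu> \<subseteq> ?W \<union> ?Y" using isotypic_in_filter_ideal[OF 1] \<nu>(2) by auto
      also have "\<dots> \<subseteq> fun_vs.span (?W \<union> ?Y)" by (rule fun_vs.span_superset)
      finally show ?thesis .
    next
      case 2
      then show ?thesis using isotypic_outside_hook[OF \<nu>(1)] fun_vs.span_zero by blast
    next
      case 3
      then have "isotypic \<nu> \<subseteq> fun_vs.span (Y \<nu>)" using Y by blast
      also have "\<dots> \<subseteq> fun_vs.span (?W \<union> ?Y)" using 3 by (intro fun_vs.span_mono) blast
      finally show ?thesis .
    qed
  qed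
  then have "fun_vs.span (\<Union>\<nu>\<in>{\<nu>\<in>partitions. psize \<nu> = n}. isotypic \<nu>) \<subseteq> fun_vs.span (?W \<union> ?Y)"
    by (intro fun_vs.span_minimal fun_vs.subspace_span) blast
  then have "tensor_power n \<subseteq> fun_vs.span (?W \<union> ?Y)" using tensor_power_decomposition by (rule order_trans[rotated])
  then have "A_dim \<Omega> n \<le> card ?Y" by (rule A_dim_le_card[OF finY])
  also have "\<dots> \<le> (\<Sum>\<nu>\<in>?H - \<Omega>. card (Y \<nu>))" by (rule card_UN_le[OF finH])
  also have "\<dots> \<le> (\<Sum>\<nu>\<in>?H - \<Omega>. ?N)" by (rule sum_mono) (use Y in blast)
  also have "\<dots> = card (?H - \<Omega>) * ?N" by simp
  also have "\<dots> \<le> Suc n ^ (card B0 + card B1) * ?N"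
    using card_mono[OF hook_partitions(1)[of n "card B0" "card B1"], of "?H - \<Omega>"]
      hook_partitions(2)[of n "card B0" "card B1"]
    by (intro mult_right_mono) auto
  finally show ?thesis by (simp add: power_add mult.assoc)
qed

end

section \<open>The exponent\<close>

lemma (in super_vector_space) homogeneous_basis_exists:
  assumes "finite B" "local.span B = UNIV"
  obtains B0 B1 where "homogeneous_basis scale V0 V1 B0 B1"
    "card B0 = local.dim V0" "card B1 = local.dim V1"
proof -
  obtain B0 where B0: "B0 \<subseteq> V0" "local.independent B0" "V0 \<subseteq> local.span B0" "card B0 = local.dim V0"
    by (rule local.basis_exists)
  obtain B1 where B1: "B1 \<subseteq> V1" "local.independent B1" "V1 \<subseteq> local.span B1" "card B1 = local.dim V1"
    by (rule local.basis_exists)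
  have fin: "finite B0" "finite B1"
    using local.independent_span_bound[OF assms(1)] B0(2) B1(2) assms(2) by auto
  have sp: "local.span B0 \<subseteq> V0" "local.span B1 \<subseteq> V1"
    using local.span_minimal B0(1) B1(1) subspace_V0 subspace_V1 by auto
  have disj: "B0 \<inter> B1 = {}"
  proof (rule ccontr)
    assume "B0 \<inter> B1 \<noteq> {}"
    then obtain v where "v \<in> B0" "v \<in> B1" by blast
    then have "v = 0" "v \<in> B0" using B0(1) B1(1) V0_inter_V1 by auto
    then show False using B0(2) local.dependent_zero by blast
  qed
  have ind: "local.independent (B0 \<union> B1)"
  proof (rule local.independent_if_scalars_zero)
    show "finite (B0 \<union> B1)" using fin by simp
    fix f x assume s: "(\<Sum>x\<in>B0 \<union> B1. scale (f x) x) = 0" and x: "x \<in> B0 \<union> B1"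
    have s': "(\<Sum>x\<in>B0. scale (f x) x) + (\<Sum>x\<in>B1. scale (f x) x) = 0"
      using s fin disj by (simp add: sum.union_disjoint)
    have in0: "(\<Sum>x\<in>B0. scale (f x) x) \<in> V0"
      using sp(1) local.span_sum local.span_scale local.span_base by (metis (no_types, lifting) subsetD)
    have in1: "(\<Sum>x\<in>B1. scale (f x) x) \<in> V1"
      using sp(2) local.span_sum local.span_scale local.span_base by (metis (no_types, lifting) subsetD)
    have "(\<Sum>x\<in>B0. scale (f x) x) = - (\<Sum>x\<in>B1. scale (f x) x)"
      using s' by (simp add: eq_neg_iff_add_eq_0)
    then have "(\<Sum>x\<in>B0. scale (f x) x) \<in> V0 \<inter> V1"
      using in0 local.subspace_neg[OF subspace_V1 in1] by simp
    then have z: "(\<Sum>x\<in>B0. scale (f x) x) = 0" "(\<Sum>x\<in>B1. scale (f x) x) = 0"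
      using V0_inter_V1 s' by auto
    show "f x = 0"
      using x local.independentD[OF B0(2) fin(1) order_refl z(1)] local.independentD[OF B1(2) fin(2) order_refl z(2)]
      by blast
  qed
  have "v \<in> local.span (B0 \<union> B1)" for v
  proof -
    obtain a b where ab: "a \<in> V0" "b \<in> V1" "v = a + b" using V0_plus_V1 by blast
    have "a \<in> local.span (B0 \<union> B1)" using ab(1) B0(3) local.span_mono[of B0 "B0 \<union> B1"] by blast
    moreover have "b \<in> local.span (B0 \<union> B1)" using ab(2) B1(3) local.span_mono[of B1 "B0 \<union> B1"] by blast
    ultimately show ?thesis unfolding ab(3) by (rule local.span_add)
  qed
  then have "homogeneous_basis scale V0 V1 B0 B1"
    using fin B0(1) B1(1) disj ind by unfold_locales auto
  then show ?thesis using B0(4) B1(4) by (rule that)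
qed

text \<open>
  A partition avoiding the filter is bounded by its rows of length at least \<open>M\<close> and its columns
  of height at least \<open>M\<close>: if there were too many of them, it would contain an element of the filter.
\<close>

lemma partition_thick_hook:
  assumes \<Omega>: "partition_filter \<Omega>" and \<nu>: "\<nu> \<in> partitions" "\<nu> \<notin> \<Omega>" "\<nu> k \<le> l"
    and M: "k < M" "l < M"
    and small: "\<And>a b. a \<le> k \<Longrightarrow> b \<le> l \<Longrightarrow> \<alpha> < a + b \<Longrightarrow> \<exists>\<kappa>\<in>\<Omega>. \<kappa> a \<le> b \<and> psize \<kappa> < M"
  shows "\<exists>a b. a + b \<le> \<alpha> \<and> finite {(i, j). a \<le> i \<and> b \<le> j \<and> j < \<nu> i} \<and>
    card {(i, j). a \<le> i \<and> b \<le> j \<and> j < \<nu> i} \<le> M * M"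
proof -
  have anti: "\<nu> j \<le> \<nu> i" if "i \<le> j" for i j using \<nu>(1) that antimonoD[of \<nu> i j] by (simp add: partitions_def)
  \<comment> \<open>\<open>a\<close> is the number of rows of length at least \<open>M\<close>, and
    \<open>b\<close>, the length of the row with index \<open>M - 1\<close>, is the number of
    columns of height at least \<open>M\<close>.\<close>
  define a where "a = (LEAST i. \<nu> i < M)"
  define b where "b = \<nu> (M - 1)"
  have "\<nu> k < M" using \<nu>(3) M by simp
  then have a: "\<nu> a < M" "a \<le> k" unfolding a_def by (rule LeastI, rule Least_le)
  have a': "M \<le> \<nu> i" if "i < a" for i using not_less_Least[of i "\<lambda>i. \<nu> i < M"] that unfolding a_def by simp
  have "k \<le> M - 1" using M by simp
  then have b: "b \<le> l" using anti[of k "M - 1"] \<nu>(3) unfolding b_def by linarith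
  have "a + b \<le> \<alpha>"
  proof (rule ccontr)
    assume "\<not> a + b \<le> \<alpha>"
    then obtain \<kappa> where \<kappa>: "\<kappa> \<in> \<Omega>" "\<kappa> a \<le> b" "psize \<kappa> < M" using small[OF a(2) b] by auto
    have \<kappa>p: "\<kappa> \<in> partitions" using \<Omega> \<kappa>(1) by (auto simp: partition_filter_def)
    \<comment> \<open>Rows of \<open>\<kappa>\<close> before \<open>a\<close> are shorter than
      \<open>M\<close>. Its later nonzero rows have index below \<open>M\<close> and length at most
      \<open>b\<close>, hence fit under the row of \<open>\<nu>\<close> with index
      \<open>M - 1\<close>.\<close>
    have "\<kappa> i \<le> \<nu> i" for i
    proof (cases "i < a")
      case True
      then show ?thesis using a'[OF True] partition_le_psize(1)[OF \<kappa>p, of i] \<kappa>(3) by simp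
    next
      case False
      show ?thesis
      proof (cases "\<kappa> i = 0")
        case nz: False
        have "\<kappa> i \<le> \<kappa> a" using \<kappa>p False antimonoD[of \<kappa> a i] by (simp add: partitions_def)
        also have "\<dots> \<le> \<nu> (M - 1)" using \<kappa>(2) by (simp add: b_def)
        also have "\<dots> \<le> \<nu> i" using partition_le_psize(2)[OF \<kappa>p nz] \<kappa>(3) by (intro anti) simp
        finally show ?thesis .
      qed simp
    qed
    then have "\<kappa> \<le> \<nu>" by (simp add: le_fun_def)
    then show False using \<Omega> \<kappa>(1) \<nu>(1,2) unfolding partition_filter_def by blast
  qed
  \<comment> \<open>A row that reaches beyond the first \<open>b\<close> columns has index below
    \<open>M\<close>, and from row \<open>a\<close> on all rows are shorter than \<open>M\<close>.
    The leftover boxes thus lie in a square, which is the origin of \<open>M * M\<close>.\<close>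
  moreover have sub: "{(i, j). a \<le> i \<and> b \<le> j \<and> j < \<nu> i} \<subseteq> {..<M} \<times> {..<M}"
  proof clarsimp
    fix i j assume ij: "a \<le> i" "b \<le> j" "j < \<nu> i"
    have "i < M"
    proof (rule ccontr)
      assume "\<not> i < M"
      then have "\<nu> i \<le> b" unfolding b_def by (intro anti) simp
      then show False using ij by simp
    qed
    then show "i < M \<and> j < M" using ij anti[OF ij(1)] a(1) by simp
  qed
  moreover have "finite {(i, j). a \<le> i \<and> b \<le> j \<and> j < \<nu> i}"
    using finite_subset[OF sub] by simp
  moreover have "card {(i, j). a \<le> i \<and> b \<le> j \<and> j < \<nu> i} \<le> M * M"
    using card_mono[OF _ sub] by (simp add: card_cartesian_product)
  ultimately show ?thesis by blast
qed

lemma (in homogeneous_basis) A_dim_exponent: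
  assumes \<Omega>: "partition_filter \<Omega>"
  obtains \<alpha> where "\<alpha> \<le> card B0 + card B1" "Exp_eq (\<lambda>n. real (A_dim \<Omega> n)) (real \<alpha>)"
proof -
  let ?k = "card B0" and ?l = "card B1"
  have part: "\<Omega> \<subseteq> partitions" using \<Omega> by (simp add: partition_filter_def)
  define S where "S = {(a, b). a \<le> ?k \<and> b \<le> ?l \<and> (\<forall>\<nu>\<in>\<Omega>. b < \<nu> a)}"
  have finS: "finite S" by (rule finite_subset[of _ "{..?k} \<times> {..?l}"]) (auto simp: S_def)
  show ?thesis
  proof (cases "S = {}")
    case True
    \<comment> \<open>The pair \<open>(0, 0)\<close> fails only if the empty partition lies in
      \<open>\<Omega>\<close>; then the filter contains every partition and the quotient is zero in
      all degrees.\<close>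
    then have "(0, 0) \<notin> S" by simp
    then obtain \<kappa> where \<kappa>: "\<kappa> \<in> \<Omega>" "\<kappa> 0 = 0" by (auto simp: S_def)
    have "\<kappa> i = 0" for i using \<kappa> part antimonoD[of \<kappa> 0 i] by (auto simp: partitions_def)
    then have all: "\<nu> \<in> \<Omega>" if "\<nu> \<in> partitions" for \<nu>
      using that \<Omega> \<kappa>(1) unfolding partition_filter_def le_fun_def by (metis le0)
    have "A_dim \<Omega> n = 0" for n
    proof -
      have "isotypic \<nu> \<subseteq> filter_ideal \<Omega> \<inter> tensor_power n" if "\<nu> \<in> partitions" "psize \<nu> = n" for \<nu>
        using isotypic_in_filter_ideal[OF all[OF that(1)]] that(2) by simp
      then have "fun_vs.span (\<Union>\<nu>\<in>{\<nu>\<in>partitions. psize \<nu> = n}. isotypic \<nu>) \<subseteq>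
          fun_vs.span (filter_ideal \<Omega> \<inter> tensor_power n)"
        by (intro fun_vs.span_mono) blast
      then have "tensor_power n \<subseteq> fun_vs.span (filter_ideal \<Omega> \<inter> tensor_power n)"
        using tensor_power_decomposition by (rule order_trans[rotated])
      then show ?thesis using A_dim_le_card[of "{}" n \<Omega>] by simp
    qed
    then show ?thesis by (intro that[of 0]) (auto simp: Exp_eq_def)
  next
    case False
    define \<alpha> where "\<alpha> = Max ((\<lambda>(a, b). a + b) ` S)"
    have "\<alpha> \<in> (\<lambda>(a, b). a + b) ` S" unfolding \<alpha>_def using finS False by (intro Max_in) auto
    then obtain a b where ab: "(a, b) \<in> S" "\<alpha> = a + b" by auto
    have max: "a + b \<le> \<alpha>" if "(a, b) \<in> S" for a b
      unfolding \<alpha>_def using that finS by (intro Max_ge) force+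
    have "a \<le> ?k" "b \<le> ?l" using ab(1) by (auto simp: S_def)
    then obtain A0 A1 where A: "A0 \<subseteq> B0" "card A0 = a" "A1 \<subseteq> B1" "card A1 = b"
      using obtain_subset_with_card_n by metis
    have lower: "\<alpha> ^ n \<le> A_dim \<Omega> n" for n
      unfolding ab(2) using ab(1) by (intro A_dim_lower[OF A(1,3,2,4) part]) (auto simp: S_def)
    define Bad where "Bad = {..?k} \<times> {..?l} - S"
    have "\<forall>p\<in>Bad. \<exists>\<kappa>. \<kappa> \<in> \<Omega> \<and> \<kappa> (fst p) \<le> snd p" by (auto simp: Bad_def S_def not_less)
    then obtain \<kappa> where \<kappa>: "\<forall>p\<in>Bad. \<kappa> p \<in> \<Omega> \<and> \<kappa> p (fst p) \<le> snd p"
      unfolding bchoice_iff ..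
    \<comment> \<open>Exceeds \<open>?k\<close>, \<open>?l\<close> and the size of the chosen
      witness in \<open>\<Omega>\<close> for every pair outside \<open>S\<close>, so that one
      threshold serves all pairs.\<close>
    define M where "M = Suc (?k + ?l + (\<Sum>p\<in>Bad. psize (\<kappa> p)))"
    have finBad: "finite Bad" by (simp add: Bad_def)
    have small: "\<exists>\<mu>\<in>\<Omega>. \<mu> a \<le> b \<and> psize \<mu> < M" if "a \<le> ?k" "b \<le> ?l" "\<alpha> < a + b" for a b
    proof
      have p: "(a, b) \<in> Bad" using that max[of a b] by (auto simp: Bad_def)
      show "\<kappa> (a, b) \<in> \<Omega>" using \<kappa> p by blast
      have "psize (\<kappa> (a, b)) \<le> (\<Sum>p\<in>Bad. psize (\<kappa> p))"
        using member_le_sum[OF p _ finBad, of "\<lambda>p. psize (\<kappa> p)"] by simp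
      then show "\<kappa> (a, b) a \<le> b \<and> psize (\<kappa> (a, b)) < M" using \<kappa> p by (auto simp: M_def)
    qed
    define E where "E = ?k + ?l + (\<alpha> + M * M) * card (B0 \<union> B1)"
    have upper: "A_dim \<Omega> n \<le> Suc n ^ E * card (labellings \<alpha> (M * M) n)" for n
      unfolding E_def
      by (rule A_dim_upper, rule partition_thick_hook[OF \<Omega>, where k = "?k" and l = "?l"])
         (use small in \<open>auto simp: M_def\<close>)
    have "\<alpha> \<le> ?k + ?l" using ab by (auto simp: S_def)
    moreover have "Exp_eq (\<lambda>n. real (A_dim \<Omega> n)) (real \<alpha>)"
    \<comment> \<open>For exponent 0 a few initial dimensions may be positive. The labellings run
      out once \<open>n\<close> exceeds \<open>M * M\<close>, which gives the eventual vanishing in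
      \<open>Exp_eq\<close>; the bound of \<open>card_labellings\<close> is for positive
      \<open>\<alpha>\<close>.\<close>
    proof (cases "\<alpha> = 0")
      case True
      have "A_dim \<Omega> n = 0" if "M * M < n" for n
        using upper[of n] labellings_0[OF that] True by simp
      then have "eventually (\<lambda>n. real (A_dim \<Omega> n) = 0) sequentially"
        by (intro eventually_mono[OF eventually_gt_at_top[of "M * M"]]) simp
      then show ?thesis using True by (simp add: Exp_eq_def)
    next
      case False
      have "Exp_ge (\<lambda>n. real (A_dim \<Omega> n)) (real \<alpha>)"
        unfolding Exp_ge_def
      proof (intro exI[of _ 1] always_eventually allI conjI)
        fix n show "poly 1 (real n) * real \<alpha> ^ n \<le> real (A_dim \<Omega> n)"
          using lower[of n] by (simp flip: of_nat_power)
      qed simp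
      moreover have "Exp_le (\<lambda>n. real (A_dim \<Omega> n)) (real \<alpha>)"
        unfolding Exp_le_def
      \<comment> \<open>The polynomial \<open>[:1, 1:]\<close> is \<open>n + 1\<close>.
        \<open>E\<close> collects the exponents from hook partitions and letter counts, and
        \<open>M * M\<close> those from the positions of the leftover labels.\<close>
      proof (intro exI[of _ "[:1, 1:] ^ (E + M * M)"] always_eventually allI conjI)
        fix n
        have poly: "poly ([:1, 1:] ^ (E + M * M)) (real n) = real (Suc n ^ (E + M * M))"
          by (simp add: poly_power)
        show "0 < poly ([:1, 1:] ^ (E + M * M)) (real n)" unfolding poly by simp
        have "A_dim \<Omega> n \<le> Suc n ^ E * (Suc n ^ (M * M) * \<alpha> ^ n)"
          using upper[of n] card_labellings[of \<alpha> "M * M" n] False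
          by (meson mult_left_mono order_trans zero_le neq0_conv)
        also have "\<dots> = Suc n ^ (E + M * M) * \<alpha> ^ n" by (simp add: power_add mult.assoc)
        finally have "real (A_dim \<Omega> n) \<le> real (Suc n ^ (E + M * M) * \<alpha> ^ n)" by (rule of_nat_mono)
        then show "real (A_dim \<Omega> n) \<le> poly ([:1, 1:] ^ (E + M * M)) (real n) * real \<alpha> ^ n"
          unfolding poly by (simp only: of_nat_mult of_nat_power)
      qed
      ultimately show ?thesis by (simp add: Exp_eq_def)
    qed
    ultimately show ?thesis by (rule that)
  qed
qed

theorem theorem5p2:
  fixes scale :: "'f::field_char_0 \<Rightarrow> 'v::ab_group_add \<Rightarrow> 'v"
    and V0 V1 :: "'v set"
    and \<Omega> :: "(nat \<Rightarrow> nat) set"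
  assumes "super_vector_space scale V0 V1"
    and "\<exists>B. finite B \<and> module.span scale B = (UNIV :: 'v set)"
    and "partition_filter \<Omega>"
  shows "\<exists>\<alpha>::int. 0 \<le> \<alpha> \<and>
           \<alpha> \<le> int (vector_space.dim scale V0 + vector_space.dim scale V1) \<and>
           Exp_eq (\<lambda>n. real (super_vector_space.A_dim scale V0 V1 \<Omega> n)) (real_of_int \<alpha>)"
proof -
  interpret super_vector_space scale V0 V1 by (rule assms(1))
  obtain B where "finite B" "local.span B = UNIV" using assms(2) by blast
  then obtain B0 B1 where hb: "homogeneous_basis scale V0 V1 B0 B1"
    and dims: "card B0 = local.dim V0" "card B1 = local.dim V1"
    by (rule homogeneous_basis_exists)
  interpret homogeneous_basis scale V0 V1 B0 B1 by (rule hb)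
  obtain \<alpha> where \<alpha>: "\<alpha> \<le> card B0 + card B1" "Exp_eq (\<lambda>n. real (A_dim \<Omega> n)) (real \<alpha>)"
    by (rule A_dim_exponent[OF assms(3)])
  then show ?thesis unfolding dims by (intro exI[of _ "int \<alpha>"]) simp
qed

end
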